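(* Let $(X,\sigma_X)$ be an irreducible (one-step) shift of finite type, $(Y,\sigma_Y)$ a subshift, $\pi:X\to Y$ a one-block factor map, and $f\in C(X)$ a function in the Bowen class. Let $g_n$ be the functions on $Y$ associated to $f$ and $\pi$ as in the context, and let $m$ be the unique Gibbs equilibrium state for $\mathcal G=\{\log g_n\}_{n=1}^\infty$. Suppose that $h\in C(Y)$ satisfies one of the following equivalent statements: (a) $P(\sigma_X,\pi,f-h\circ\pi)(y)=0$ for every periodic point $y\in Y$ (equivalently, $\lim_{n\to\infty}\frac1n\log(g_n(y)/e^{(S_nh)(y)})=0$ for every periodic point $y\in Y$); (b) $f-h\circ\pi$ is a compensation function for $\pi$; (c) $\lim_{n\to\infty}\frac1n\log(g_n(y)/e^{(S_nh)(y)})=0$ for every $y\in Y$; (d) $\mathcal G$ is asymptotically additive on $Y$ and $\lim_{n\to\infty}\frac1n\lVert\log(g_n/e^{S_nh})\rVert_\infty=0$; (e) $\int P(\sigma_X,\pi,f)\,d\mu=\int h\,d\mu$ for all $\mu\in M(Y,\sigma_Y)$. Then (i) $m$ is an invariant weak Gibbs measure for $h$. (ii) There exists a sequence $\{C_{n,l}\}_{n,l\in\mathbb N}$ such that $\frac1{C_{n,l}}\le\frac{g_{n+l}(y)}{g_n(y)g_l(\sigma_Y^ny)}\le C_{n,l}$ for all $y\in Y$, $n,l\in\mathbb N$, where $\lim_{n\to\infty}\frac1n\log C_{n,l}=\lim_{l\to\infty}\frac1l\log C_{n,l}=0$. (iii) If $m$ is a Gibbs measure for a continuous function, then $\mathcal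 G$ is almost additive. Hence, whenever $(X,\sigma_X)$ is an irreducible (one-step) shift of finite type, $(Y,\sigma_Y)$ is a subshift, $\pi:X\to Y$ is a one-block factor map and $f\in C(X)$ is a function in the Bowen class, if there is no sequence $\{C_{n,l}\}_{n,l\in\mathbb N}$ as in (ii), then there does not exist a continuous function $h$ on $Y$ such that $\int P(\sigma_X,\pi,f)\,d\mu=\int h\,d\mu$ for every $\mu\in M(Y,\sigma_Y)$.
   Context: $\mathbb N=\{1,2,\dots\}$. A (one-sided) subshift $(X,\sigma_X)$ is a closed set $X\subseteq\{1,\dots,k\}^{\mathbb N}$ (some $k\ge1$) with $\sigma_X(X)\subseteq X$, where $(\sigma_Xx)_i=x_{i+1}$. The metric is $d(x,x')=2^{-k}$ if $x_i=x_i'$ for $1\le i\le k$ and $x_{k+1}\ne x'_{k+1}$, $d(x,x')=1$ if $x_1\neq x_1'$, and $d(x,x)=0$. $B_n(X)$ is the set of words of length $n$ appearing in points of $X$, $B_0(X)=\{\epsilon\}$ (empty word), $B(X)=\bigcup_{n\ge0}B_n(X)$. The cylinder $[x_1\dots x_n]$ is the set of $z\in X$ with $z_i=x_i$ for $1\le i\le n$. $X$ is irreducible if for all $u,v\in B(X)$ there is $w\in B(X)$ with $uwv\in B(X)$. Shifts of finite type are one-step: $X$ is the set of all sequences in $\{1,\dots,k\}^{\mathbb N}$ in which no word of a given set of forbidden blocks of length $\le2$ appears. $x$ is periodic if $\sigma_X^lx=x$ for some $l\in\mathbb N$. $M(X,\sigma_X)$ is the set of $\sigma_X$-invariant Borel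 probability measures; $h_\mu(\sigma_X)$ is measure-theoretic entropy; $(S_nf)(x)=\sum_{i=0}^{n-1}f(\sigma_X^ix)$. $f\in C(X)$ is in the Bowen class if $\sup_{n}\sup\{e^{(S_nf)(x)}/e^{(S_nf)(y)}:x_i=y_i,\ 1\le i\le n\}<\infty$. A factor map $\pi:X\to Y$ is a continuous surjection with $\pi\circ\sigma_X=\sigma_Y\circ\pi$; it is one-block if $\pi(x)_i$ depends only on $x_i$, so $\pi$ acts on words. Relative pressure: for $f\in C(X)$, $n\in\mathbb N$, $\delta>0$, $y\in Y$, let $P_n(\sigma_X,\pi,f,\delta)(y)=\sup\{\sum_{x\in E}e^{(S_nf)(x)}: E\text{ is an }(n,\delta)\text{-separated subset of }\pi^{-1}(\{y\})\}$, $P(\sigma_X,\pi,f,\delta)(y)=\limsup_{n\to\infty}\frac1n\log P_n(\sigma_X,\pi,f,\delta)(y)$, and $P(\sigma_X,\pi,f)(y)=\lim_{\delta\to0}P(\sigma_X,\pi,f,\delta)(y)$. The functions $g_n$: for $y\in Y$ let $E_n(y)$ denote a set consisting of exactly one point from each cylinder $[x_1\dots x_n]$ in $X$ such that $\pi(x_1\dots x_n)=y_1\dots y_n$; set $g_n(y)=\sup_{E_n(y)}\sum_{x\in E_n(y)}e^{(S_nf)(x)}$, the supremum over all such choices $E_n(y)$. $F\in C(X)$ is a compensation function for $\pi$ if $\sup_{\mu\in M(X,\sigma_X)}\{h_\mu(\sigma_X)+\int F\,d\mu+\int\phi\circ\pi\,d\mu\}=\sup_{\nu\in M(Y,\sigma_Y)}\{h_\nu(\sigma_Y)+\int\phi\,d\nu\}$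 for every $\phi\in C(Y)$. Let $\mathcal F=\{\log f_n\}_{n=1}^\infty$ with $f_n:X\to(0,\infty)$ continuous on a subshift $X$. $\mathcal F$ is almost additive if there is $C\ge0$ with $e^{-C}f_n(x)f_l(\sigma_X^nx)\le f_{n+l}(x)\le e^Cf_n(x)f_l(\sigma_X^nx)$ for all $n,l,x$. It is asymptotically additive if for every $\epsilon>0$ there is a continuous $\rho_\epsilon$ with $\limsup_{n\to\infty}\frac1n\lVert\log f_n-S_n\rho_\epsilon\rVert_\infty<\epsilon$ (supremum norm). The topological pressure is $P(\mathcal F)=\limsup_{n\to\infty}\frac1n\log\sum_{u\in B_n(X)}\sup\{f_n(x):x\in[u]\}$; for subadditive $\mathcal F$ (i.e. $f_{n+l}(x)\le f_n(x)f_l(\sigma_X^nx)$) one has $P(\mathcal F)=\sup_{\mu\in M(X,\sigma_X)}\{h_\mu(\sigma_X)+\lim_n\frac1n\int\log f_n\,d\mu\}$ and an equilibrium state is a $\mu$ attaining this supremum. If $P(\mathcal F)\neq-\infty$, $\mu\in M(X,\sigma_X)$ is a weak Gibbs measure for $\mathcal F$ if there are $C_n>0$ with $\lim_n\frac1n\log C_n=0$ and $\frac1{C_n}<\frac{\mu[x_1\dots x_n]}{e^{-nP(\mathcal F)}f_n(x)}<C_n$ for every $x\in X$, $n\in\mathbb N$; it is a Gibbs measure if $C_n$ can be taken independent of $n$. For a continuous function $h$, these notions refer to $f_n=e^{S_nh}$. It is known that when $f$ is in the Bowen class, the subadditive sequence $\mathcal G$ has a unique invariant Gibbs measure, which is its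 unique equilibrium state (the unique Gibbs equilibrium state). *)

theory Defs
  imports "HOL-Probability.Probability"
begin

text \<open>
  Sequences \<open>x\<^sub>1 x\<^sub>2 \<dots>\<close> are functions \<open>nat \<Rightarrow> nat\<close>, with \<open>x\<^sub>i\<^sub>+\<^sub>1\<close> stored at index \<open>i\<close>.
  Topology and Borel sets are those of the product of countably many copies of the discrete
  space \<open>nat\<close>; on \<open>{1..k}\<close>-valued sequences this is the topology of \<open>seq_dist\<close> below.
  Functions on a subshift \<open>X\<close> are total functions whose values outside \<open>X\<close> are irrelevant.
\<close>

type_synonym seq = "nat \<Rightarrow> nat"


subsection \<open>Subshifts and words\<close>

definition shift_map :: "seq \<Rightarrow> seq" where
  "shift_map x = (\<lambda>i. x (Suc i))"

definition full_shift :: "nat \<Rightarrow> seq set" where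
  "full_shift k = {x. \<forall>i. x i \<in> {1..k}}"

definition subshift :: "seq set \<Rightarrow> bool" where
  "subshift X \<longleftrightarrow> (\<exists>k\<ge>1. X \<subseteq> full_shift k) \<and> closed X \<and> shift_map ` X \<subseteq> X"

definition seq_dist :: "seq \<Rightarrow> seq \<Rightarrow> real" where
  "seq_dist x x' = (if x = x' then 0 else (1/2) ^ (LEAST i. x i \<noteq> x' i))"

definition word_at :: "seq \<Rightarrow> nat \<Rightarrow> nat \<Rightarrow> nat list" where
  "word_at x i n = map x [i..<i+n]"

definition words_of_length :: "seq set \<Rightarrow> nat \<Rightarrow> nat list set" where
  "words_of_length X n = (if n = 0 then {[]} else {word_at x i n | x i. x \<in> X})"

definition words :: "seq set \<Rightarrow> nat list set" where
  "words X = (\<Union>n. words_of_length X n)"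

definition cylinder :: "seq set \<Rightarrow> nat list \<Rightarrow> seq set" where
  "cylinder X u = {z \<in> X. word_at z 0 (length u) = u}"

definition irreducible_shift :: "seq set \<Rightarrow> bool" where
  "irreducible_shift X \<longleftrightarrow> (\<forall>u\<in>words X. \<forall>v\<in>words X. \<exists>w\<in>words X. u @ w @ v \<in> words X)"

definition one_step_sft :: "seq set \<Rightarrow> bool" where
  "one_step_sft X \<longleftrightarrow> (\<exists>k\<ge>1. \<exists>F. (\<forall>w\<in>F. length w \<le> 2) \<and>
     X = {x \<in> full_shift k. \<forall>w\<in>F. \<forall>i. word_at x i (length w) \<noteq> w})"

definition periodic_point :: "seq \<Rightarrow> bool" where
  "periodic_point x \<longleftrightarrow> (\<exists>l\<ge>1. (shift_map ^^ l) x = x)"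

definition factor_map :: "seq set \<Rightarrow> seq set \<Rightarrow> (seq \<Rightarrow> seq) \<Rightarrow> bool" where
  "factor_map X Y \<pi> \<longleftrightarrow> continuous_on X \<pi> \<and> \<pi> ` X = Y \<and>
     (\<forall>x\<in>X. \<pi> (shift_map x) = shift_map (\<pi> x))"

text \<open>\<open>\<Phi>\<close> is the map on symbols inducing \<open>\<pi>\<close>; the action of \<open>\<pi>\<close> on words is \<open>map \<Phi>\<close>.\<close>

definition one_block :: "seq set \<Rightarrow> (seq \<Rightarrow> seq) \<Rightarrow> (nat \<Rightarrow> nat) \<Rightarrow> bool" where
  "one_block X \<pi> \<Phi> \<longleftrightarrow> (\<forall>x\<in>X. \<forall>i. \<pi> x i = \<Phi> (x i))"

definition birkhoff_sum :: "nat \<Rightarrow> (seq \<Rightarrow> real) \<Rightarrow> seq \<Rightarrow> real" where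
  "birkhoff_sum n f x = (\<Sum>i<n. f ((shift_map ^^ i) x))"

definition bowen_class :: "seq set \<Rightarrow> (seq \<Rightarrow> real) \<Rightarrow> bool" where
  "bowen_class X f \<longleftrightarrow> continuous_on X f \<and>
     (\<exists>K. \<forall>n\<ge>1. \<forall>x\<in>X. \<forall>y\<in>X. (\<forall>i<n. x i = y i) \<longrightarrow>
        exp (birkhoff_sum n f x) / exp (birkhoff_sum n f y) \<le> K)"


subsection \<open>Invariant measures and entropy\<close>

definition invariant_measures :: "seq set \<Rightarrow> seq measure set" where
  "invariant_measures X = {\<mu>. prob_space \<mu> \<and> sets \<mu> = sets (restrict_space borel X) \<and>
     shift_map \<in> measurable \<mu> \<mu> \<and> distr \<mu> \<mu> shift_map = \<mu>}"

definition finite_meas_partition :: "'a measure \<Rightarrow> 'a set set \<Rightarrow> bool" where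
  "finite_meas_partition \<mu> P \<longleftrightarrow> finite P \<and> P \<subseteq> sets \<mu> \<and> disjoint P \<and> \<Union>P = space \<mu>"

text \<open>The convention \<open>0 log 0 = 0\<close> holds automatically.\<close>

definition partition_entropy :: "'a measure \<Rightarrow> 'a set set \<Rightarrow> real" where
  "partition_entropy \<mu> P = - (\<Sum>A\<in>P. measure \<mu> A * ln (measure \<mu> A))"

text \<open>The join of \<open>P, T\<^sup>-\<^sup>1 P, \<dots>, T\<^sup>-\<^sup>(\<^sup>n\<^sup>-\<^sup>1\<^sup>) P\<close>.\<close>

definition iterated_join :: "'a measure \<Rightarrow> ('a \<Rightarrow> 'a) \<Rightarrow> 'a set set \<Rightarrow> nat \<Rightarrow> 'a set set" where
  "iterated_join \<mu> T P n =
     {{x \<in> space \<mu>. \<forall>i<n. (T ^^ i) x \<in> s i} | s. \<forall>i<n. s i \<in> P}"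

definition ks_entropy :: "'a measure \<Rightarrow> ('a \<Rightarrow> 'a) \<Rightarrow> ereal" where
  "ks_entropy \<mu> T =
     (SUP P \<in> {P. finite_meas_partition \<mu> P}.
        ereal (lim (\<lambda>n. partition_entropy \<mu> (iterated_join \<mu> T P n) / real n)))"


subsection \<open>Relative pressure, the functions \<open>g\<^sub>n\<close>, compensation functions\<close>

definition separated :: "nat \<Rightarrow> real \<Rightarrow> seq set \<Rightarrow> bool" where
  "separated n \<delta> E \<longleftrightarrow> (\<forall>x\<in>E. \<forall>x'\<in>E. x \<noteq> x' \<longrightarrow>
     (\<exists>i<n. seq_dist ((shift_map ^^ i) x) ((shift_map ^^ i) x') > \<delta>))"

text \<open>For \<open>X\<close> a subshift and \<open>\<delta> > 0\<close> all separated sets below are finite, with bounded sums.\<close>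

definition rel_pressure_n ::
  "seq set \<Rightarrow> (seq \<Rightarrow> seq) \<Rightarrow> (seq \<Rightarrow> real) \<Rightarrow> nat \<Rightarrow> real \<Rightarrow> seq \<Rightarrow> real" where
  "rel_pressure_n X \<pi> f n \<delta> y =
     (SUP E \<in> {E. E \<subseteq> {x \<in> X. \<pi> x = y} \<and> separated n \<delta> E}.
        \<Sum>x\<in>E. exp (birkhoff_sum n f x))"

definition rel_pressure_delta ::
  "seq set \<Rightarrow> (seq \<Rightarrow> seq) \<Rightarrow> (seq \<Rightarrow> real) \<Rightarrow> real \<Rightarrow> seq \<Rightarrow> ereal" where
  "rel_pressure_delta X \<pi> f \<delta> y = limsup (\<lambda>n. ereal (ln (rel_pressure_n X \<pi> f n \<delta> y) / real n))"

definition rel_pressure :: "seq set \<Rightarrow> (seq \<Rightarrow> seq) \<Rightarrow> (seq \<Rightarrow> real) \<Rightarrow> seq \<Rightarrow> ereal" where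
  "rel_pressure X \<pi> f y = Lim (at_right 0) (\<lambda>\<delta>. rel_pressure_delta X \<pi> f \<delta> y)"

text \<open>\<open>fibre_choice X \<Phi> n y E\<close>: \<open>E\<close> is one of the sets \<open>E\<^sub>n(y)\<close>.\<close>

definition fibre_words :: "seq set \<Rightarrow> (nat \<Rightarrow> nat) \<Rightarrow> nat \<Rightarrow> seq \<Rightarrow> nat list set" where
  "fibre_words X \<Phi> n y = {u \<in> words_of_length X n. map \<Phi> u = word_at y 0 n}"

definition fibre_choice :: "seq set \<Rightarrow> (nat \<Rightarrow> nat) \<Rightarrow> nat \<Rightarrow> seq \<Rightarrow> seq set \<Rightarrow> bool" where
  "fibre_choice X \<Phi> n y E \<longleftrightarrow> E \<subseteq> (\<Union>u\<in>fibre_words X \<Phi> n y. cylinder X u) \<and>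
     (\<forall>u\<in>fibre_words X \<Phi> n y. \<exists>!x. x \<in> E \<inter> cylinder X u)"

definition gfun :: "seq set \<Rightarrow> (nat \<Rightarrow> nat) \<Rightarrow> (seq \<Rightarrow> real) \<Rightarrow> nat \<Rightarrow> seq \<Rightarrow> real" where
  "gfun X \<Phi> f n y =
     (SUP E \<in> {E. fibre_choice X \<Phi> n y E}. \<Sum>x\<in>E. exp (birkhoff_sum n f x))"

definition compensation_function ::
  "seq set \<Rightarrow> seq set \<Rightarrow> (seq \<Rightarrow> seq) \<Rightarrow> (seq \<Rightarrow> real) \<Rightarrow> bool" where
  "compensation_function X Y \<pi> F \<longleftrightarrow> continuous_on X F \<and>
     (\<forall>\<phi>. continuous_on Y \<phi> \<longrightarrow>
        (SUP \<mu> \<in> invariant_measures X.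
           ks_entropy \<mu> shift_map + ereal (\<integral>x. F x \<partial>\<mu>) + ereal (\<integral>x. \<phi> (\<pi> x) \<partial>\<mu>))
      = (SUP \<nu> \<in> invariant_measures Y. ks_entropy \<nu> shift_map + ereal (\<integral>y. \<phi> y \<partial>\<nu>)))"


subsection \<open>Sequences of potentials\<close>

text \<open>
  A sequence \<open>{log f\<^sub>n}\<close> with \<open>f\<^sub>n\<close> positive and continuous on a subshift is represented by
  \<open>F n = f\<^sub>n\<close>; the value of \<open>F\<close> at \<open>0\<close> is irrelevant.
\<close>

type_synonym pot_seq = "nat \<Rightarrow> seq \<Rightarrow> real"

definition additive_seq :: "(seq \<Rightarrow> real) \<Rightarrow> pot_seq" where
  "additive_seq h = (\<lambda>n y. exp (birkhoff_sum n h y))"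

definition almost_additive :: "seq set \<Rightarrow> pot_seq \<Rightarrow> bool" where
  "almost_additive X F \<longleftrightarrow> (\<exists>C\<ge>0. \<forall>n\<ge>1. \<forall>l\<ge>1. \<forall>x\<in>X.
     exp (- C) * F n x * F l ((shift_map ^^ n) x) \<le> F (n + l) x \<and>
     F (n + l) x \<le> exp C * F n x * F l ((shift_map ^^ n) x))"

definition sup_norm_on :: "seq set \<Rightarrow> (seq \<Rightarrow> real) \<Rightarrow> real" where
  "sup_norm_on X \<phi> = (SUP x\<in>X. \<bar>\<phi> x\<bar>)"

definition asymptotically_additive :: "seq set \<Rightarrow> pot_seq \<Rightarrow> bool" where
  "asymptotically_additive X F \<longleftrightarrow> (\<forall>\<epsilon>>0. \<exists>\<rho>. continuous_on X \<rho> \<and>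
     limsup (\<lambda>n. ereal (sup_norm_on X (\<lambda>x. ln (F n x) - birkhoff_sum n \<rho> x) / real n)) < ereal \<epsilon>)"

definition top_pressure :: "seq set \<Rightarrow> pot_seq \<Rightarrow> ereal" where
  "top_pressure X F =
     limsup (\<lambda>n. ereal (ln (\<Sum>u\<in>words_of_length X n. SUP x\<in>cylinder X u. F n x) / real n))"

definition equilibrium_state :: "seq set \<Rightarrow> pot_seq \<Rightarrow> seq measure \<Rightarrow> bool" where
  "equilibrium_state X F \<mu> \<longleftrightarrow> \<mu> \<in> invariant_measures X \<and>
     ks_entropy \<mu> shift_map + lim (\<lambda>n. ereal ((\<integral>x. ln (F n x) \<partial>\<mu>) / real n))
     = (SUP \<nu> \<in> invariant_measures X.
          ks_entropy \<nu> shift_map + lim (\<lambda>n. ereal ((\<integral>x. ln (F n x) \<partial>\<nu>) / real n)))"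

definition gibbs_ratio :: "seq set \<Rightarrow> pot_seq \<Rightarrow> seq measure \<Rightarrow> nat \<Rightarrow> seq \<Rightarrow> real" where
  "gibbs_ratio X F \<mu> n x =
     measure \<mu> (cylinder X (word_at x 0 n))
       / (exp (- (real n * real_of_ereal (top_pressure X F))) * F n x)"

text \<open>
  The pressure has to be different from \<open>-\<infinity>\<close>; the value \<open>\<infinity>\<close>, for which the defining
  inequality is meaningless, is excluded as well (it never occurs for subadditive sequences).
\<close>

definition weak_gibbs :: "seq set \<Rightarrow> pot_seq \<Rightarrow> seq measure \<Rightarrow> bool" where
  "weak_gibbs X F \<mu> \<longleftrightarrow> \<mu> \<in> invariant_measures X \<and> \<bar>top_pressure X F\<bar> \<noteq> \<infinity> \<and>
     (\<exists>C :: nat \<Rightarrow> real. (\<forall>n\<ge>1. C n > 0) \<and> (\<lambda>n. ln (C n) / real n) \<longlonglongrightarrow> 0 \<and>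
        (\<forall>n\<ge>1. \<forall>x\<in>X. 1 / C n < gibbs_ratio X F \<mu> n x \<and> gibbs_ratio X F \<mu> n x < C n))"

definition gibbs :: "seq set \<Rightarrow> pot_seq \<Rightarrow> seq measure \<Rightarrow> bool" where
  "gibbs X F \<mu> \<longleftrightarrow> \<mu> \<in> invariant_measures X \<and> \<bar>top_pressure X F\<bar> \<noteq> \<infinity> \<and>
     (\<exists>C>0. \<forall>n\<ge>1. \<forall>x\<in>X. 1 / C < gibbs_ratio X F \<mu> n x \<and> gibbs_ratio X F \<mu> n x < C)"

definition subexp_almost_additive_bounds :: "seq set \<Rightarrow> pot_seq \<Rightarrow> (nat \<Rightarrow> nat \<Rightarrow> real) \<Rightarrow> bool" where
  "subexp_almost_additive_bounds Y g C \<longleftrightarrow>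
     (\<forall>n\<ge>1. \<forall>l\<ge>1. \<forall>y\<in>Y.
        1 / C n l \<le> g (n + l) y / (g n y * g l ((shift_map ^^ n) y)) \<and>
        g (n + l) y / (g n y * g l ((shift_map ^^ n) y)) \<le> C n l) \<and>
     (\<forall>l\<ge>1. (\<lambda>n. ln (C n l) / real n) \<longlonglongrightarrow> 0) \<and>
     (\<forall>n\<ge>1. (\<lambda>l. ln (C n l) / real l) \<longlonglongrightarrow> 0)"

end

theory Submission
  imports Defs
begin

text \<open>
  Write \<open>G\<^sub>n(y)\<close> for the sum, over the words \<open>u\<close> of length \<open>n\<close> of \<open>X\<close> above \<open>y\<^sub>1 \<dots> y\<^sub>n\<close>, of the weights
  \<open>sup exp (S\<^sub>n f)\<close> over the cylinder of \<open>u\<close>. By the Bowen property \<open>G\<^sub>n\<close> and \<open>g\<^sub>n\<close> agree up to a constant, \<open>G\<^sub>n\<close> is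
  submultiplicative, and weights are multiplicative along concatenations up to bounded factors.

  Each of the conditions on \<open>h\<close> implies that \<open>log g\<^sub>n - S\<^sub>n h = o(n)\<close> uniformly on \<open>Y\<close> (\<open>uniformly_close\<close>), and from this
  the three conclusions follow directly: the pressures of \<open>g\<close> and \<open>h\<close> agree and the Gibbs bounds of \<open>m\<close> carry
  over with subexponential constants; additivity of Birkhoff sums bounds \<open>log (g\<^sub>n\<^sub>+\<^sub>l / (g\<^sub>n g\<^sub>l \<circ> \<sigma>\<^sup>n))\<close>; and two
  Gibbs properties of the same \<open>m\<close> force \<open>log g\<^sub>n\<close> to be additive up to a bounded error. The final
  statement about measures combines the second conclusion with the integral condition.

  The uniform estimate comes from periodic points (\<open>uniform_estimate_if_periodic_estimates\<close>). Suppose that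
  at every point \<open>y\<close> of period \<open>q\<close>, first, \<open>log G\<^sub>q(y) \<ge> S\<^sub>q h(y)\<close>, and second, the total weight of the words
  over one period that start at a symbol \<open>a\<close> and can return to it is at most \<open>exp (S\<^sub>q h(y))\<close> up to a constant. An
  arbitrary word of \<open>Y\<close> is closed up to a periodic one by a word of bounded length, using irreducibility;
  the first property bounds \<open>G\<^sub>n\<close> from below because of submultiplicativity, and the second from above because a
  fixed proportion of \<open>G\<^sub>n\<close> is carried by words with one common pair of end symbols.

  Both properties hold where \<open>G\<^sub>n / exp (S\<^sub>n h)\<close> has growth rate \<open>0\<close> at periodic points. That covers the pointwise
  conditions, and the one on relative pressure, since at a periodic point \<open>G\<^sub>n\<close> and the relative pressure have the same
  growth: a word of the fibre fails to extend to a point of the fibre only because of boundedly many last symbols. The integral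
  condition is evaluated at the uniform measures on periodic orbits.

  For compensation functions both properties are extracted from the variational identity with a
  potential that punishes leaving the orbit. This needs the inequality \<open>h\<^sub>\<mu> + \<integral> F d\<mu> \<le> (1/n) log \<Sum> exp (sup S\<^sub>n F)\<close>
  (\<open>free_energy_le\<close>), which rests on the Kolmogorov--Sinai theorem for subshifts (\<open>ks_entropy_le\<close>), and an explicit
  measure of large free energy above the orbit: independent concatenations of loops at \<open>a\<close> (\<open>loop_measure\<close>).
\<close>


section \<open>Words, cylinders and Birkhoff sums\<close>

lemma shift_map_funpow: "(shift_map ^^ n) x = (\<lambda>i. x (i + n))"
  by (induction n arbitrary: x) (auto simp: shift_map_def funpow_swap1)

lemma length_word_at [simp]: "length (word_at x i n) = n"
  by (simp add: word_at_def)

lemma word_at_nth: "j < n \<Longrightarrow> word_at x i n ! j = x (i + j)"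
  by (simp add: word_at_def)

lemma word_at_eq_iff: "word_at x i n = word_at y j n \<longleftrightarrow> (\<forall>k<n. x (i + k) = y (j + k))"
  by (auto simp: list_eq_iff_nth_eq word_at_nth)

lemma word_at_eq_listI: "length u = n \<Longrightarrow> (\<And>j. j < n \<Longrightarrow> x (i + j) = u ! j) \<Longrightarrow> word_at x i n = u"
  by (auto simp: list_eq_iff_nth_eq word_at_nth)

lemma word_at_funpow: "word_at ((shift_map ^^ k) x) i n = word_at x (i + k) n"
  by (auto simp: word_at_eq_iff shift_map_funpow algebra_simps)

lemma word_at_append: "word_at x i (n + m) = word_at x i n @ word_at x (i + n) m"
  by (auto simp: list_eq_iff_nth_eq word_at_nth nth_append)

lemma in_cylinder_iff: "z \<in> cylinder X u \<longleftrightarrow> z \<in> X \<and> (\<forall>i<length u. z i = u ! i)"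
  by (auto simp: cylinder_def list_eq_iff_nth_eq word_at_nth)

lemma in_cylinder_word_at: "z \<in> cylinder X (word_at x 0 n) \<longleftrightarrow> z \<in> X \<and> (\<forall>i<n. z i = x i)"
  by (auto simp: in_cylinder_iff word_at_nth)

lemma birkhoff_sum_add:
  "birkhoff_sum (n + m) f x = birkhoff_sum n f x + birkhoff_sum m f ((shift_map ^^ n) x)"
proof -
  have "(\<Sum>i<n + m. f ((shift_map ^^ i) x))
      = (\<Sum>i<n. f ((shift_map ^^ i) x)) + (\<Sum>i\<in>{n..<n + m}. f ((shift_map ^^ i) x))"
    by (subst sum.union_disjoint[symmetric]) (auto intro!: sum.cong)
  also have "(\<Sum>i\<in>{n..<n + m}. f ((shift_map ^^ i) x)) = (\<Sum>i<m. f ((shift_map ^^ i) ((shift_map ^^ n) x)))"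
    by (rule sum.reindex_bij_witness[of _ "\<lambda>i. i + n" "\<lambda>i. i - n"]) (auto simp: shift_map_funpow add.commute add.left_commute)
  finally show ?thesis by (simp add: birkhoff_sum_def)
qed

lemma birkhoff_sum_0 [simp]: "birkhoff_sum 0 f x = 0"
  by (simp add: birkhoff_sum_def)

lemma birkhoff_sum_period:
  assumes "(shift_map ^^ q) x = x"
  shows "birkhoff_sum (k * q) f x = real k * birkhoff_sum q f x"
proof (induction k)
  case (Suc k)
  have "birkhoff_sum (q + k * q) f x = birkhoff_sum q f x + birkhoff_sum (k * q) f x"
    using assms by (simp add: birkhoff_sum_add)
  then show ?case using Suc by (simp add: algebra_simps)
qed simp

section \<open>Topology of sequence spaces\<close>

lemma open_seq_contains_cylinder:
  fixes U :: "seq set"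
  assumes "open U" "z \<in> U"
  obtains n where "{x. \<forall>i<n. x i = z i} \<subseteq> U"
proof -
  have "openin (product_topology (\<lambda>i. euclidean) UNIV) U"
    using assms(1) by (simp add: open_fun_def)
  from product_topology_open_contains_basis[OF this assms(2)]
  obtain V where V: "z \<in> (\<Pi>\<^sub>E i\<in>UNIV. V i)" "\<And>i. openin euclidean (V i)"
    "finite {i. V i \<noteq> topspace (euclidean :: nat topology)}" "(\<Pi>\<^sub>E i\<in>UNIV. V i) \<subseteq> U" by blast
  from V(3) obtain n where n: "\<And>i. V i \<noteq> UNIV \<Longrightarrow> i < n"
    by (metis (mono_tags, lifting) finite_nat_set_iff_bounded mem_Collect_eq topspace_euclidean)
  have "{x. \<forall>i<n. x i = z i} \<subseteq> (\<Pi>\<^sub>E i\<in>UNIV. V i)"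
  proof
    fix x assume x: "x \<in> {x. \<forall>i<n. x i = z i}"
    have "x i \<in> V i" for i
    proof (cases "V i = UNIV")
      case False
      then have "x i = z i" using n x by auto
      moreover have "z i \<in> V i" using V(1) by (auto simp: PiE_def)
      ultimately show ?thesis by simp
    qed auto
    then show "x \<in> (\<Pi>\<^sub>E i\<in>UNIV. V i)" by (auto simp: PiE_def)
  qed
  then have "{x. \<forall>i<n. x i = z i} \<subseteq> U" using V(4) by (rule subset_trans)
  then show ?thesis by (rule that)
qed

lemma continuous_on_coord: "continuous_on S (\<lambda>x::seq. x i)"
  by (rule continuous_on_product_coordinates[THEN continuous_on_subset]) auto

lemma open_coords: "open {x::seq. P (x i)}"
proof -
  have "open ((\<lambda>x::seq. x i) -` {a. P a})"
    by (rule open_vimage) (rule Topological_Spaces.open_discrete, rule continuous_on_coord)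
  then show ?thesis by (simp add: vimage_def)
qed

lemma open_seq_cylinder: "open {x::seq. \<forall>i<n. x i = z i}"
proof -
  have "{x::seq. \<forall>i<n. x i = z i} = (\<Inter>i\<in>{..<n}. {x. x i = z i})" by auto
  also have "open \<dots>" by (intro open_INT ballI open_coords) auto
  finally show ?thesis .
qed

lemma closed_coords: "closed {x::seq. P (x i)}"
  using open_coords[of "\<lambda>a. \<not> P a" i] by (simp add: closed_def Collect_neg_eq[symmetric])

lemma continuous_on_funpow_shift: "continuous_on S (shift_map ^^ n)"
proof -
  have "continuous_on S (\<lambda>x::seq. \<lambda>i. x (i + n))"
    by (intro continuous_on_coordinatewise_then_product continuous_on_coord)
  then show ?thesis by (simp add: shift_map_funpow[abs_def])
qed

lemma compact_full_shift: "compact (full_shift k)"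
proof -
  have eq: "full_shift k = (\<Pi>\<^sub>E i\<in>UNIV. {1..k})" by (auto simp: full_shift_def PiE_def)
  have "compactin (product_topology (\<lambda>i::nat. euclidean) UNIV) (\<Pi>\<^sub>E i\<in>UNIV. {1..k})"
    by (subst compactin_PiE) (auto intro: finite_imp_compact)
  then have "compactin euclidean (full_shift k)"
    by (simp add: eq euclidean_product_topology)
  then show ?thesis by simp
qed

lemma compact_subshift: "subshift X \<Longrightarrow> compact X"
  unfolding subshift_def by (metis compact_Int_closed compact_full_shift Int_absorb1)

lemma subshift_funpow: "subshift X \<Longrightarrow> x \<in> X \<Longrightarrow> (shift_map ^^ n) x \<in> X"
  by (induction n) (auto simp: subshift_def)

lemma subshift_bound:
  assumes "subshift X" obtains k where "k \<ge> 1" "\<And>x i. x \<in> X \<Longrightarrow> x i \<in> {1..k}"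
  using assms unfolding subshift_def full_shift_def by auto

lemma words_of_length_eq:
  assumes "subshift X" "X \<noteq> {}"
  shows "words_of_length X n = (\<lambda>x. word_at x 0 n) ` X"
proof (cases "n = 0")
  case True
  have "\<And>x. word_at x 0 0 = []" by (simp add: word_at_def)
  then show ?thesis using True assms by (auto simp: words_of_length_def)
next
  case False
  have "word_at x i n \<in> (\<lambda>x. word_at x 0 n) ` X" if "x \<in> X" for x i
    by (rule image_eqI[of _ _ "(shift_map ^^ i) x"])
      (auto simp: word_at_funpow intro: subshift_funpow assms that)
  with False show ?thesis by (auto simp: words_of_length_def)
qed

lemma length_words_of_length: "u \<in> words_of_length X n \<Longrightarrow> length u = n"
  by (auto simp: words_of_length_def split: if_splits)

lemma finite_words_of_length:
  assumes "subshift X" shows "finite (words_of_length X n)"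
    and "\<And>k. (\<And>x i. x \<in> X \<Longrightarrow> x i \<in> {1..k}) \<Longrightarrow> card (words_of_length X n) \<le> k ^ n"
proof -
  have *: "words_of_length X n \<subseteq> {u. set u \<subseteq> {1..k} \<and> length u = n}" if "\<And>x i. x \<in> X \<Longrightarrow> x i \<in> {1..k}" for k
    using that by (fastforce simp: words_of_length_def word_at_def split: if_splits)
  obtain k where k: "\<And>x i. x \<in> X \<Longrightarrow> x i \<in> {1..k}" by (rule subshift_bound[OF assms]) blast
  have "words_of_length X n \<subseteq> {u. set u \<subseteq> {1..k} \<and> length u = n}" using k by (rule *)
  then show "finite (words_of_length X n)"
    by (rule finite_subset) (auto intro: finite_lists_length_eq)
  fix k assume k: "\<And>x i. x \<in> X \<Longrightarrow> x i \<in> {1..k}"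
  have "words_of_length X n \<subseteq> {u. set u \<subseteq> {1..k} \<and> length u = n}" using k by (rule *)
  from card_mono[OF _ this] show "card (words_of_length X n) \<le> k ^ n"
    using card_lists_length_eq[of "{1..k}" n] finite_lists_length_eq[of "{1..k}" n] by simp
qed

lemma continuous_on_subshift_bounded:
  assumes "subshift X" "continuous_on X (f :: seq \<Rightarrow> real)"
  obtains B where "B \<ge> 0" "\<And>x. x \<in> X \<Longrightarrow> \<bar>f x\<bar> \<le> B"
proof -
  have "bounded (f ` X)"
    using compact_continuous_image[OF assms(2) compact_subshift[OF assms(1)]] compact_imp_bounded by blast
  then obtain B where "\<forall>x\<in>X. norm (f x) \<le> B" "B > 0"
    unfolding bounded_pos by auto
  then show ?thesis using that[of B] by auto
qed

lemma birkhoff_sum_bounded: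
  assumes "subshift X" "\<And>x. x \<in> X \<Longrightarrow> \<bar>f x\<bar> \<le> B" "x \<in> X"
  shows "\<bar>birkhoff_sum n f x\<bar> \<le> real n * B"
proof -
  have "\<bar>birkhoff_sum n f x\<bar> \<le> (\<Sum>i<n. \<bar>f ((shift_map ^^ i) x)\<bar>)"
    unfolding birkhoff_sum_def by (rule sum_abs)
  also have "\<dots> \<le> (\<Sum>i<n. B)"
    by (intro sum_mono assms(2) subshift_funpow[OF assms(1)] assms(3))
  finally show ?thesis by simp
qed

text \<open>A Lebesgue number argument in terms of windows: finitely many cylinders on which \<open>f\<close> hardly
  varies cover the compact set, and the longest of the words defining them is a window that works
  everywhere.\<close>

lemma uniformly_continuous_seq:
  fixes f :: "seq \<Rightarrow> real"
  assumes "compact X" "continuous_on X f" "e > 0"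
  obtains N where "\<And>x y. x \<in> X \<Longrightarrow> y \<in> X \<Longrightarrow> (\<And>i. i < N \<Longrightarrow> x i = y i) \<Longrightarrow> \<bar>f x - f y\<bar> < e"
proof -
  have "\<exists>n. \<forall>x\<in>X. (\<forall>i<n. x i = z i) \<longrightarrow> \<bar>f x - f z\<bar> < e / 2" if z: "z \<in> X" for z
  proof -
    have "continuous_on X (\<lambda>x. \<bar>f x - f z\<bar>)" using assms(2) by (intro continuous_intros)
    then obtain U where U: "open U" "U \<inter> X = (\<lambda>x. \<bar>f x - f z\<bar>) -` {..<e/2} \<inter> X"
      using open_lessThan unfolding continuous_on_open_invariant by blast
    then have "z \<in> U" using z assms(3) by auto
    from open_seq_contains_cylinder[OF U(1) this] obtain n where "{x. \<forall>i<n. x i = z i} \<subseteq> U" .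
    with U show ?thesis by (intro exI[of _ n]) blast
  qed
  then obtain n where n: "\<And>z x. z \<in> X \<Longrightarrow> x \<in> X \<Longrightarrow> (\<forall>i<n z. x i = z i) \<Longrightarrow> \<bar>f x - f z\<bar> < e / 2"
    by metis
  let ?C = "\<lambda>z. {x. \<forall>i<n z. x i = z i}"
  have "X \<subseteq> (\<Union>z\<in>X. ?C z)" by auto
  then obtain D where D: "D \<subseteq> X" "finite D" "X \<subseteq> (\<Union>z\<in>D. ?C z)"
    by (rule compactE_image[OF assms(1) open_seq_cylinder])
  define N where "N = Max (insert 0 (n ` D))"
  have N: "n z \<le> N" if "z \<in> D" for z using that D by (auto simp: N_def)
  show ?thesis
  proof (rule that[of N])
    fix x y assume xy: "x \<in> X" "y \<in> X" and eq: "\<And>i. i < N \<Longrightarrow> x i = y i"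
    obtain z where z: "z \<in> D" "x \<in> ?C z" using D xy by auto
    have "y \<in> ?C z" using z eq N[OF z(1)] by auto
    then have "\<bar>f y - f z\<bar> < e / 2" "\<bar>f x - f z\<bar> < e / 2" using n[of z] z D xy by auto
    then show "\<bar>f x - f y\<bar> < e" by linarith
  qed
qed

text \<open>Birkhoff sums of a continuous function vary by \<open>o(n)\<close> over cylinders of length \<open>n\<close>: all but
  boundedly many of the shifted pairs still agree on a long initial word.\<close>

lemma birkhoff_sum_variation:
  fixes h :: "seq \<Rightarrow> real"
  assumes X: "subshift X" and h: "continuous_on X h" and "e > 0"
  obtains C where "C \<ge> 0" "\<And>n x y. x \<in> X \<Longrightarrow> y \<in> X \<Longrightarrow> (\<And>i. i < n \<Longrightarrow> x i = y i) \<Longrightarrow>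
    \<bar>birkhoff_sum n h x - birkhoff_sum n h y\<bar> \<le> e * real n + C"
proof -
  obtain N where N: "\<And>x y. x \<in> X \<Longrightarrow> y \<in> X \<Longrightarrow> (\<And>i. i < N \<Longrightarrow> x i = y i) \<Longrightarrow> \<bar>h x - h y\<bar> < e"
    using uniformly_continuous_seq[OF compact_subshift[OF X] h assms(3)] by metis
  obtain B where B: "B \<ge> 0" "\<And>x. x \<in> X \<Longrightarrow> \<bar>h x\<bar> \<le> B"
    using continuous_on_subshift_bounded[OF X h] by metis
  show ?thesis
  proof (rule that[of "2 * B * real N"])
    show "0 \<le> 2 * B * real N" using B by simp
    fix n x y assume xy: "x \<in> X" "y \<in> X" and eq: "\<And>i. i < n \<Longrightarrow> x i = y i"
    have t: "\<bar>h ((shift_map ^^ i) x) - h ((shift_map ^^ i) y)\<bar> \<le> e + (if n < i + N then 2 * B else 0)"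
      if "i < n" for i
    proof (cases "n < i + N")
      case True
      then show ?thesis using B(2)[OF subshift_funpow[OF X xy(1), of i]] B(2)[OF subshift_funpow[OF X xy(2), of i]] assms(3)
        by auto
    next
      case False
      then have "\<bar>h ((shift_map ^^ i) x) - h ((shift_map ^^ i) y)\<bar> < e"
        by (intro N subshift_funpow X xy) (auto simp: shift_map_funpow intro!: eq)
      then show ?thesis using False by simp
    qed
    have "\<bar>birkhoff_sum n h x - birkhoff_sum n h y\<bar> \<le> (\<Sum>i<n. \<bar>h ((shift_map ^^ i) x) - h ((shift_map ^^ i) y)\<bar>)"
      unfolding birkhoff_sum_def sum_subtractf[symmetric] by (rule sum_abs)
    also have "\<dots> \<le> (\<Sum>i<n. e + (if n < i + N then 2 * B else 0))"
      by (intro sum_mono t) auto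
    also have "\<dots> = e * real n + 2 * B * real (card ({..<n} \<inter> {i. n < i + N}))"
      by (simp add: sum.distrib sum.If_cases)
    also have "card ({..<n} \<inter> {i. n < i + N}) \<le> card {n - N..<n}"
      by (rule card_mono) auto
    also have "e * real n + 2 * B * real (card {n - N..<n}) \<le> e * real n + 2 * B * real N"
      using B by (intro add_left_mono mult_left_mono) auto
    finally show "\<bar>birkhoff_sum n h x - birkhoff_sum n h y\<bar> \<le> e * real n + 2 * B * real N"
      using B by (simp add: mult_left_mono)
  qed
qed

section \<open>One-step shifts of finite type as edge shifts\<close>

text \<open>A one-step shift is the set of infinite paths in a finite graph. All later constructions (periodic
  points, connecting words, independent concatenations) are gluings of paths in this graph.\<close>

definition edge :: "seq set \<Rightarrow> nat \<Rightarrow> nat \<Rightarrow> bool" where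
  "edge X a b \<longleftrightarrow> (\<exists>x\<in>X. x 0 = a \<and> x 1 = b)"

definition symbols :: "seq set \<Rightarrow> nat set" where
  "symbols X = (\<lambda>x. x 0) ` X"

lemma closed_word_at_neq: "closed {x::seq. word_at x i n \<noteq> w}"
proof (cases "length w = n")
  case True
  have "{x::seq. word_at x i n = w} = (\<Inter>j\<in>{..<n}. {x. x (i + j) = w ! j})"
    using True by (auto simp: list_eq_iff_nth_eq word_at_nth)
  also have "open \<dots>" by (intro open_INT ballI open_coords) auto
  finally show ?thesis by (simp add: closed_def Collect_neg_eq[symmetric])
next
  case False
  then have "{x::seq. word_at x i n \<noteq> w} = UNIV" by auto
  then show ?thesis by simp
qed

lemma closed_full_shift: "closed (full_shift k)"
proof -
  have "full_shift k = (\<Inter>i. {x. x i \<in> {1..k}})" by (auto simp: full_shift_def)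
  also have "closed \<dots>" by (intro closed_INT ballI closed_coords)
  finally show ?thesis .
qed

lemma one_step_sft_subshift:
  assumes "one_step_sft X" shows "subshift X"
proof -
  obtain k F where k: "k \<ge> 1"
    and X: "X = {x \<in> full_shift k. \<forall>w\<in>F. \<forall>i. word_at x i (length w) \<noteq> w}"
    using assms by (auto simp: one_step_sft_def)
  have "X = full_shift k \<inter> (\<Inter>w\<in>F. \<Inter>i. {x. word_at x i (length w) \<noteq> w})" using X by auto
  moreover have "closed (full_shift k)" by (rule closed_full_shift)
  then have "closed (full_shift k \<inter> (\<Inter>w\<in>F. \<Inter>i. {x. word_at x i (length w) \<noteq> w}))"
    by (intro closed_Int closed_INT ballI closed_word_at_neq)
  moreover have "shift_map x \<in> X" if "x \<in> X" for x
    using that word_at_funpow[of 1 x] by (simp add: X full_shift_def) (simp add: shift_map_def)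
  ultimately show ?thesis using k X unfolding subshift_def by auto
qed

text \<open>A block of length at most two occurring in \<open>x\<close> at \<open>i\<close> lies inside \<open>x\<^sub>i x\<^sub>i\<^sub>+\<^sub>1\<close>, so it occurs in any
  point of \<open>X\<close> that starts with this pair and cannot be forbidden.\<close>

lemma one_step_sft_edges:
  assumes "one_step_sft X" shows "x \<in> X \<longleftrightarrow> (\<forall>i. edge X (x i) (x (Suc i)))"
proof
  assume x: "x \<in> X"
  show "\<forall>i. edge X (x i) (x (Suc i))"
    unfolding edge_def
    by (intro allI bexI[OF _ subshift_funpow[OF one_step_sft_subshift[OF assms] x]]) (auto simp: shift_map_funpow)
next
  obtain k F where F: "\<And>w. w \<in> F \<Longrightarrow> length w \<le> 2"
    and X: "X = {x \<in> full_shift k. \<forall>w\<in>F. \<forall>i. word_at x i (length w) \<noteq> w}"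
    using assms by (auto simp: one_step_sft_def)
  assume e: "\<forall>i. edge X (x i) (x (Suc i))"
  have *: "\<exists>z\<in>X. z 0 = x i \<and> z 1 = x (Suc i)" for i using e by (auto simp: edge_def)
  have "x i \<in> {1..k}" for i using *[of i] unfolding X full_shift_def by (metis (no_types, lifting) mem_Collect_eq)
  moreover have "word_at x i (length w) \<noteq> w" if w: "w \<in> F" for w i
  proof -
    obtain z where z: "z \<in> X" "z 0 = x i" "z 1 = x (Suc i)" using * by auto
    have "word_at x i (length w) = word_at z 0 (length w)"
      unfolding word_at_eq_iff
    proof (intro allI impI)
      fix j assume "j < length w"
      then have "j = 0 \<or> j = 1" using F[OF w] by linarith
      then show "x (i + j) = z (0 + j)" using z by auto
    qed
    then show ?thesis using z(1) w by (auto simp: X)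
  qed
  ultimately show "x \<in> X" by (auto simp: X full_shift_def)
qed

lemma in_words_iff: "u \<in> words X \<longleftrightarrow> u \<in> words_of_length X (length u)"
  by (auto simp: words_def dest: length_words_of_length)

lemma words_of_length_words: "words_of_length X n = {u \<in> words X. length u = n}"
  by (auto simp: words_def dest: length_words_of_length)

lemma glue_in_sft:
  assumes X: "one_step_sft X" and u: "u \<noteq> []" "successively (edge X) u"
    and z: "z \<in> X" "edge X (last u) (z 0)"
  shows "(\<lambda>i. if i < length u then u ! i else z (i - length u)) \<in> X" (is "?x \<in> X")
  unfolding one_step_sft_edges[OF X]
proof
  fix i
  consider "Suc i < length u" | "Suc i = length u" | "length u \<le> i" by linarith
  then show "edge X (?x i) (?x (Suc i))"
  proof cases
    case 1 then show ?thesis using u(2) by (auto simp: successively_conv_nth)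
  next
    case 2
    then have "last u = u ! i" using u(1) by (simp add: last_conv_nth flip: 2)
    then show ?thesis using 2 z(2) by auto
  next
    case 3 then show ?thesis using z(1) one_step_sft_edges[OF X, of z] by (auto simp: Suc_diff_le)
  qed
qed

text \<open>Every symbol at the end of a path of \<open>X\<close> is the first symbol of some point, so a finite path can
  always be continued to a point.\<close>

lemma in_words_sft_iff:
  assumes X: "one_step_sft X" "X \<noteq> {}" and u: "u \<noteq> []"
  shows "u \<in> words X \<longleftrightarrow> hd u \<in> symbols X \<and> successively (edge X) u"
proof
  note sub = one_step_sft_subshift[OF X(1)]
  assume "u \<in> words X"
  then obtain x where x: "x \<in> X" "u = word_at x 0 (length u)"
    by (auto simp: in_words_iff words_of_length_eq[OF sub X(2)])
  then have nth: "u ! i = x i" if "i < length u" for i using that word_at_nth[of i "length u" x 0] by simp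
  show "hd u \<in> symbols X \<and> successively (edge X) u"
    using x(1) u one_step_sft_edges[OF X(1), of x]
    by (auto simp: symbols_def hd_conv_nth nth successively_conv_nth)
next
  note sub = one_step_sft_subshift[OF X(1)]
  assume a: "hd u \<in> symbols X \<and> successively (edge X) u"
  have "\<exists>z\<in>X. z 0 = last u"
  proof (cases "length u = 1")
    case True
    then have "last u = hd u" by (cases u) auto
    then show ?thesis using a by (auto simp: symbols_def)
  next
    case False
    with u obtain j where j: "length u = Suc (Suc j)"
      by (metis One_nat_def length_0_conv not0_implies_Suc)
    then have "edge X (u ! j) (u ! Suc j)" using a by (auto simp: successively_conv_nth)
    then obtain x where "x \<in> X" "x 1 = u ! Suc j" by (auto simp: edge_def)
    then have "(shift_map ^^ 1) x \<in> X" "((shift_map ^^ 1) x) 0 = last u"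
      using j u subshift_funpow[OF sub, of x 1] by (auto simp: shift_map_def last_conv_nth)
    then show ?thesis by blast
  qed
  then obtain z where z: "z \<in> X" "z 0 = last u" by auto
  let ?z = "(shift_map ^^ 1) z"
  have "?z \<in> X" "edge X (last u) (?z 0)"
    using z subshift_funpow[OF sub z(1), of 1] by (auto simp: edge_def shift_map_def)
  from glue_in_sft[OF X(1) u _ this] a
  have "(\<lambda>i. if i < length u then u ! i else ?z (i - length u)) \<in> X" (is "?x \<in> X") by blast
  then have "word_at ?x 0 (length u) \<in> words_of_length X (length u)"
    unfolding words_of_length_eq[OF sub X(2)] by (rule imageI)
  moreover have "word_at ?x 0 (length u) = u" by (intro word_at_eq_listI) auto
  ultimately show "u \<in> words X" by (simp add: in_words_iff)
qed

lemma words_append_left: "u @ v \<in> words X \<Longrightarrow> u \<in> words X"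
  and words_append_right: "u @ v \<in> words X \<Longrightarrow> v \<in> words X"
proof -
  assume "u @ v \<in> words X"
  then have "u @ v = [] \<or> (\<exists>x\<in>X. \<exists>i. u @ v = word_at x i (length u + length v))"
    unfolding in_words_iff words_of_length_def by (auto split: if_splits)
  then have *: "u @ v = [] \<or> (\<exists>x\<in>X. \<exists>i. u = word_at x i (length u) \<and> v = word_at x (i + length u) (length v))"
    by (auto simp: word_at_append)
  have "[] \<in> words X" by (auto simp: words_def words_of_length_def)
  moreover have "word_at x i n \<in> words X" if "x \<in> X" for x i n
    unfolding in_words_iff words_of_length_def using that by (auto simp: word_at_def)
  ultimately show "u \<in> words X" "v \<in> words X"
    using * by (metis append_is_Nil_conv)+
qed

lemma cylinder_nonempty: "subshift X \<Longrightarrow> X \<noteq> {} \<Longrightarrow> u \<in> words X \<Longrightarrow> cylinder X u \<noteq> {}"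
  by (force simp: in_words_iff words_of_length_eq cylinder_def)

text \<open>Periodic points and the samples of the Bernoulli-type measures constructed later are both
  concatenations of blocks of one length.\<close>

definition cat :: "nat \<Rightarrow> (nat \<Rightarrow> nat list) \<Rightarrow> seq" where
  "cat q \<omega> i = \<omega> (i div q) ! (i mod q)"

lemma cat_in_sft:
  assumes X: "one_step_sft X" and q: "q \<ge> 1" and len: "\<And>j. length (\<omega> j) = q"
    and succ: "\<And>j. successively (edge X) (\<omega> j)" and e: "\<And>j. edge X (last (\<omega> j)) (hd (\<omega> (Suc j)))"
  shows "cat q \<omega> \<in> X"
  unfolding one_step_sft_edges[OF X]
proof
  fix i
  show "edge X (cat q \<omega> i) (cat q \<omega> (Suc i))"
  proof (cases "Suc (i mod q) < q")
    case True
    then have "Suc i mod q = Suc (i mod q)" "Suc i div q = i div q"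
      by (auto simp: mod_Suc div_Suc)
    then show ?thesis using True succ[of "i div q"] len[of "i div q"]
      by (auto simp: cat_def successively_conv_nth)
  next
    case False
    then have *: "Suc (i mod q) = q" using q by (metis Suc_lessI mod_less_divisor not_less_eq_eq One_nat_def Suc_le_lessD)
    then have "Suc i mod q = 0" "Suc i div q = Suc (i div q)"
      by (auto simp: mod_Suc div_Suc)
    moreover have "\<omega> j \<noteq> []" for j using len[of j] q by auto
    moreover have "i mod q = q - 1" using * by simp
    ultimately show ?thesis using e[of "i div q"] len
      by (auto simp: cat_def last_conv_nth hd_conv_nth)
  qed
qed

section \<open>Weights of words\<close>

text \<open>The weight of a word plays the role of an entry of a transfer matrix. For locally constant \<open>f\<close> sums
  of weights over fibres would be entries of products of matrices; the Bowen property keeps the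
  multiplicativity of weights up to bounded factors, which is all that is used of this picture.\<close>

definition wt :: "seq set \<Rightarrow> (seq \<Rightarrow> real) \<Rightarrow> nat list \<Rightarrow> real" where
  "wt X f u = (SUP x\<in>cylinder X u. exp (birkhoff_sum (length u) f x))"

definition fibre_sum :: "seq set \<Rightarrow> (nat \<Rightarrow> nat) \<Rightarrow> (seq \<Rightarrow> real) \<Rightarrow> nat \<Rightarrow> seq \<Rightarrow> real" where
  "fibre_sum X \<Phi> f n y = (\<Sum>u\<in>fibre_words X \<Phi> n y. wt X f u)"

definition loops :: "seq set \<Rightarrow> (nat \<Rightarrow> nat) \<Rightarrow> nat \<Rightarrow> seq \<Rightarrow> nat \<Rightarrow> nat list set" where
  "loops X \<Phi> n y a = {u \<in> fibre_words X \<Phi> n y. u \<noteq> [] \<and> hd u = a \<and> edge X (last u) a}"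

text \<open>Here \<open>K\<close> is a constant for the Bowen property, \<open>B\<close> a bound for \<open>f\<close>, \<open>k\<close> the size of the alphabet, and
  \<open>N\<close> a bound for the length of words connecting two symbols. Irreducibility enters only through \<open>N\<close>.\<close>

locale factor_system =
  fixes X Y :: "seq set" and \<pi> :: "seq \<Rightarrow> seq" and \<Phi> :: "nat \<Rightarrow> nat" and f :: "seq \<Rightarrow> real"
    and K B :: real and k N :: nat
  assumes sft: "one_step_sft X" and nonempty: "X \<noteq> {}" and subshift_Y: "subshift Y"
    and fac: "factor_map X Y \<pi>" and ob: "one_block X \<pi> \<Phi>" and cont_f: "continuous_on X f"
    and K1: "K \<ge> 1"
    and K: "\<And>n x y. x \<in> X \<Longrightarrow> y \<in> X \<Longrightarrow> (\<And>i. i < n \<Longrightarrow> x i = y i) \<Longrightarrow>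
      exp (birkhoff_sum n f x) \<le> K * exp (birkhoff_sum n f y)"
    and B0: "B \<ge> 0" and B: "\<And>x. x \<in> X \<Longrightarrow> \<bar>f x\<bar> \<le> B"
    and k1: "k \<ge> 1" and k: "\<And>x i. x \<in> X \<Longrightarrow> x i \<in> {1..k}"
    and gap: "\<And>a b. a \<in> symbols X \<Longrightarrow> b \<in> symbols X \<Longrightarrow>
      \<exists>w. length w \<le> N \<and> [a] @ w @ [b] \<in> words X"
begin

lemma subshift_X: "subshift X"
  by (rule one_step_sft_subshift[OF sft])

abbreviation "W \<equiv> wt X f"
abbreviation "G \<equiv> fibre_sum X \<Phi> f"
abbreviation "Z n y a \<equiv> (\<Sum>u\<in>loops X \<Phi> n y a. W u)"
abbreviation "FW \<equiv> fibre_words X \<Phi>"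

text \<open>One constant for all crude exponential bounds: sums of weights over nonempty sets of words of length \<open>n\<close>
  lie between \<open>M\<^sup>-\<^sup>n\<close> and \<open>M\<^sup>n\<close>.\<close>

definition M :: real where "M = real k * exp B"

lemma M1: "M \<ge> 1"
proof -
  have "1 * 1 \<le> real k * exp B" using k1 B0 by (intro mult_mono) auto
  then show ?thesis by (simp add: M_def)
qed

lemma Y_eq: "Y = \<pi> ` X" using fac by (auto simp: factor_map_def)

lemma pi_in: "x \<in> X \<Longrightarrow> \<pi> x \<in> Y" by (auto simp: Y_eq)

lemma pi_nth: "x \<in> X \<Longrightarrow> \<pi> x i = \<Phi> (x i)" using ob by (auto simp: one_block_def)

lemma pi_funpow: "x \<in> X \<Longrightarrow> \<pi> ((shift_map ^^ n) x) = (shift_map ^^ n) (\<pi> x)"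
  using subshift_funpow[OF subshift_X] by (auto simp: pi_nth shift_map_funpow)

lemma Y_funpow: "y \<in> Y \<Longrightarrow> (shift_map ^^ n) y \<in> Y"
  by (rule subshift_funpow[OF subshift_Y])

lemma pi_word_at: "x \<in> X \<Longrightarrow> map \<Phi> (word_at x i n) = word_at (\<pi> x) i n"
  by (auto simp: list_eq_iff_nth_eq word_at_nth pi_nth)

lemma X_words_eq: "words_of_length X n = (\<lambda>x. word_at x 0 n) ` X"
  by (rule words_of_length_eq[OF subshift_X nonempty])

lemma word_at_in_words: "x \<in> X \<Longrightarrow> word_at x i n \<in> words X"
  using subshift_funpow[OF subshift_X, of x i] word_at_funpow[of i x 0 n]
  unfolding words_of_length_words[of X n, symmetric] in_words_iff length_word_at X_words_eq by force

lemma S_bounded: "x \<in> X \<Longrightarrow> \<bar>birkhoff_sum n f x\<bar> \<le> real n * B"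
  by (rule birkhoff_sum_bounded[OF subshift_X]) (rule B)

lemma bdd_weights: "bdd_above ((\<lambda>x. exp (birkhoff_sum n f x)) ` cylinder X u)"
proof (rule bdd_aboveI2)
  fix x assume "x \<in> cylinder X u"
  then show "exp (birkhoff_sum n f x) \<le> exp (real n * B)"
    using S_bounded[of x n] by (auto simp: cylinder_def abs_le_iff)
qed

lemma weight_ge: "x \<in> cylinder X u \<Longrightarrow> exp (birkhoff_sum (length u) f x) \<le> W u"
  unfolding wt_def by (rule cSUP_upper[OF _ bdd_weights])

lemma weight_le: "x \<in> cylinder X u \<Longrightarrow> W u \<le> K * exp (birkhoff_sum (length u) f x)"
  unfolding wt_def by (rule cSUP_least) (blast, auto intro!: K simp: in_cylinder_iff)

lemma words_cylinder: "u \<in> words X \<Longrightarrow> \<exists>x. x \<in> cylinder X u"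
  using cylinder_nonempty[OF subshift_X nonempty] by blast

lemma weight_pos: "u \<in> words X \<Longrightarrow> W u > 0"
  by (metis words_cylinder weight_ge exp_gt_zero less_le_trans)

lemma weight_exp_le: "u \<in> words X \<Longrightarrow> W u \<le> exp B ^ length u"
  unfolding wt_def
  using cylinder_nonempty[OF subshift_X nonempty, of u] S_bounded
  by (intro cSUP_least) (auto simp: exp_of_nat_mult[symmetric] cylinder_def abs_le_iff)

lemma weight_exp_ge: "u \<in> words X \<Longrightarrow> exp (- B) ^ length u \<le> W u"
proof -
  assume "u \<in> words X"
  then obtain x where x: "x \<in> cylinder X u" using words_cylinder by blast
  have "exp (- B) ^ length u \<le> exp (birkhoff_sum (length u) f x)"
    using S_bounded[of x "length u"] x
    by (auto simp: exp_of_nat_mult[symmetric] cylinder_def abs_le_iff)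
  with weight_ge[OF x] show ?thesis by linarith
qed

lemma cylinder_append:
  assumes "x \<in> cylinder X (u @ v)"
  shows "x \<in> cylinder X u" "(shift_map ^^ length u) x \<in> cylinder X v"
    "exp (birkhoff_sum (length (u @ v)) f x)
       = exp (birkhoff_sum (length u) f x) * exp (birkhoff_sum (length v) f ((shift_map ^^ length u) x))"
proof -
  have *: "x \<in> X" "\<And>i. i < length u + length v \<Longrightarrow> x i = (u @ v) ! i"
    using assms by (auto simp: in_cylinder_iff)
  show "x \<in> cylinder X u" using * by (auto simp: in_cylinder_iff nth_append)
  show "(shift_map ^^ length u) x \<in> cylinder X v"
    using *(2)[of "_ + length u"] subshift_funpow[OF subshift_X *(1)]
    by (auto simp: in_cylinder_iff nth_append shift_map_funpow)
qed (simp add: birkhoff_sum_add exp_add)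

lemma weight_append_le: "u @ v \<in> words X \<Longrightarrow> W (u @ v) \<le> W u * W v"
proof -
  assume uv: "u @ v \<in> words X"
  have "exp (birkhoff_sum (length (u @ v)) f x) \<le> W u * W v" if "x \<in> cylinder X (u @ v)" for x
    unfolding cylinder_append(3)[OF that]
    using weight_ge[OF cylinder_append(1)[OF that]] weight_ge[OF cylinder_append(2)[OF that]]
      weight_pos[OF words_append_left[OF uv]]
    by (intro mult_mono) auto
  then show ?thesis
    unfolding wt_def[of X f "u @ v"]
    using cylinder_nonempty[OF subshift_X nonempty uv] by (intro cSUP_least) auto
qed

text \<open>Both factors are compared with their values along one point of the long cylinder; each comparison
  costs one factor \<open>K\<close>.\<close>

lemma weight_append_ge: "u @ v \<in> words X \<Longrightarrow> W u * W v \<le> K ^ 2 * W (u @ v)"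
proof -
  assume uv: "u @ v \<in> words X"
  then obtain x where x: "x \<in> cylinder X (u @ v)" using words_cylinder by blast
  have "W u * W v \<le> (K * exp (birkhoff_sum (length u) f x)) * (K * exp (birkhoff_sum (length v) f ((shift_map ^^ length u) x)))"
    using weight_le[OF cylinder_append(1)[OF x]] weight_le[OF cylinder_append(2)[OF x]]
      weight_pos[OF words_append_right[OF uv]] K1
    by (intro mult_mono) auto
  also have "\<dots> = K ^ 2 * exp (birkhoff_sum (length (u @ v)) f x)"
    unfolding cylinder_append(3)[OF x] by (simp add: power2_eq_square)
  also have "\<dots> \<le> K ^ 2 * W (u @ v)" using weight_ge[OF x] by (intro mult_left_mono) auto
  finally show ?thesis .
qed

section \<open>Fibre sums\<close>

lemma finite_fibre_words [simp]: "finite (FW n y)"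
  using finite_words_of_length[OF subshift_X, of n] by (auto simp: fibre_words_def)

lemma fibre_wordsD: "u \<in> FW n y \<Longrightarrow> u \<in> words X" "u \<in> FW n y \<Longrightarrow> length u = n"
  "u \<in> FW n y \<Longrightarrow> map \<Phi> u = word_at y 0 n"
  by (auto simp: fibre_words_def words_of_length_words)

lemma fibre_wordsI: "u \<in> words X \<Longrightarrow> length u = n \<Longrightarrow> map \<Phi> u = word_at y 0 n \<Longrightarrow> u \<in> FW n y"
  by (auto simp: fibre_words_def words_of_length_words)

lemma word_at_in_FW: "x \<in> X \<Longrightarrow> \<pi> x = y \<Longrightarrow> word_at x 0 n \<in> FW n y"
  by (auto intro!: fibre_wordsI word_at_in_words simp: pi_word_at)

lemma fibre_words_nonempty: "y \<in> Y \<Longrightarrow> FW n y \<noteq> {}"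
  using word_at_in_FW Y_eq by blast

lemma G_pos: "y \<in> Y \<Longrightarrow> G n y > 0"
  unfolding fibre_sum_def using fibre_words_nonempty
  by (intro sum_pos) (auto dest: fibre_wordsD intro: weight_pos)

lemma G_le: "G n y \<le> M ^ n"
proof -
  have "G n y \<le> (\<Sum>u\<in>FW n y. exp B ^ n)"
    unfolding fibre_sum_def using weight_exp_le fibre_wordsD by (intro sum_mono) metis
  also have "\<dots> = real (card (FW n y)) * exp B ^ n" by simp
  also have "card (FW n y) \<le> card (words_of_length X n)"
    using finite_words_of_length[OF subshift_X, of n] by (intro card_mono) (auto simp: fibre_words_def)
  also have "\<dots> \<le> k ^ n" by (rule finite_words_of_length(2)[OF subshift_X]) (rule k)
  finally show ?thesis by (simp add: M_def power_mult_distrib mult_right_mono)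
qed

lemma sum_weights_ge: "u \<in> S \<Longrightarrow> finite S \<Longrightarrow> S \<subseteq> words X \<Longrightarrow> length u = n \<Longrightarrow> 1 \<le> M ^ n * sum W S"
proof -
  assume u: "u \<in> S" "finite S" "S \<subseteq> words X" "length u = n"
  have "exp (- B) ^ n \<le> W u" using weight_exp_ge[of u] u by auto
  also have "\<dots> \<le> sum W S" using u by (intro member_le_sum) (auto intro: less_imp_le weight_pos)
  finally have "M ^ n * exp (- B) ^ n \<le> M ^ n * sum W S" using M1 by (intro mult_left_mono) auto
  moreover have "M * exp (- B) = real k" by (simp add: M_def exp_minus)
  then have "M ^ n * exp (- B) ^ n = real k ^ n" by (simp only: power_mult_distrib[symmetric])
  ultimately show ?thesis using k1 one_le_power[of "real k" n] by linarith
qed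

lemma G_ge: "y \<in> Y \<Longrightarrow> 1 \<le> M ^ n * G n y"
proof -
  assume "y \<in> Y"
  then obtain u where "u \<in> FW n y" using fibre_words_nonempty by blast
  then show ?thesis unfolding fibre_sum_def
    by (intro sum_weights_ge[of u]) (auto dest: fibre_wordsD)
qed

lemma ln_G_bounds:
  assumes "y \<in> Y" shows "\<bar>ln (G n y)\<bar> \<le> real n * ln M"
proof -
  have "ln (G n y) \<le> ln (M ^ n)" using G_le G_pos[OF assms] by (intro ln_mono) auto
  moreover have "0 \<le> ln (M ^ n * G n y)" using G_ge[OF assms] by (intro ln_ge_zero)
  ultimately show ?thesis using M1 G_pos[OF assms, of n] by (simp add: ln_mult ln_realpow)
qed

lemma FW_cong: "(\<And>i. i < n \<Longrightarrow> y i = y' i) \<Longrightarrow> FW n y = FW n y'"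
proof -
  assume "\<And>i. i < n \<Longrightarrow> y i = y' i"
  then have "word_at y 0 n = word_at y' 0 n" by (auto simp: word_at_eq_iff)
  then show ?thesis by (simp add: fibre_words_def)
qed

lemma G_cong: "(\<And>i. i < n \<Longrightarrow> y i = y' i) \<Longrightarrow> G n y = G n y'"
  unfolding fibre_sum_def by (subst FW_cong) auto

lemma FW_split: "u \<in> FW (n + m) y \<Longrightarrow> take n u \<in> FW n y \<and> drop n u \<in> FW m ((shift_map ^^ n) y)"
proof -
  assume u: "u \<in> FW (n + m) y"
  have "take n u @ drop n u \<in> words X" using fibre_wordsD(1)[OF u] by simp
  then have "take n u \<in> words X" "drop n u \<in> words X" by (rule words_append_left, rule words_append_right)
  moreover have "map \<Phi> (take n u) = word_at y 0 n" "map \<Phi> (drop n u) = word_at ((shift_map ^^ n) y) 0 m"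
    using fibre_wordsD(3)[OF u] by (auto simp: take_map[symmetric] drop_map[symmetric] word_at_append word_at_funpow)
  ultimately show ?thesis using fibre_wordsD(2)[OF u] by (auto intro!: fibre_wordsI)
qed

text \<open>Cutting at position \<open>n\<close> is injective on words, so submultiplicativity of weights passes to sums.\<close>

lemma weights_sum_split_le:
  assumes "finite A" "finite A'" "A \<subseteq> words X" "A' \<subseteq> words X"
    and S: "S \<subseteq> words X" "\<And>u. u \<in> S \<Longrightarrow> take n u \<in> A \<and> drop n u \<in> A'"
  shows "sum W S \<le> sum W A * sum W A'"
proof -
  have inj: "inj_on (\<lambda>u. (take n u, drop n u)) S" by (rule inj_onI) (metis Pair_inject append_take_drop_id)
  have "sum W S \<le> (\<Sum>u\<in>S. W (take n u) * W (drop n u))"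
  proof (rule sum_mono)
    fix u assume "u \<in> S"
    then show "W u \<le> W (take n u) * W (drop n u)"
      using weight_append_le[of "take n u" "drop n u"] S(1) by auto
  qed
  also have "\<dots> = (\<Sum>(u, v)\<in>(\<lambda>u. (take n u, drop n u)) ` S. W u * W v)"
    by (subst sum.reindex[OF inj]) (simp add: o_def)
  also have "\<dots> \<le> (\<Sum>(u, v)\<in>A \<times> A'. W u * W v)"
  proof (rule sum_mono2)
    show "finite (A \<times> A')" using assms by simp
    show "(\<lambda>u. (take n u, drop n u)) ` S \<subseteq> A \<times> A'" using S(2) by auto
    fix p assume "p \<in> A \<times> A' - (\<lambda>u. (take n u, drop n u)) ` S"
    then obtain u v where p: "p = (u, v)" "u \<in> words X" "v \<in> words X" using assms(3,4) by blast
    then show "0 \<le> (case p of (u, v) \<Rightarrow> W u * W v)"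
      using weight_pos[of u] weight_pos[of v] by simp
  qed
  also have "\<dots> = sum W A * sum W A'"
    by (simp add: sum_product sum.cartesian_product)
  finally show ?thesis .
qed

lemma G_add: "G (n + m) y \<le> G n y * G m ((shift_map ^^ n) y)"
  unfolding fibre_sum_def
  by (rule weights_sum_split_le[where n = n]) (auto dest: FW_split fibre_wordsD)

lemma G_add_const: "y \<in> Y \<Longrightarrow> G (n + m) y \<le> G n y * M ^ m"
  using G_add[of n m y] G_le[of m "(shift_map ^^ n) y"] G_pos[of y n]
  by (meson mult_left_mono less_imp_le order_trans)

lemma G_add_const': "y \<in> Y \<Longrightarrow> G (n + m) y \<le> M ^ n * G m ((shift_map ^^ n) y)"
  using G_add[of n m y] G_le[of n y] G_pos[OF Y_funpow[of y n], of m]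
  by (meson mult_right_mono less_imp_le order_trans)

lemma G_period: 
  assumes y: "y \<in> Y" "(shift_map ^^ q) y = y"
  shows "G (j * q) y \<le> G q y ^ j"
proof (induction j)
  case 0
  have "G 0 y \<le> 1" using G_le[of 0 y] by simp
  then show ?case by simp
next
  case (Suc j)
  have "G (q + j * q) y \<le> G q y * G (j * q) y" using G_add[of q "j * q" y] y(2) by simp
  also have "\<dots> \<le> G q y * G q y ^ j" using Suc G_pos[OF y(1), of q] by (intro mult_left_mono) auto
  finally show ?case by simp
qed

text \<open>By the Bowen property every choice of points in the fibre cylinders gives the same sum up to
  the factor \<open>K\<close>.\<close>

lemma fibre_choice_sum:
  assumes "fibre_choice X \<Phi> n y E"
  shows "(\<Sum>x\<in>E. exp (birkhoff_sum n f x)) \<le> G n y" "G n y \<le> K * (\<Sum>x\<in>E. exp (birkhoff_sum n f x))"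
proof -
  have ex: "\<exists>!x. x \<in> E \<inter> cylinder X u" if "u \<in> FW n y" for u using assms that by (auto simp: fibre_choice_def)
  have inv: "word_at x 0 n \<in> FW n y \<and> x \<in> cylinder X (word_at x 0 n)" if "x \<in> E" for x
  proof -
    from that assms obtain u where u: "u \<in> FW n y" "x \<in> cylinder X u" unfolding fibre_choice_def by blast
    then have "word_at x 0 n = u" using fibre_wordsD(2)[OF u(1)] by (auto simp: cylinder_def)
    with u show ?thesis by simp
  qed
  have bij: "bij_betw (\<lambda>x. word_at x 0 n) E (FW n y)"
    unfolding bij_betw_def
  proof
    show "inj_on (\<lambda>x. word_at x 0 n) E" using ex inv by (intro inj_onI) (metis IntI)
    show "(\<lambda>x. word_at x 0 n) ` E = FW n y"
    proof (intro equalityI subsetI)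
      fix u assume u: "u \<in> FW n y"
      then obtain x where x: "x \<in> E" "x \<in> cylinder X u" using ex by blast
      then have "word_at x 0 n = u" using fibre_wordsD(2)[OF u] by (auto simp: cylinder_def)
      with x show "u \<in> (\<lambda>x. word_at x 0 n) ` E" by blast
    qed (use inv in auto)
  qed
  have G: "G n y = (\<Sum>x\<in>E. W (word_at x 0 n))"
    unfolding fibre_sum_def by (rule sum.reindex_bij_betw[OF bij, symmetric])
  show "(\<Sum>x\<in>E. exp (birkhoff_sum n f x)) \<le> G n y"
    unfolding G using weight_ge inv by (intro sum_mono) force
  show "G n y \<le> K * (\<Sum>x\<in>E. exp (birkhoff_sum n f x))"
    unfolding G sum_distrib_left using weight_le inv by (intro sum_mono) force
qed

lemma gfun_bounds: "gfun X \<Phi> f n y \<le> G n y" "G n y \<le> K * gfun X \<Phi> f n y"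
proof -
  define E where "E = (\<lambda>u. SOME x. x \<in> cylinder X u) ` FW n y"
  have s: "(SOME x. x \<in> cylinder X u) \<in> cylinder X u" if "u \<in> FW n y" for u
    using words_cylinder fibre_wordsD(1)[OF that] by (metis someI_ex)
  have un: "x = (SOME x. x \<in> cylinder X u)" if a: "u \<in> FW n y" "x \<in> E" "x \<in> cylinder X u" for x u
  proof -
    obtain v where v: "v \<in> FW n y" "x = (SOME x. x \<in> cylinder X v)" using a(2) by (auto simp: E_def)
    have "x \<in> cylinder X v" using s v by simp
    then have "v = u" using a fibre_wordsD(2)[OF v(1)] fibre_wordsD(2)[OF a(1)] by (auto simp: cylinder_def)
    with v show ?thesis by simp
  qed
  have uni: "\<exists>!x. x \<in> E \<inter> cylinder X u" if u: "u \<in> FW n y" for u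
  proof (rule ex1I[of _ "SOME x. x \<in> cylinder X u"])
    show "(SOME x. x \<in> cylinder X u) \<in> E \<inter> cylinder X u" using s[OF u] u unfolding E_def by blast
    fix x assume "x \<in> E \<inter> cylinder X u"
    then show "x = (SOME x. x \<in> cylinder X u)" using un[OF u] by blast
  qed
  have "E \<subseteq> (\<Union>u\<in>FW n y. cylinder X u)" using s unfolding E_def by blast
  then have E: "fibre_choice X \<Phi> n y E" unfolding fibre_choice_def using uni by blast
  show "gfun X \<Phi> f n y \<le> G n y"
    unfolding gfun_def by (rule cSUP_least) (use E fibre_choice_sum(1) in auto)
  have "bdd_above ((\<lambda>E. \<Sum>x\<in>E. exp (birkhoff_sum n f x)) ` {E. fibre_choice X \<Phi> n y E})"
    using fibre_choice_sum(1) by (intro bdd_aboveI2) auto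
  then have "(\<Sum>x\<in>E. exp (birkhoff_sum n f x)) \<le> gfun X \<Phi> f n y"
    unfolding gfun_def using E by (intro cSUP_upper) auto
  then show "G n y \<le> K * gfun X \<Phi> f n y"
    using fibre_choice_sum(2)[OF E] K1 by (meson mult_left_mono order_trans zero_le_one)
qed

lemma gfun_pos: "y \<in> Y \<Longrightarrow> gfun X \<Phi> f n y > 0"
  using G_pos[of y n] gfun_bounds(2)[where n = n and y = y] K1
  by (metis less_le_trans mult_le_0_iff not_less order.trans zero_le_one)

lemma ln_gfun:
  assumes "y \<in> Y" shows "\<bar>ln (gfun X \<Phi> f n y) - ln (G n y)\<bar> \<le> ln K"
proof -
  have "ln (gfun X \<Phi> f n y) \<le> ln (G n y)"
    using gfun_bounds(1)[where n = n and y = y] gfun_pos[OF assms, of n] G_pos[OF assms, of n] by simp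
  moreover have "ln (G n y) \<le> ln (K * gfun X \<Phi> f n y)"
    using gfun_bounds(2)[where n = n and y = y] gfun_pos[OF assms, of n] G_pos[OF assms, of n] K1 by simp
  ultimately show ?thesis using gfun_pos[OF assms, of n] K1 by (simp add: ln_mult)
qed

end

context factor_system
begin

section \<open>Loops and periodic points\<close>

lemma word_nth_symbol: "u \<in> words X \<Longrightarrow> i < length u \<Longrightarrow> u ! i \<in> symbols X"
proof -
  assume u: "u \<in> words X" "i < length u"
  obtain x where x: "x \<in> X" "\<And>j. j < length u \<Longrightarrow> x j = u ! j"
    using words_cylinder[OF u(1)] by (auto simp: in_cylinder_iff)
  then have "((shift_map ^^ i) x) 0 = u ! i" using u by (simp add: shift_map_funpow)
  then show ?thesis using subshift_funpow[OF subshift_X x(1), of i] unfolding symbols_def by (metis (lifting) imageI)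
qed

lemma hd_last_symbol: "u \<in> words X \<Longrightarrow> u \<noteq> [] \<Longrightarrow> hd u \<in> symbols X \<and> last u \<in> symbols X"
  using word_nth_symbol[of u 0] word_nth_symbol[of u "length u - 1"]
  by (simp add: hd_conv_nth last_conv_nth)

lemma symbols_range: "symbols X \<subseteq> {1..k}"
  using k by (auto simp: symbols_def)

lemma successively_words: "u \<in> words X \<Longrightarrow> successively (edge X) u"
  by (cases "u = []") (auto simp: in_words_sft_iff[OF sft nonempty])

lemma close_word:
  assumes u: "u \<in> words X" "u \<noteq> []" and w: "[last u] @ w @ [a] \<in> words X"
  shows "u @ w \<in> words X" "edge X (last (u @ w)) a"
proof -
  have "successively (edge X) (([last u] @ w) @ [a])" using successively_words[OF w] by simp
  then have s: "successively (edge X) ([last u] @ w)" "edge X (last ([last u] @ w)) a"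
    unfolding successively_append_iff by auto
  have "successively (edge X) (u @ w)"
    using successively_words[OF u(1)] s(1) u(2) unfolding successively_append_iff by auto
  then show "u @ w \<in> words X"
    using u hd_last_symbol[OF u] by (simp add: in_words_sft_iff[OF sft nonempty])
  show "edge X (last (u @ w)) a"
    using s(2) u(2) by (cases "w = []") auto
qed

text \<open>A word that can be followed by its own first symbol repeats to a periodic point.\<close>

lemma loop_periodic_point:
  assumes u: "u \<in> words X" "u \<noteq> []" "edge X (last u) (hd u)"
  obtains x where "x \<in> X" "(shift_map ^^ length u) x = x" "word_at x 0 (length u) = u"
proof
  let ?q = "length u" and ?x = "cat (length u) (\<lambda>_. u)"
  show "?x \<in> X" using u successively_words[OF u(1)] by (intro cat_in_sft[OF sft]) (auto simp: Suc_le_eq)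
  show "(shift_map ^^ ?q) ?x = ?x" by (auto simp: shift_map_funpow cat_def)
  show "word_at ?x 0 ?q = u" by (intro word_at_eq_listI) (auto simp: cat_def)
qed

lemma loops_FW: "loops X \<Phi> n y a \<subseteq> FW n y" by (auto simp: loops_def)

lemma finite_loops [simp]: "finite (loops X \<Phi> n y a)"
  by (rule finite_subset[OF loops_FW]) simp

lemma loops_words: "u \<in> loops X \<Phi> n y a \<Longrightarrow> u \<in> words X"
  by (auto simp: loops_def dest: fibre_wordsD)

lemma Z_pos: "loops X \<Phi> n y a \<noteq> {} \<Longrightarrow> Z n y a > 0"
  by (intro sum_pos) (auto intro: weight_pos loops_words)

lemma Z_nonneg: "Z n y a \<ge> 0"
  by (intro sum_nonneg) (auto intro: less_imp_le weight_pos loops_words)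

lemma Z_le_G: "Z n y a \<le> G n y"
  unfolding fibre_sum_def
  by (intro sum_mono2 loops_FW) (auto intro: less_imp_le weight_pos fibre_wordsD)

lemma loops_append:
  assumes u: "u \<in> loops X \<Phi> n y a" and v: "v \<in> loops X \<Phi> m ((shift_map ^^ n) y) a"
  shows "u @ v \<in> loops X \<Phi> (n + m) y a"
proof -
  have u': "u \<in> words X" "length u = n" "map \<Phi> u = word_at y 0 n" "u \<noteq> []" "hd u = a" "edge X (last u) a"
    using u fibre_wordsD[of u n y] by (auto simp: loops_def)
  have v': "v \<in> words X" "length v = m" "map \<Phi> v = word_at y n m" "v \<noteq> []" "hd v = a" "edge X (last v) a"
    using v fibre_wordsD[of v m "(shift_map ^^ n) y"] by (auto simp: loops_def word_at_funpow)
  have "u @ v \<in> words X"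
    using u' v' successively_words[OF u'(1)] successively_words[OF v'(1)] hd_last_symbol[OF u'(1)]
    by (simp add: in_words_sft_iff[OF sft nonempty] successively_append_iff)
  moreover have "map \<Phi> (u @ v) = word_at y 0 (n + m)" using u' v' by (simp add: word_at_append)
  ultimately show ?thesis using u' v' by (auto simp: loops_def intro!: fibre_wordsI)
qed

lemma Z_add: "Z n y a * Z m ((shift_map ^^ n) y) a \<le> K ^ 2 * Z (n + m) y a"
proof -
  let ?A = "loops X \<Phi> n y a" and ?A' = "loops X \<Phi> m ((shift_map ^^ n) y) a"
  have inj: "inj_on (\<lambda>(u, v). u @ v) (?A \<times> ?A')"
  proof (rule inj_onI, clarify)
    fix u v u' v' assume a: "u \<in> ?A" "u' \<in> ?A" "u @ v = u' @ v'"
    then have "length u = length u'" using fibre_wordsD(2) loops_FW by (metis subsetD)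
    then show "u = u' \<and> v = v'" using a(3) by simp
  qed
  have "Z n y a * Z m ((shift_map ^^ n) y) a = (\<Sum>(u, v)\<in>?A \<times> ?A'. W u * W v)"
    unfolding sum_product sum.cartesian_product ..
  also have "\<dots> \<le> (\<Sum>(u, v)\<in>?A \<times> ?A'. K ^ 2 * W (u @ v))"
  proof (rule sum_mono)
    fix p assume "p \<in> ?A \<times> ?A'"
    then obtain u v where p: "p = (u, v)" "u \<in> ?A" "v \<in> ?A'" by blast
    show "(case p of (u, v) \<Rightarrow> W u * W v) \<le> (case p of (u, v) \<Rightarrow> K ^ 2 * W (u @ v))"
      using weight_append_ge[OF loops_words[OF loops_append[OF p(2,3)]]] by (simp add: p(1))
  qed
  also have "\<dots> = K ^ 2 * (\<Sum>p\<in>?A \<times> ?A'. W (case p of (u, v) \<Rightarrow> u @ v))"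
    by (simp add: sum_distrib_left case_prod_beta)
  also have "(\<Sum>p\<in>?A \<times> ?A'. W (case p of (u, v) \<Rightarrow> u @ v)) = sum W ((\<lambda>(u, v). u @ v) ` (?A \<times> ?A'))"
    by (subst sum.reindex[OF inj]) (simp add: o_def)
  also have "\<dots> \<le> Z (n + m) y a"
  proof (rule sum_mono2)
    show "(\<lambda>(u, v). u @ v) ` (?A \<times> ?A') \<subseteq> loops X \<Phi> (n + m) y a" using loops_append by auto
  qed (auto intro: less_imp_le weight_pos loops_words)
  finally show ?thesis using K1 by (simp add: mult_left_mono)
qed

text \<open>Loops over one period at a fixed symbol can be traversed in any order, and each junction costs \<open>K\<^sup>2\<close>.\<close>

lemma Z_power:
  assumes "(shift_map ^^ q) y = y"
  shows "Z q y a ^ Suc j \<le> K ^ (2 * j) * Z (Suc j * q) y a"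
proof (induction j)
  case (Suc j)
  have "Z q y a ^ Suc (Suc j) \<le> Z q y a * (K ^ (2 * j) * Z (Suc j * q) y a)"
    using Suc Z_nonneg by (simp add: mult_left_mono)
  also have "\<dots> = K ^ (2 * j) * (Z q y a * Z (Suc j * q) ((shift_map ^^ q) y) a)" using assms by simp
  also have "\<dots> \<le> K ^ (2 * j) * (K ^ 2 * Z (q + Suc j * q) y a)"
    by (intro mult_left_mono Z_add) (use K1 in auto)
  also have "\<dots> = K ^ (2 * Suc j) * Z (Suc (Suc j) * q) y a"
    by (simp add: power_add power2_eq_square)
  finally show ?case .
qed simp

section \<open>From periodic points to uniform estimates\<close>

text \<open>This is the heart of the argument: information at periodic points controls all points at once.
  Given \<open>y\<close> and \<open>n\<close>, a word of \<open>X\<close> over \<open>v = y\<^sub>1 \<dots> y\<^sub>n\<close> is closed up by a connecting word \<open>w\<close> of bounded length,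
  which gives a periodic point \<open>z\<close> of \<open>Y\<close> that agrees with \<open>y\<close> on the first \<open>n\<close> symbols and has period
  \<open>n + length w\<close>. The Birkhoff sums of \<open>h\<close> along \<open>y\<close> and along one period of \<open>z\<close> differ by \<open>o(n)\<close>.

  For the lower bound every choice of the word works, since submultiplicativity gives that the fibre sum of
  a whole period of \<open>z\<close> is at most a constant times the fibre sum of \<open>y\<close>. For the upper bound the fibre words are sorted by their first and last
  symbols \<open>(a, b)\<close>; the best of the at most \<open>k\<^sup>2\<close> classes carries a fixed proportion of the fibre sum,
  and a single \<open>w\<close> leading from \<open>b\<close> to \<open>a\<close> turns all its words into loops over the same \<open>z\<close>.\<close>

lemma uniform_estimate_if_periodic_estimates:
  assumes h: "continuous_on Y h" and "e > 0"
    and L: "\<And>y q. y \<in> Y \<Longrightarrow> q \<ge> 1 \<Longrightarrow> (shift_map ^^ q) y = y \<Longrightarrow> birkhoff_sum q h y \<le> ln (G q y)"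
    and U: "\<And>y q a. y \<in> Y \<Longrightarrow> q \<ge> 1 \<Longrightarrow> (shift_map ^^ q) y = y \<Longrightarrow> loops X \<Phi> q y a \<noteq> {} \<Longrightarrow>
      ln (Z q y a) \<le> birkhoff_sum q h y + 2 * ln K"
  obtains C where "\<And>n y. n \<ge> 1 \<Longrightarrow> y \<in> Y \<Longrightarrow> \<bar>ln (gfun X \<Phi> f n y) - birkhoff_sum n h y\<bar> \<le> e * real n + C"
proof -
  obtain Cv where Cv: "Cv \<ge> 0" "\<And>n x y. x \<in> Y \<Longrightarrow> y \<in> Y \<Longrightarrow> (\<And>i. i < n \<Longrightarrow> x i = y i) \<Longrightarrow>
    \<bar>birkhoff_sum n h x - birkhoff_sum n h y\<bar> \<le> e * real n + Cv"
    by (rule birkhoff_sum_variation[OF subshift_Y h \<open>e > 0\<close>]) blast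
  obtain Bh where Bh: "Bh \<ge> 0" "\<And>x. x \<in> Y \<Longrightarrow> \<bar>h x\<bar> \<le> Bh"
    by (rule continuous_on_subshift_bounded[OF subshift_Y h]) blast
  have close: "\<bar>birkhoff_sum (n + l) h z - birkhoff_sum n h y\<bar> \<le> e * real n + Cv + real N * Bh"
    if "z \<in> Y" "y \<in> Y" "\<And>i. i < n \<Longrightarrow> z i = y i" "l \<le> N" for n l z y
  proof -
    have "\<bar>birkhoff_sum l h ((shift_map ^^ n) z)\<bar> \<le> real l * Bh"
      by (rule birkhoff_sum_bounded[OF subshift_Y]) (use Bh Y_funpow that in auto)
    also have "\<dots> \<le> real N * Bh" using that Bh by (intro mult_right_mono) auto
    finally show ?thesis using Cv(2)[of z y n] that unfolding birkhoff_sum_add by auto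
  qed
  have pw: "M ^ l \<le> M ^ N" if "l \<le> N" for l using that M1 by (rule power_increasing)
  have lnM: "ln (M ^ N) = real N * ln M" using M1 by (simp add: ln_realpow)
  have lower: "birkhoff_sum n h y - (e * real n + Cv + real N * Bh) - real N * ln M \<le> ln (G n y)"
    if n: "n \<ge> 1" and y: "y \<in> Y" for n y
  proof -
    obtain x where x: "x \<in> X" "\<pi> x = y" using y Y_eq by auto
    define u where "u = word_at x 0 n"
    have u: "u \<in> words X" "u \<noteq> []" "length u = n"
      using n word_at_in_words[OF x(1), of 0 n] by (auto simp: u_def simp flip: length_0_conv)
    obtain w where w: "length w \<le> N" "[last u] @ w @ [hd u] \<in> words X"
      using gap[of "last u" "hd u"] hd_last_symbol[OF u(1,2)] by auto
    have uw: "u @ w \<in> words X" "u @ w \<noteq> []" "edge X (last (u @ w)) (hd (u @ w))"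
      using close_word[OF u(1,2) w(2)] u(2) by auto
    obtain p where p: "p \<in> X" "(shift_map ^^ length (u @ w)) p = p" "word_at p 0 (length (u @ w)) = u @ w"
      by (rule loop_periodic_point[OF uw])
    let ?q = "length (u @ w)" and ?z = "\<pi> p"
    have z: "?z \<in> Y" "(shift_map ^^ ?q) ?z = ?z" using p pi_in pi_funpow[OF p(1), of ?q] by auto
    have zy: "?z i = y i" if "i < n" for i
    proof -
      have "p i = (u @ w) ! i" using p(3) word_at_nth[of i ?q p 0] that u(3) by simp
      also have "\<dots> = x i" using that u(3) by (simp add: nth_append u_def word_at_nth)
      finally show ?thesis using pi_nth[OF p(1)] pi_nth[OF x(1)] x(2) by auto
    qed
    have q: "?q = n + length w" using u(3) by simp
    have "G ?q ?z \<le> G n ?z * M ^ length w" unfolding q by (rule G_add_const[OF z(1)])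
    also have "\<dots> \<le> G n ?z * M ^ N" using pw[OF w(1)] G_pos[OF z(1), of n] by (intro mult_left_mono) auto
    also have "G n ?z = G n y" by (rule G_cong) (rule zy)
    finally have "ln (G ?q ?z) \<le> ln (G n y * M ^ N)" using G_pos[OF z(1)] by (intro ln_mono) auto
    also have "\<dots> = ln (G n y) + real N * ln M"
      using G_pos[OF y, of n] M1 by (simp add: ln_mult ln_realpow)
    finally have "birkhoff_sum ?q h ?z \<le> ln (G n y) + real N * ln M"
      using L[OF z(1) _ z(2)] n q by linarith
    moreover have cl: "\<bar>birkhoff_sum ?q h ?z - birkhoff_sum n h y\<bar> \<le> e * real n + Cv + real N * Bh"
      unfolding q by (rule close[OF z(1) y _ w(1)]) (rule zy)
    ultimately show ?thesis by linarith
  qed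
  have upper: "ln (G n y) \<le> birkhoff_sum n h y + (e * real n + Cv + real N * Bh) + real N * ln M + 4 * ln K + 2 * ln k"
    if n: "n \<ge> 1" and y: "y \<in> Y" for n y
  proof -
    let ?P = "{1..k} \<times> {1..k}"
    define A where "A p = {u \<in> FW n y. (hd u, last u) = p}" for p
    have ne: "u \<noteq> []" if "u \<in> FW n y" for u using fibre_wordsD(2)[OF that] n by auto
    have "(\<lambda>u. (hd u, last u)) ` FW n y \<subseteq> ?P"
      using hd_last_symbol symbols_range ne fibre_wordsD(1) by blast
    then have G: "G n y = (\<Sum>p\<in>?P. sum W (A p))"
      unfolding fibre_sum_def A_def by (intro sum.group[symmetric]) auto
    have "\<exists>p\<in>?P. G n y / (real k)\<^sup>2 \<le> sum W (A p)"
    proof (rule ccontr)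
      assume "\<not> ?thesis"
      then have "sum W (A p) < G n y / (real k)\<^sup>2" if "p \<in> ?P" for p
        using that by (meson not_le)
      then have "(\<Sum>p\<in>?P. sum W (A p)) < of_nat (card ?P) * (G n y / (real k)\<^sup>2)"
        using k1 by (intro sum_bounded_above_strict) (auto simp: card_gt_0_iff)
      then have "G n y < real (card ?P) * (G n y / (real k)\<^sup>2)"
        by (simp only: G[symmetric])
      then show False using k1 by (simp add: power2_eq_square)
    qed
    then obtain a b where ab: "G n y \<le> (real k)\<^sup>2 * sum W (A (a, b))"
      using k1 by (auto simp: field_simps)
    then have "A (a, b) \<noteq> {}" using G_pos[OF y, of n] by auto
    then obtain u where u: "u \<in> FW n y" "hd u = a" "last u = b" by (auto simp: A_def)
    note uw = fibre_wordsD(1)[OF u(1)]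
    obtain w where w: "length w \<le> N" "[b] @ w @ [a] \<in> words X"
      using gap[of b a] hd_last_symbol[OF uw ne[OF u(1)]] u by auto
    have uw': "u @ w \<in> words X" "u @ w \<noteq> []" "edge X (last (u @ w)) (hd (u @ w))"
      using close_word[OF uw ne[OF u(1)], of w a] w(2) u ne[OF u(1)] by auto
    obtain p where p: "p \<in> X" "(shift_map ^^ length (u @ w)) p = p" "word_at p 0 (length (u @ w)) = u @ w"
      by (rule loop_periodic_point[OF uw'])
    let ?q = "length (u @ w)" and ?z = "\<pi> p"
    have z: "?z \<in> Y" "(shift_map ^^ ?q) ?z = ?z" using p pi_in pi_funpow[OF p(1), of ?q] by auto
    have q: "?q = n + length w" using fibre_wordsD(2)[OF u(1)] by simp
    have zw: "word_at ?z 0 ?q = map \<Phi> u @ map \<Phi> w" using pi_word_at[OF p(1), of 0 ?q] p(3) by simp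
    have zy: "?z i = y i" if "i < n" for i
    proof -
      have "?z i = (map \<Phi> u @ map \<Phi> w) ! i" using zw word_at_nth[of i ?q ?z 0] that q by simp
      also have "\<dots> = y i" using that fibre_wordsD[OF u(1)] by (simp add: nth_append word_at_nth)
      finally show ?thesis .
    qed
    have lp: "v @ w \<in> loops X \<Phi> ?q ?z a" if v: "v \<in> A (a, b)" for v
    proof -
      have v': "v \<in> FW n y" "hd v = a" "last v = b" using v by (auto simp: A_def)
      then have c: "v @ w \<in> words X" "edge X (last (v @ w)) a"
        using close_word[OF fibre_wordsD(1)[OF v'(1)] ne[OF v'(1)], of w a] w(2) by auto
      have "map \<Phi> v = map \<Phi> u" using fibre_wordsD(3)[OF v'(1)] fibre_wordsD(3)[OF u(1)] by simp
      then have "map \<Phi> (v @ w) = word_at ?z 0 ?q" using zw by simp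
      moreover have "length (v @ w) = ?q" using fibre_wordsD(2)[OF v'(1)] q by simp
      ultimately show ?thesis using c v' ne[OF v'(1)] by (auto simp: loops_def intro!: fibre_wordsI)
    qed
    have ww: "w \<in> words X" using words_append_right[OF uw'(1)] .
    have "sum W (A (a, b)) * W w = (\<Sum>v\<in>A (a, b). W v * W w)" by (simp add: sum_distrib_right)
    also have "\<dots> \<le> (\<Sum>v\<in>A (a, b). K ^ 2 * W (v @ w))"
      using weight_append_ge loops_words[OF lp] by (intro sum_mono) auto
    also have "\<dots> = K ^ 2 * sum W ((\<lambda>v. v @ w) ` A (a, b))"
      by (subst sum.reindex) (auto simp: inj_on_def sum_distrib_left)
    also have "\<dots> \<le> K ^ 2 * Z ?q ?z a"
    proof (intro mult_left_mono sum_mono2)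
      show "(\<lambda>v. v @ w) ` A (a, b) \<subseteq> loops X \<Phi> ?q ?z a" using lp by auto
    qed (auto intro: less_imp_le weight_pos loops_words)
    finally have 1: "sum W (A (a, b)) * W w \<le> K ^ 2 * Z ?q ?z a" .
    have 2: "1 \<le> M ^ N * W w"
    proof -
      have "1 \<le> M ^ length w * sum W {w}" by (rule sum_weights_ge[of w]) (use ww in auto)
      also have "\<dots> \<le> M ^ N * W w" using pw[OF w(1)] weight_pos[OF ww] by (auto intro: mult_right_mono)
      finally show ?thesis .
    qed
    have A0: "0 \<le> sum W (A (a, b))"
      by (intro sum_nonneg) (auto simp: A_def intro!: less_imp_le weight_pos dest: fibre_wordsD)
    have "sum W (A (a, b)) * 1 \<le> sum W (A (a, b)) * (M ^ N * W w)"
      using 2 A0 by (intro mult_left_mono)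
    also have "\<dots> = M ^ N * (sum W (A (a, b)) * W w)" by simp
    also have "\<dots> \<le> M ^ N * (K ^ 2 * Z ?q ?z a)" using 1 M1 by (intro mult_left_mono) auto
    finally have "(real k)\<^sup>2 * sum W (A (a, b)) \<le> (real k)\<^sup>2 * (M ^ N * (K ^ 2 * Z ?q ?z a))"
      by (intro mult_left_mono) auto
    then have 3: "G n y \<le> (real k)\<^sup>2 * (M ^ N * (K ^ 2 * Z ?q ?z a))" using ab by linarith
    have lne: "loops X \<Phi> ?q ?z a \<noteq> {}" using lp[of u] u by (auto simp: A_def)
    have "ln (G n y) \<le> ln ((real k)\<^sup>2 * (M ^ N * (K ^ 2 * Z ?q ?z a)))"
      using 3 G_pos[OF y, of n] by simp
    also have "\<dots> = 2 * ln k + real N * ln M + 2 * ln K + ln (Z ?q ?z a)"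
      using Z_pos[OF lne] k1 M1 K1 by (simp add: ln_mult ln_realpow)
    finally have "ln (G n y) \<le> 2 * ln k + real N * ln M + 2 * ln K + ln (Z ?q ?z a)" .
    moreover have "ln (Z ?q ?z a) \<le> birkhoff_sum ?q h ?z + 2 * ln K"
      using U[OF z(1) _ z(2) lne] n q by linarith
    moreover have cl: "\<bar>birkhoff_sum ?q h ?z - birkhoff_sum n h y\<bar> \<le> e * real n + Cv + real N * Bh"
      unfolding q by (rule close[OF z(1) y _ w(1)]) (rule zy)
    ultimately show ?thesis by linarith
  qed
  have "ln k \<ge> 0" "ln M \<ge> 0" "ln K \<ge> 0" using k1 M1 K1 by auto
  then have est: "\<bar>ln (G n y) - birkhoff_sum n h y\<bar> \<le> e * real n + (Cv + real N * Bh + real N * ln M + 4 * ln K + 2 * ln k)"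
    if "n \<ge> 1" "y \<in> Y" for n y using lower[OF that] upper[OF that] by (auto simp: abs_le_iff)
  show ?thesis
  proof (rule that[of "Cv + real N * Bh + real N * ln M + 5 * ln K + 2 * ln k"])
    fix n y assume "n \<ge> (1::nat)" "y \<in> Y"
    from est[OF this] ln_gfun[OF this(2), of n]
    show "\<bar>ln (gfun X \<Phi> f n y) - birkhoff_sum n h y\<bar>
      \<le> e * real n + (Cv + real N * Bh + real N * ln M + 5 * ln K + 2 * ln k)" by linarith
  qed
qed

end

section \<open>Consequences of a uniform estimate\<close>

lemma limsup_ereal_cong:
  fixes a b :: "nat \<Rightarrow> real"
  assumes "(\<lambda>n. a n - b n) \<longlonglongrightarrow> 0"
  shows "limsup (\<lambda>n. ereal (a n)) = limsup (\<lambda>n. ereal (b n))"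
proof -
  have "limsup (\<lambda>n. ereal (a n - b n) + ereal (b n)) = 0 + limsup (\<lambda>n. ereal (b n))"
    using assms by (intro ereal_limsup_lim_add) (auto simp: zero_ereal_def)
  then show ?thesis by simp
qed

text \<open>The common consequence of all the conditions on \<open>h\<close>: \<open>log F\<^sub>n\<close> and the Birkhoff sums of \<open>h\<close> differ by
  at most \<open>D n = o(n)\<close>. The error is kept as a sequence because the constants \<open>C\<^sub>n\<^sub>,\<^sub>l\<close> and \<open>C\<^sub>n\<close> are built from it.\<close>

definition uniformly_close :: "seq set \<Rightarrow> pot_seq \<Rightarrow> (seq \<Rightarrow> real) \<Rightarrow> (nat \<Rightarrow> real) \<Rightarrow> bool" where
  "uniformly_close Y F h D \<longleftrightarrow> (\<lambda>n. D n / real n) \<longlonglongrightarrow> 0 \<and>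
     (\<forall>n\<ge>1. \<forall>y\<in>Y. \<bar>ln (F n y) - birkhoff_sum n h y\<bar> \<le> D n)"

text \<open>Bounds of the form \<open>\<epsilon> n + C\<^sub>\<epsilon>\<close> are easier to produce, and the supremum over the points turns them into
  one sequence.\<close>

lemma uniformly_closeI:
  assumes ne: "Y \<noteq> {}" and
    est: "\<And>e. e > 0 \<Longrightarrow> \<exists>C. \<forall>n\<ge>1. \<forall>y\<in>Y. \<bar>ln (F n y) - birkhoff_sum n h y\<bar> \<le> e * real n + C"
  obtains D where "uniformly_close Y F h D"
proof
  define D where "D n = (SUP y\<in>Y. \<bar>ln (F n y) - birkhoff_sum n h y\<bar>)" for n
  have bdd: "bdd_above ((\<lambda>y. \<bar>ln (F n y) - birkhoff_sum n h y\<bar>) ` Y)" if "n \<ge> 1" for n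
    using est[of 1] that by (auto simp: bdd_above_def)
  have 1: "\<bar>ln (F n y) - birkhoff_sum n h y\<bar> \<le> D n" if "n \<ge> 1" "y \<in> Y" for n y
    unfolding D_def by (rule cSUP_upper[OF that(2) bdd[OF that(1)]])
  have "(\<lambda>n. D n / real n) \<longlonglongrightarrow> 0"
  proof (rule LIMSEQ_I)
    fix r :: real assume r: "r > 0"
    obtain C where C: "\<And>n y. n \<ge> 1 \<Longrightarrow> y \<in> Y \<Longrightarrow> \<bar>ln (F n y) - birkhoff_sum n h y\<bar> \<le> r / 2 * real n + C"
      using est[of "r / 2"] r by auto
    obtain n0 :: nat where n0: "real n0 > 2 * \<bar>C\<bar> / r" using reals_Archimedean2 by blast
    show "\<exists>no. \<forall>n\<ge>no. norm (D n / real n - 0) < r"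
    proof (intro exI[of _ "Suc n0"] allI impI)
      fix n assume n: "Suc n0 \<le> n"
      then have n1: "n \<ge> 1" by simp
      have "D n \<le> r / 2 * real n + C" unfolding D_def using C[OF n1] ne by (intro cSUP_least)
      moreover obtain y where "y \<in> Y" using ne by auto
      then have "D n \<ge> 0" using 1[OF n1] by force
      moreover have "C < r / 2 * real n"
      proof -
        have "2 * \<bar>C\<bar> / r < real n" using n n0 by linarith
        then show ?thesis using r by (simp add: field_simps)
      qed
      ultimately show "norm (D n / real n - 0) < r" using n1 by (simp add: field_simps)
    qed
  qed
  with 1 show "uniformly_close Y F h D" by (auto simp: uniformly_close_def)
qed

text \<open>Birkhoff sums are additive, so only the three errors remain in the logarithm of the quotient.\<close>

lemma uniformly_close_subexp_bounds:
  assumes D: "uniformly_close Y F h D" and Y: "subshift Y" and pos: "\<And>n y. y \<in> Y \<Longrightarrow> F n y > 0"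
  shows "subexp_almost_additive_bounds Y F (\<lambda>n l. exp (D (n + l) + D n + D l))"
proof -
  have lim0: "(\<lambda>n. D n / real n) \<longlonglongrightarrow> 0" using D by (simp add: uniformly_close_def)
  have lim1: "(\<lambda>n. (D (n + l) + D n + D l) / real n) \<longlonglongrightarrow> 0" for l
  proof -
    have a: "(\<lambda>n. D (n + l) / real (n + l)) \<longlonglongrightarrow> 0" using LIMSEQ_ignore_initial_segment[OF lim0] .
    have b: "(\<lambda>n. real (n + l) / real n) \<longlonglongrightarrow> 1" by real_asymp
    have "(\<lambda>n. D (n + l) / real (n + l) * (real (n + l) / real n) + D n / real n + D l / real n) \<longlonglongrightarrow> 0 * 1 + 0 + 0"
      by (intro tendsto_add tendsto_mult a b lim0) real_asymp
    moreover have "eventually (\<lambda>n. D (n + l) / real (n + l) * (real (n + l) / real n) + D n / real n + D l / real n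
       = (D (n + l) + D n + D l) / real n) sequentially"
      by (intro eventually_sequentiallyI[of 1]) (simp add: add_divide_distrib del: of_nat_add)
    ultimately show ?thesis by (simp add: tendsto_cong)
  qed
  have "1 / exp (D (n + l) + D n + D l) \<le> F (n + l) y / (F n y * F l ((shift_map ^^ n) y)) \<and>
     F (n + l) y / (F n y * F l ((shift_map ^^ n) y)) \<le> exp (D (n + l) + D n + D l)"
    if "n \<ge> 1" "l \<ge> 1" "y \<in> Y" for n l y
  proof -
    let ?z = "(shift_map ^^ n) y"
    have z: "?z \<in> Y" using subshift_funpow[OF Y that(3)] .
    have p: "F (n + l) y > 0" "F n y > 0" "F l ?z > 0" using pos that z by auto
    let ?r = "F (n + l) y / (F n y * F l ?z)"
    have r: "?r > 0" using p by simp
    have "ln ?r = ln (F (n + l) y) - ln (F n y) - ln (F l ?z)" using p by (simp add: ln_div ln_mult)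
    moreover have "\<bar>ln (F (n + l) y) - birkhoff_sum (n + l) h y\<bar> \<le> D (n + l)"
      "\<bar>ln (F n y) - birkhoff_sum n h y\<bar> \<le> D n" "\<bar>ln (F l ?z) - birkhoff_sum l h ?z\<bar> \<le> D l"
      using D that z by (auto simp: uniformly_close_def)
    ultimately have "\<bar>ln ?r\<bar> \<le> D (n + l) + D n + D l" unfolding birkhoff_sum_add by linarith
    then have "- (D (n + l) + D n + D l) \<le> ln ?r" "ln ?r \<le> D (n + l) + D n + D l" by auto
    then have "exp (- (D (n + l) + D n + D l)) \<le> ?r" "?r \<le> exp (D (n + l) + D n + D l)"
      using r by (metis exp_le_cancel_iff exp_ln)+
    then show ?thesis by (simp only: exp_minus inverse_eq_divide)
  qed
  then show ?thesis
    using lim1 lim1[of ] unfolding subexp_almost_additive_bounds_def by (auto simp: add.commute add.left_commute)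
qed

lemma top_pressure_eq_if_close:
  assumes D: "uniformly_close Y F h D" and Y: "subshift Y" "Y \<noteq> {}" and h: "continuous_on Y h"
    and pos: "\<And>n y. y \<in> Y \<Longrightarrow> F n y > 0"
  shows "top_pressure Y F = top_pressure Y (additive_seq h)"
proof -
  obtain B where B: "B \<ge> 0" "\<And>y. y \<in> Y \<Longrightarrow> \<bar>h y\<bar> \<le> B"
    by (rule continuous_on_subshift_bounded[OF Y(1) h]) blast
  let ?H = "additive_seq h"
  let ?S = "\<lambda>F n. \<Sum>u\<in>words_of_length Y n. SUP y\<in>cylinder Y u. F n y"
  have comp: "F n y \<le> exp (D n) * ?H n y" "?H n y \<le> exp (D n) * F n y" if "n \<ge> 1" "y \<in> Y" for n y
  proof -
    have "\<bar>ln (F n y) - birkhoff_sum n h y\<bar> \<le> D n" using D that by (auto simp: uniformly_close_def)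
    then have "ln (F n y) \<le> D n + birkhoff_sum n h y" "birkhoff_sum n h y \<le> D n + ln (F n y)" by auto
    then have "exp (ln (F n y)) \<le> exp (D n + birkhoff_sum n h y)" "exp (birkhoff_sum n h y) \<le> exp (D n + ln (F n y))"
      by simp_all
    then show "F n y \<le> exp (D n) * ?H n y" "?H n y \<le> exp (D n) * F n y"
      using pos[OF that(2), of n] by (simp_all add: exp_add additive_seq_def)
  qed
  have Hb: "?H n y \<le> exp (real n * B)" if "y \<in> Y" for n y
  proof -
    have "\<bar>birkhoff_sum n h y\<bar> \<le> real n * B" by (rule birkhoff_sum_bounded[OF Y(1) _ that]) (rule B(2))
    then show ?thesis by (simp add: additive_seq_def)
  qed
  have bddH: "bdd_above (?H n ` cylinder Y u)" for n u
    using Hb by (intro bdd_aboveI2[of _ _ "exp (real n * B)"]) (auto simp: cylinder_def)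
  have bddF: "bdd_above (F n ` cylinder Y u)" if "n \<ge> 1" for n u
  proof (rule bdd_aboveI2)
    fix y assume "y \<in> cylinder Y u"
    then have y: "y \<in> Y" by (simp add: cylinder_def)
    show "F n y \<le> exp (D n) * exp (real n * B)"
      using comp(1)[OF that y] Hb[OF y, of n] by (meson mult_left_mono order_trans exp_ge_zero)
  qed
  have cyl: "cylinder Y u \<noteq> {}" if "u \<in> words_of_length Y n" for u n
    using that cylinder_nonempty[OF Y] by (auto simp: words_def)
  have wne: "words_of_length Y n \<noteq> {}" for n using words_of_length_eq[OF Y] Y(2) by auto
  have fin: "finite (words_of_length Y n)" for n by (rule finite_words_of_length[OF Y(1)])
  have mono: "?S F1 n \<le> exp (D n) * ?S F2 n"
    if "\<And>y. y \<in> Y \<Longrightarrow> F1 n y \<le> exp (D n) * F2 n y" "\<And>u. bdd_above (F2 n ` cylinder Y u)" for F1 F2 :: pot_seq and n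
    unfolding sum_distrib_left
  proof (intro sum_mono cSUP_least cyl)
    fix u y assume "u \<in> words_of_length Y n" and y: "y \<in> cylinder Y u"
    have "F2 n y \<le> (SUP y\<in>cylinder Y u. F2 n y)" using y that(2) by (rule cSUP_upper)
    moreover have "F1 n y \<le> exp (D n) * F2 n y" using y that(1) by (auto simp: cylinder_def)
    ultimately show "F1 n y \<le> exp (D n) * (SUP y\<in>cylinder Y u. F2 n y)"
      by (meson mult_left_mono order_trans exp_ge_zero)
  qed
  have posS: "?S F1 n > 0" if "\<And>y. y \<in> Y \<Longrightarrow> F1 n y > 0" "\<And>u. bdd_above (F1 n ` cylinder Y u)" for F1 :: pot_seq and n
  proof (rule sum_pos[OF fin wne])
    fix u assume "u \<in> words_of_length Y n"
    then obtain y where y: "y \<in> cylinder Y u" using cyl by blast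
    then have "F1 n y \<le> (SUP y\<in>cylinder Y u. F1 n y)" using that(2) by (rule cSUP_upper)
    moreover have "F1 n y > 0" using that(1) y by (auto simp: cylinder_def)
    ultimately show "0 < (SUP y\<in>cylinder Y u. F1 n y)" by linarith
  qed
  have lnS: "\<bar>ln (?S F n) - ln (?S ?H n)\<bar> \<le> D n" if n: "n \<ge> 1" for n
  proof -
    have pF: "?S F n > 0" by (rule posS, rule pos, assumption, rule bddF[OF n])
    have pH: "?S ?H n > 0" by (rule posS[OF _ bddH]) (simp add: additive_seq_def)
    have "?S F n \<le> exp (D n) * ?S ?H n" by (rule mono, rule comp(1)[OF n], assumption, rule bddH)
    moreover have "?S ?H n \<le> exp (D n) * ?S F n" by (rule mono, rule comp(2)[OF n], assumption, rule bddF[OF n])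
    ultimately have "ln (?S F n) \<le> ln (exp (D n) * ?S ?H n)" "ln (?S ?H n) \<le> ln (exp (D n) * ?S F n)"
      using pF pH by (auto intro!: ln_mono)
    then show ?thesis using pF pH by (simp add: ln_mult abs_le_iff)
  qed
  have "(\<lambda>n. ln (?S F n) / real n - ln (?S ?H n) / real n) \<longlonglongrightarrow> 0"
  proof (rule Lim_null_comparison)
    show "(\<lambda>n. D n / real n) \<longlonglongrightarrow> 0" using D by (simp add: uniformly_close_def)
    show "\<forall>\<^sub>F n in sequentially. norm (ln (?S F n) / real n - ln (?S ?H n) / real n) \<le> D n / real n"
      using lnS by (intro eventually_sequentiallyI[of 1])
        (auto simp: diff_divide_distrib[symmetric] intro!: divide_right_mono)
  qed
  then show ?thesis unfolding top_pressure_def by (rule limsup_ereal_cong)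
qed

text \<open>The pressures agree, hence the two Gibbs quotients differ exactly by the factor \<open>F\<^sub>n / exp (S\<^sub>n h)\<close>.\<close>

lemma weak_gibbs_if_close:
  assumes D: "uniformly_close Y F h D" and Y: "subshift Y" "Y \<noteq> {}" and h: "continuous_on Y h"
    and pos: "\<And>n y. y \<in> Y \<Longrightarrow> F n y > 0" and m: "gibbs Y F m"
  shows "weak_gibbs Y (additive_seq h) m"
proof -
  have P: "top_pressure Y F = top_pressure Y (additive_seq h)" by (rule top_pressure_eq_if_close[OF D Y h pos])
  obtain C where C: "C > 0" "\<And>n y. n \<ge> 1 \<Longrightarrow> y \<in> Y \<Longrightarrow> 1 / C < gibbs_ratio Y F m n y \<and> gibbs_ratio Y F m n y < C"
    using m by (auto simp: gibbs_def)
  have lim: "(\<lambda>n. ln (C * exp (D n)) / real n) \<longlonglongrightarrow> 0"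
  proof -
    have "(\<lambda>n. ln C / real n + D n / real n) \<longlonglongrightarrow> 0 + 0"
      using D by (intro tendsto_add) (real_asymp, simp add: uniformly_close_def)
    then show ?thesis using C(1) by (simp add: ln_mult add_divide_distrib)
  qed
  have "1 / (C * exp (D n)) < gibbs_ratio Y (additive_seq h) m n y \<and>
      gibbs_ratio Y (additive_seq h) m n y < C * exp (D n)" if n: "n \<ge> 1" and y: "y \<in> Y" for n y
  proof -
    let ?q = "F n y / exp (birkhoff_sum n h y)"
    have eq: "gibbs_ratio Y (additive_seq h) m n y = gibbs_ratio Y F m n y * ?q"
      using pos[OF y, of n] by (simp add: gibbs_ratio_def P additive_seq_def field_simps)
    have "\<bar>ln ?q\<bar> \<le> D n" using D n y pos[OF y, of n] by (simp add: uniformly_close_def ln_div)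
    moreover have q: "?q > 0" using pos[OF y] by simp
    ultimately have "?q \<le> exp (D n)" "exp (- D n) \<le> ?q"
      by (metis abs_le_iff exp_le_cancel_iff exp_ln, metis abs_le_iff exp_le_cancel_iff exp_ln minus_le_iff)
    note * = this q C(2)[OF n y] C(1)
    have "1 / C > 0" using C(1) by simp
    then have "gibbs_ratio Y F m n y \<ge> 0" using C(2)[OF n y] by linarith
    note * = this *
    have "gibbs_ratio Y F m n y * ?q < C * exp (D n)"
      using * by (intro mult_less_le_imp_less) (auto intro: order.strict_trans[rotated] less_imp_le)
    moreover have "1 / C * exp (- D n) < gibbs_ratio Y F m n y * ?q"
      using * by (intro mult_less_le_imp_less) auto
    moreover have "1 / (C * exp (D n)) = 1 / C * exp (- D n)" by (simp add: exp_minus field_simps)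
    ultimately show ?thesis unfolding eq by simp
  qed
  then show ?thesis
    unfolding weak_gibbs_def using m P C(1) lim
    by (auto simp: gibbs_def intro!: exI[of _ "\<lambda>n. C * exp (D n)"])
qed

text \<open>Both Gibbs properties evaluate the same cylinders, so \<open>log F\<^sub>n\<close> is a Birkhoff sum plus a multiple of
  \<open>n\<close> up to a bounded error, and the sum of the three errors is at most \<open>3 E\<close>.\<close>

lemma almost_additive_if_gibbs:
  assumes Y: "subshift Y" and pos: "\<And>n y. y \<in> Y \<Longrightarrow> F n y > 0"
    and m: "gibbs Y F m" and m': "gibbs Y (additive_seq \<psi>) m"
  shows "almost_additive Y F"
proof -
  obtain C where C: "C > 0" "\<And>n y. n \<ge> 1 \<Longrightarrow> y \<in> Y \<Longrightarrow> 1 / C < gibbs_ratio Y F m n y \<and> gibbs_ratio Y F m n y < C"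
    using m by (auto simp: gibbs_def)
  obtain C' where C': "C' > 0" "\<And>n y. n \<ge> 1 \<Longrightarrow> y \<in> Y \<Longrightarrow>
      1 / C' < gibbs_ratio Y (additive_seq \<psi>) m n y \<and> gibbs_ratio Y (additive_seq \<psi>) m n y < C'"
    using m' by (auto simp: gibbs_def)
  define P where "P = real_of_ereal (top_pressure Y F) - real_of_ereal (top_pressure Y (additive_seq \<psi>))"
  define E where "E = \<bar>ln C\<bar> + \<bar>ln C'\<bar>"
  have est: "\<bar>ln (F n y) - real n * P - birkhoff_sum n \<psi> y\<bar> \<le> E" if n: "n \<ge> 1" and y: "y \<in> Y" for n y
  proof -
    let ?m = "measure m (cylinder Y (word_at y 0 n))"
    let ?a = "real_of_ereal (top_pressure Y F)" and ?b = "real_of_ereal (top_pressure Y (additive_seq \<psi>))"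
    have r0: "gibbs_ratio Y F m n y > 0" "gibbs_ratio Y (additive_seq \<psi>) m n y > 0"
      using C C' n y by (meson less_trans zero_less_divide_1_iff)+
    then have m0: "?m > 0"
      using pos[OF y, of n] by (auto simp: gibbs_ratio_def zero_less_divide_iff zero_less_mult_iff)
    have l1: "ln (gibbs_ratio Y F m n y) = ln ?m + real n * ?a - ln (F n y)"
      using m0 pos[OF y, of n] by (simp add: gibbs_ratio_def ln_div ln_mult)
    have l2: "ln (gibbs_ratio Y (additive_seq \<psi>) m n y) = ln ?m + real n * ?b - birkhoff_sum n \<psi> y"
      using m0 by (simp add: gibbs_ratio_def ln_div ln_mult additive_seq_def exp_add[symmetric])
    have "ln (1 / C) < ln (gibbs_ratio Y F m n y)" "ln (gibbs_ratio Y F m n y) < ln C"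
      "ln (1 / C') < ln (gibbs_ratio Y (additive_seq \<psi>) m n y)" "ln (gibbs_ratio Y (additive_seq \<psi>) m n y) < ln C'"
      using C C' n y r0 by (auto simp del: ln_div)
    then show ?thesis using C(1) C'(1) l1 l2 unfolding E_def P_def by (simp add: ln_div algebra_simps)
  qed
  have "exp (- (3 * E)) * F n y * F l ((shift_map ^^ n) y) \<le> F (n + l) y \<and>
     F (n + l) y \<le> exp (3 * E) * F n y * F l ((shift_map ^^ n) y)"
    if n: "n \<ge> 1" and l: "l \<ge> 1" and y: "y \<in> Y" for n l y
  proof -
    let ?z = "(shift_map ^^ n) y"
    have z: "?z \<in> Y" using subshift_funpow[OF Y y] .
    have nl: "n + l \<ge> 1" using n by simp
    have "\<bar>ln (F (n + l) y) - ln (F n y) - ln (F l ?z)\<bar> \<le> 3 * E"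
      using est[OF n y] est[OF l z] est[OF nl y] unfolding birkhoff_sum_add by (simp add: algebra_simps)
    then have "- (3 * E) + ln (F n y) + ln (F l ?z) \<le> ln (F (n + l) y)"
      "ln (F (n + l) y) \<le> 3 * E + ln (F n y) + ln (F l ?z)" by auto
    then have "exp (- (3 * E) + ln (F n y) + ln (F l ?z)) \<le> exp (ln (F (n + l) y))"
      "exp (ln (F (n + l) y)) \<le> exp (3 * E + ln (F n y) + ln (F l ?z))" by simp_all
    then show ?thesis using pos[OF y, of n] pos[OF z, of l] pos[OF y, of "n + l"]
      by (simp only: exp_add exp_ln simp_thms)
  qed
  moreover have "3 * E \<ge> 0" by (simp add: E_def)
  ultimately show ?thesis unfolding almost_additive_def by blast
qed

lemma funpow_mult_fixpoint: "(g ^^ q) y = y \<Longrightarrow> (g ^^ (j * q)) y = y"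
  by (induction j) (auto simp: funpow_add)

context factor_system
begin

section \<open>Exponents at periodic points\<close>

text \<open>The conditions at periodic points are all expressed by one number: the upper exponential growth
  rate of \<open>G\<^sub>n / exp (S\<^sub>n h)\<close>.\<close>

definition excess :: "(seq \<Rightarrow> real) \<Rightarrow> seq \<Rightarrow> ereal" where
  "excess h y = limsup (\<lambda>n. ereal ((ln (G n y) - birkhoff_sum n h y) / real n))"

lemma gfun_limsup:
  assumes y: "y \<in> Y"
  shows "limsup (\<lambda>n. ereal (ln (gfun X \<Phi> f n y / exp (birkhoff_sum n h y)) / real n)) = excess h y"
  unfolding excess_def
proof (rule limsup_ereal_cong, rule Lim_null_comparison)
  show "(\<lambda>n. ln K / real n) \<longlonglongrightarrow> 0" by real_asymp
  show "\<forall>\<^sub>F n in sequentially. norm (ln (gfun X \<Phi> f n y / exp (birkhoff_sum n h y)) / real n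
      - (ln (G n y) - birkhoff_sum n h y) / real n) \<le> ln K / real n"
  proof (intro always_eventually allI)
    fix n
    have "ln (gfun X \<Phi> f n y / exp (birkhoff_sum n h y)) = ln (gfun X \<Phi> f n y) - birkhoff_sum n h y"
      using gfun_pos[OF y, of n] by (simp add: ln_div)
    then have "norm (ln (gfun X \<Phi> f n y / exp (birkhoff_sum n h y)) / real n
      - (ln (G n y) - birkhoff_sum n h y) / real n) = \<bar>ln (gfun X \<Phi> f n y) - ln (G n y)\<bar> / real n"
      by (simp add: diff_divide_distrib[symmetric])
    also have "\<dots> \<le> ln K / real n" using ln_gfun[OF y, of n] by (rule divide_right_mono) simp
    finally show "norm (ln (gfun X \<Phi> f n y / exp (birkhoff_sum n h y)) / real n
      - (ln (G n y) - birkhoff_sum n h y) / real n) \<le> ln K / real n" .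
  qed
qed

lemma h_bound:
  assumes h: "continuous_on Y h"
  obtains Bh where "Bh \<ge> 0" "\<And>y n. y \<in> Y \<Longrightarrow> \<bar>birkhoff_sum n h y\<bar> \<le> real n * Bh"
proof -
  obtain Bh where Bh: "Bh \<ge> 0" "\<And>x. x \<in> Y \<Longrightarrow> \<bar>h x\<bar> \<le> Bh"
    by (rule continuous_on_subshift_bounded[OF subshift_Y h]) blast
  show ?thesis
    by (rule that[OF Bh(1)], rule birkhoff_sum_bounded[OF subshift_Y]) (auto intro: Bh(2))
qed

text \<open>Division of \<open>n\<close> by the period \<open>q\<close> and submultiplicativity bound the growth rate by its value over a
  single period; \<open>C\<close> absorbs the last incomplete period.\<close>

lemma G_period_bound:
  assumes y: "y \<in> Y" "(shift_map ^^ q) y = y" and q: "q \<ge> 1" and h: "continuous_on Y h"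
  obtains C where "\<And>n. ln (G n y) - birkhoff_sum n h y \<le> real n * ((ln (G q y) - birkhoff_sum q h y) / real q) + C"
proof -
  obtain Bh where Bh: "Bh \<ge> 0" "\<And>y n. y \<in> Y \<Longrightarrow> \<bar>birkhoff_sum n h y\<bar> \<le> real n * Bh"
    by (rule h_bound[OF h]) blast
  define d where "d = (ln (G q y) - birkhoff_sum q h y) / real q"
  have "ln (G n y) - birkhoff_sum n h y \<le> real n * d + real q * (ln M + Bh + \<bar>d\<bar>)" for n
  proof -
    let ?j = "n div q" and ?r = "n mod q"
    have n: "n = ?j * q + ?r" by simp
    have r: "real ?r \<le> real q" using q by (simp add: less_imp_le)
    have fix_jq: "(shift_map ^^ (?j * q)) y = y"
      using y(2) by (rule funpow_mult_fixpoint)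
    have "G n y \<le> G (?j * q) y * M ^ ?r" by (subst n) (rule G_add_const[OF y(1)])
    also have "\<dots> \<le> G q y ^ ?j * M ^ ?r" using G_period[OF y] M1 by (intro mult_right_mono) auto
    finally have "ln (G n y) \<le> ln (G q y ^ ?j * M ^ ?r)" using G_pos[OF y(1), of n] by simp
    also have "\<dots> = real ?j * ln (G q y) + real ?r * ln M"
      using G_pos[OF y(1), of q] M1 by (simp add: ln_mult ln_realpow)
    finally have 1: "ln (G n y) \<le> real ?j * ln (G q y) + real ?r * ln M" .
    have "birkhoff_sum n h y = birkhoff_sum (?j * q + ?r) h y" by simp
    also have "\<dots> = real ?j * birkhoff_sum q h y + birkhoff_sum ?r h y"
      by (simp only: birkhoff_sum_add birkhoff_sum_period[OF y(2)] fix_jq)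
    finally have 2: "birkhoff_sum n h y = real ?j * birkhoff_sum q h y + birkhoff_sum ?r h y" .
    have "real ?j * (ln (G q y) - birkhoff_sum q h y) = real ?j * real q * d" using q by (simp add: d_def)
    also have "\<dots> = real n * d - real ?r * d"
    proof -
      have "real n = real ?j * real q + real ?r" by (metis n of_nat_add of_nat_mult)
      then show ?thesis by (simp only: ring_distribs)
    qed
    finally have 3: "real ?j * (ln (G q y) - birkhoff_sum q h y) = real n * d - real ?r * d" .
    have lnM: "ln M \<ge> 0" using M1 by simp
    have 4: "real ?r * ln M \<le> real q * ln M" "- birkhoff_sum ?r h y \<le> real q * Bh" "- (real ?r * d) \<le> real q * \<bar>d\<bar>"
    proof -
      show "real ?r * ln M \<le> real q * ln M" using r lnM by (rule mult_right_mono)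
      have "real ?r * Bh \<le> real q * Bh" using r Bh(1) by (rule mult_right_mono)
      then show "- birkhoff_sum ?r h y \<le> real q * Bh" using Bh(2)[OF y(1), of ?r] by linarith
      have "real ?r * \<bar>d\<bar> \<le> real q * \<bar>d\<bar>" using r by (rule mult_right_mono) simp
      moreover have "- (real ?r * d) \<le> real ?r * \<bar>d\<bar>" by (metis abs_ge_minus_self mult_left_mono mult_minus_right of_nat_0_le_iff)
      ultimately show "- (real ?r * d) \<le> real q * \<bar>d\<bar>" by linarith
    qed
    show ?thesis using 1 2 3 4 by (simp add: algebra_simps)
  qed
  then show ?thesis unfolding d_def by (rule that)
qed

text \<open>The growth rate is at most its value over a single period. This supplies the lower hypothesis of
  \<open>uniform_estimate_if_periodic_estimates\<close>.\<close>

lemma fibre_sum_lower_if_excess_nonneg: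
  assumes y: "y \<in> Y" "(shift_map ^^ q) y = y" and q: "q \<ge> 1" and h: "continuous_on Y h"
    and ex: "excess h y \<ge> 0"
  shows "birkhoff_sum q h y \<le> ln (G q y)"
proof -
  define d where "d = (ln (G q y) - birkhoff_sum q h y) / real q"
  obtain C where C: "\<And>n. ln (G n y) - birkhoff_sum n h y \<le> real n * d + C"
    unfolding d_def by (rule G_period_bound[OF y q h]) blast
  have "excess h y \<le> limsup (\<lambda>n. ereal ((real n * d + C) / real n))"
    unfolding excess_def using C by (intro Limsup_mono always_eventually allI) (simp add: divide_right_mono)
  also have "(\<lambda>n. (real n * d + C) / real n) \<longlonglongrightarrow> d" by real_asymp
  then have "limsup (\<lambda>n. ereal ((real n * d + C) / real n)) = ereal d"
    by (intro lim_imp_Limsup) auto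
  finally have "excess h y \<le> ereal d" .
  with ex have "0 \<le> ereal d" by (rule order_trans)
  then have "0 \<le> d" by simp
  then show ?thesis using q by (simp add: d_def zero_le_divide_iff)
qed

text \<open>Iterating the loops at \<open>a\<close> produces at least \<open>Z\<^sup>j\<close> of weight, up to \<open>K\<^sup>2\<^sup>j\<close>, among the words over \<open>j\<close>
  periods, so their weight is limited by the growth rate.\<close>

lemma loop_sum_upper_if_excess_nonpos:
  assumes y: "y \<in> Y" "(shift_map ^^ q) y = y" and q: "q \<ge> 1"
    and ex: "excess h y \<le> 0" and lp: "loops X \<Phi> q y a \<noteq> {}"
  shows "ln (Z q y a) \<le> birkhoff_sum q h y + 2 * ln K"
proof -
  define d where "d = (ln (Z q y a) - birkhoff_sum q h y - 2 * ln K) / real q"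
  let ?u = "\<lambda>n. ereal ((ln (G n y) - birkhoff_sum n h y) / real n)"
  have ud: "ereal d \<le> ?u (Suc j * q)" for j
  proof -
    have "Z q y a ^ Suc j \<le> K ^ (2 * j) * Z (Suc j * q) y a" by (rule Z_power[OF y(2)])
    also have "\<dots> \<le> K ^ (2 * j) * G (Suc j * q) y" using K1 by (intro mult_left_mono Z_le_G) auto
    finally have "ln (Z q y a ^ Suc j) \<le> ln (K ^ (2 * j) * G (Suc j * q) y)" 
      using Z_pos[OF lp] by (intro ln_mono) auto
    then have "real (Suc j) * ln (Z q y a) \<le> 2 * real j * ln K + ln (G (Suc j * q) y)"
      using Z_pos[OF lp] K1 G_pos[OF y(1), of "Suc j * q"] by (simp only: ln_mult ln_realpow) (simp add: ln_mult ln_realpow)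
    moreover have "2 * real j * ln K \<le> 2 * real (Suc j) * ln K" using K1 by (intro mult_right_mono) auto
    moreover have "birkhoff_sum (Suc j * q) h y = real (Suc j) * birkhoff_sum q h y"
      by (rule birkhoff_sum_period[OF y(2)])
    ultimately have "real (Suc j) * (ln (Z q y a) - birkhoff_sum q h y - 2 * ln K)
      \<le> ln (G (Suc j * q) y) - birkhoff_sum (Suc j * q) h y" by (simp add: algebra_simps)
    then have "real (Suc j) * (ln (Z q y a) - birkhoff_sum q h y - 2 * ln K) / real (Suc j * q)
      \<le> (ln (G (Suc j * q) y) - birkhoff_sum (Suc j * q) h y) / real (Suc j * q)"
      by (rule divide_right_mono) simp
    moreover have "real (Suc j) * (ln (Z q y a) - birkhoff_sum q h y - 2 * ln K) / real (Suc j * q) = d"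
      using q unfolding d_def of_nat_mult by (simp del: of_nat_Suc)
    ultimately show ?thesis by simp
  qed
  have "ereal d \<le> limsup (\<lambda>j. ?u (Suc j * q))"
    by (rule le_Limsup, simp, rule always_eventually, rule allI, rule ud)
  also have "\<dots> = limsup (?u \<circ> (\<lambda>j. Suc j * q))" by (simp only: o_def)
  also have "\<dots> \<le> limsup ?u"
    using q by (intro limsup_subseq_mono) (auto simp: strict_mono_def)
  also have "\<dots> \<le> 0" using ex by (simp add: excess_def)
  finally have "d \<le> 0" by simp
  then show ?thesis using q by (simp add: d_def divide_le_0_iff)
qed

section \<open>Relative pressure\<close>

text \<open>A word over \<open>y\<^sub>1 \<dots> y\<^sub>n\<close> need not extend to a point over \<open>y\<close>. Relative pressure sees only those words that
  do, while \<open>g\<^sub>n\<close> counts all of them.\<close>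

definition live_words :: "nat \<Rightarrow> seq \<Rightarrow> nat list set" where
  "live_words n y = (\<lambda>x. word_at x 0 n) ` {x \<in> X. \<pi> x = y}"

abbreviation "Q n y \<equiv> sum W (live_words n y)"

lemma live_FW: "live_words n y \<subseteq> FW n y"
  by (auto simp: live_words_def intro: word_at_in_FW)

lemma finite_live [simp]: "finite (live_words n y)"
  by (rule finite_subset[OF live_FW]) simp

lemma live_in_words: "live_words n y \<subseteq> words X"
  using live_FW fibre_wordsD by blast

lemma Q_le_G: "Q n y \<le> G n y"
  unfolding fibre_sum_def
  by (intro sum_mono2 live_FW) (auto intro: less_imp_le weight_pos fibre_wordsD)

lemma Q_ge: "y \<in> Y \<Longrightarrow> 1 \<le> M ^ n * Q n y"
proof -
  assume "y \<in> Y"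
  then obtain x where "x \<in> X" "\<pi> x = y" using Y_eq by auto
  then have "word_at x 0 n \<in> live_words n y" by (auto simp: live_words_def)
  then show ?thesis by (intro sum_weights_ge[of "word_at x 0 n"] live_in_words) auto
qed

lemma Q_pos: "y \<in> Y \<Longrightarrow> Q n y > 0"
  using Q_ge[of y n] M1 by (smt (verit) mult_nonneg_nonpos zero_le_power)

lemma ln_Q_bounds:
  assumes "y \<in> Y" shows "\<bar>ln (Q n y)\<bar> \<le> real n * ln M"
proof -
  have "Q n y \<le> M ^ n" using Q_le_G G_le by (rule order_trans)
  then have "ln (Q n y) \<le> ln (M ^ n)" using Q_pos[OF assms] by (intro ln_mono) auto
  moreover have "0 \<le> ln (M ^ n * Q n y)" using Q_ge[OF assms] by (intro ln_ge_zero)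
  ultimately show ?thesis using M1 Q_pos[OF assms, of n] by (simp add: ln_mult ln_realpow)
qed

text \<open>Points separated at scale \<open>\<delta> \<ge> 2\<^sup>-\<^sup>j\<close> within \<open>n\<close> steps differ in one of their first \<open>n + j\<close> symbols. The last
  \<open>j\<close> of these account for the factor \<open>k\<^sup>j\<close>, which does not depend on \<open>n\<close>.\<close>

lemma separated_sum_le:
  assumes E: "E \<subseteq> {x \<in> X. \<pi> x = y}" "separated n \<delta> E" and j: "(1/2) ^ j \<le> \<delta>"
  shows "(\<Sum>x\<in>E. exp (birkhoff_sum n f x)) \<le> real k ^ j * Q n y"
proof -
  let ?w = "\<lambda>x. (word_at x 0 n, word_at x n j)"
  let ?J = "{v. set v \<subseteq> {1..k} \<and> length v = j}"
  have inj: "inj_on ?w E"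
  proof (rule inj_onI, rule ccontr)
    fix x x' assume x: "x \<in> E" "x' \<in> E" "?w x = ?w x'" "x \<noteq> x'"
    then obtain i where i: "i < n" "seq_dist ((shift_map ^^ i) x) ((shift_map ^^ i) x') > \<delta>"
      using E(2) unfolding separated_def by blast
    have agree: "x l = x' l" if "l < n + j" for l
    proof (cases "l < n")
      case True then show ?thesis using x(3) by (auto simp: word_at_eq_iff)
    next
      case False
      moreover have "x (n + (l - n)) = x' (n + (l - n))" if "l - n < j"
        using x(3) that unfolding prod.inject word_at_eq_iff by blast
      ultimately show ?thesis using that by simp
    qed
    define l where "l = (LEAST l. (shift_map ^^ i) x l \<noteq> (shift_map ^^ i) x' l)"
    have ne: "(shift_map ^^ i) x \<noteq> (shift_map ^^ i) x'"
    proof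
      assume "(shift_map ^^ i) x = (shift_map ^^ i) x'"
      then have "seq_dist ((shift_map ^^ i) x) ((shift_map ^^ i) x') = 0" by (simp add: seq_dist_def)
      moreover have "(0::real) < (1/2) ^ j" by simp
      ultimately show False using i(2) j by linarith
    qed
    then have "\<exists>l. (shift_map ^^ i) x l \<noteq> (shift_map ^^ i) x' l" by blast
    from LeastI_ex[OF this] have "(shift_map ^^ i) x l \<noteq> (shift_map ^^ i) x' l" unfolding l_def .
    then have "n + j \<le> l + i" using agree[of "l + i"] unfolding shift_map_funpow by linarith
    then have "j \<le> l" using i(1) by simp
    then have "(1/2::real) ^ l \<le> (1/2) ^ j" by (intro power_decreasing) auto
    moreover have "seq_dist ((shift_map ^^ i) x) ((shift_map ^^ i) x') = (1/2) ^ l"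
      using ne by (simp add: seq_dist_def l_def)
    ultimately show False using i(2) j by linarith
  qed
  have sub: "?w ` E \<subseteq> live_words n y \<times> ?J"
  proof
    fix p assume "p \<in> ?w ` E"
    then obtain x where x: "x \<in> X" "\<pi> x = y" "p = ?w x" using E(1) by blast
    then have "set (word_at x n j) \<subseteq> {1..k}" using k[OF x(1)] by (simp only: word_at_def) auto
    then show "p \<in> live_words n y \<times> ?J" using x by (auto simp: live_words_def)
  qed
  have finJ: "finite ?J" by (rule finite_lists_length_eq) simp
  have "(\<Sum>x\<in>E. exp (birkhoff_sum n f x)) \<le> (\<Sum>x\<in>E. W (fst (?w x)))"
  proof (rule sum_mono)
    fix x assume "x \<in> E"
    then have "x \<in> cylinder X (word_at x 0 n)" using E(1) by (auto simp: in_cylinder_word_at)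
    from weight_ge[OF this] show "exp (birkhoff_sum n f x) \<le> W (fst (?w x))" by simp
  qed
  also have "\<dots> = (\<Sum>p\<in>?w ` E. W (fst p))" by (subst sum.reindex[OF inj]) simp
  also have "\<dots> \<le> (\<Sum>p\<in>live_words n y \<times> ?J. W (fst p))"
    using sub finJ
    by (intro sum_mono2) (auto intro!: less_imp_le weight_pos live_in_words[THEN subsetD])
  also have "\<dots> = (\<Sum>u\<in>live_words n y. \<Sum>v\<in>?J. W u)"
    unfolding sum.cartesian_product by (rule sum.cong) auto
  also have "\<dots> = real (card ?J) * Q n y" by (simp add: sum_distrib_left)
  also have "card ?J = k ^ j" using card_lists_length_eq[of "{1..k}" j] by simp
  finally show ?thesis by simp
qed

text \<open>Points in different \<open>n\<close>-cylinders differ in a first symbol after fewer than \<open>n\<close> shifts, so they are at distance \<open>1\<close> there.\<close>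

lemma separated_sum_ge:
  assumes "\<delta> < 1"
  obtains E where "E \<subseteq> {x \<in> X. \<pi> x = y}" "separated n \<delta> E" "Q n y \<le> K * (\<Sum>x\<in>E. exp (birkhoff_sum n f x))"
proof -
  have "\<forall>u\<in>live_words n y. \<exists>x. x \<in> X \<and> \<pi> x = y \<and> word_at x 0 n = u" by (auto simp: live_words_def)
  then obtain p where p: "\<And>u. u \<in> live_words n y \<Longrightarrow> p u \<in> X \<and> \<pi> (p u) = y \<and> word_at (p u) 0 n = u"
    by metis
  let ?E = "p ` live_words n y"
  have sep: "separated n \<delta> ?E"
    unfolding separated_def
  proof (intro ballI impI)
    fix x x' assume x: "x \<in> ?E" "x' \<in> ?E" "x \<noteq> x'"
    then obtain u u' where u: "u \<in> live_words n y" "u' \<in> live_words n y" "x = p u" "x' = p u'" "u \<noteq> u'" by auto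
    then have "word_at x 0 n \<noteq> word_at x' 0 n" using p by auto
    then obtain i where i: "i < n" "x i \<noteq> x' i" by (auto simp: word_at_eq_iff)
    have "(LEAST l. (shift_map ^^ i) x l \<noteq> (shift_map ^^ i) x' l) = 0"
      using i(2) by (intro Least_eq_0) (simp add: shift_map_funpow)
    then have "seq_dist ((shift_map ^^ i) x) ((shift_map ^^ i) x') = 1"
      using i(2) by (auto simp: seq_dist_def shift_map_funpow dest: fun_cong[of _ _ 0])
    then show "\<exists>i<n. seq_dist ((shift_map ^^ i) x) ((shift_map ^^ i) x') > \<delta>"
      using i(1) assms by auto
  qed
  have inj: "inj_on p (live_words n y)" using p by (metis inj_onI)
  have "Q n y \<le> (\<Sum>u\<in>live_words n y. K * exp (birkhoff_sum n f (p u)))"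
  proof (rule sum_mono)
    fix u assume u: "u \<in> live_words n y"
    have l: "length u = n" using p[OF u] length_word_at by metis
    then have "p u \<in> cylinder X u" using p[OF u] by (simp add: cylinder_def)
    with l show "W u \<le> K * exp (birkhoff_sum n f (p u))" using weight_le by blast
  qed
  also have "\<dots> = K * (\<Sum>x\<in>?E. exp (birkhoff_sum n f x))"
    by (simp add: sum.reindex[OF inj] sum_distrib_left)
  finally show ?thesis using sep p by (intro that[of ?E]) auto
qed

lemma birkhoff_sum_fibre:
  assumes "x \<in> X" "\<pi> x = y"
  shows "birkhoff_sum n (\<lambda>x. f x - h (\<pi> x)) x = birkhoff_sum n f x - birkhoff_sum n h y"
  using assms by (simp add: birkhoff_sum_def sum_subtractf pi_funpow)

lemma rel_pressure_n_bounds: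
  assumes \<delta>: "\<delta> < 1" "(1/2) ^ j \<le> \<delta>"
  shows "exp (- birkhoff_sum n h y) * Q n y \<le> K * rel_pressure_n X \<pi> (\<lambda>x. f x - h (\<pi> x)) n \<delta> y"
    and "rel_pressure_n X \<pi> (\<lambda>x. f x - h (\<pi> x)) n \<delta> y \<le> exp (- birkhoff_sum n h y) * (real k ^ j * Q n y)"
proof -
  let ?F = "\<lambda>x. f x - h (\<pi> x)" and ?e = "exp (- birkhoff_sum n h y)"
  let ?\<E> = "{E. E \<subseteq> {x \<in> X. \<pi> x = y} \<and> separated n \<delta> E}"
  have eq: "(\<Sum>x\<in>E. exp (birkhoff_sum n ?F x)) = ?e * (\<Sum>x\<in>E. exp (birkhoff_sum n f x))"
    if "E \<subseteq> {x \<in> X. \<pi> x = y}" for E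
    using that unfolding sum_distrib_left
    by (intro sum.cong) (auto simp: birkhoff_sum_fibre exp_diff exp_minus field_simps)
  have up: "(\<Sum>x\<in>E. exp (birkhoff_sum n ?F x)) \<le> ?e * (real k ^ j * Q n y)" if "E \<in> ?\<E>" for E
    using that separated_sum_le[of E y n \<delta> j] \<delta>(2) by (simp add: eq)
  then have bdd: "bdd_above ((\<lambda>E. \<Sum>x\<in>E. exp (birkhoff_sum n ?F x)) ` ?\<E>)"
    by (rule bdd_aboveI2)
  have "{} \<in> ?\<E>" by (simp add: separated_def)
  then show "rel_pressure_n X \<pi> ?F n \<delta> y \<le> ?e * (real k ^ j * Q n y)"
    unfolding rel_pressure_n_def using up by (intro cSUP_least) auto
  obtain E where E': "E \<subseteq> {x \<in> X. \<pi> x = y}" "separated n \<delta> E"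
      "Q n y \<le> K * (\<Sum>x\<in>E. exp (birkhoff_sum n f x))"
    by (rule separated_sum_ge[OF \<delta>(1)])
  then have E: "E \<in> ?\<E>" "Q n y \<le> K * (\<Sum>x\<in>E. exp (birkhoff_sum n f x))" by simp_all
  have "?e * Q n y \<le> ?e * (K * (\<Sum>x\<in>E. exp (birkhoff_sum n f x)))"
    using E(2) by (intro mult_left_mono) auto
  also have "\<dots> = K * (\<Sum>x\<in>E. exp (birkhoff_sum n ?F x))" using E(1) by (simp add: eq)
  also have "\<dots> \<le> K * rel_pressure_n X \<pi> ?F n \<delta> y"
    unfolding rel_pressure_n_def using bdd E(1) K1 by (intro mult_left_mono cSUP_upper) auto
  finally show "?e * Q n y \<le> K * rel_pressure_n X \<pi> ?F n \<delta> y" .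
qed

lemma rel_pressure_delta_eq:
  assumes y: "y \<in> Y" and \<delta>: "0 < \<delta>" "\<delta> < 1"
  shows "rel_pressure_delta X \<pi> (\<lambda>x. f x - h (\<pi> x)) \<delta> y
    = limsup (\<lambda>n. ereal ((ln (Q n y) - birkhoff_sum n h y) / real n))"
proof -
  obtain j where j: "(1/2) ^ j < \<delta>" using real_arch_pow_inv[OF \<delta>(1), of "1/2"] by auto
  let ?r = "\<lambda>n. rel_pressure_n X \<pi> (\<lambda>x. f x - h (\<pi> x)) n \<delta> y"
  define C where "C = ln K + real j * ln k"
  have b: "\<bar>ln (?r n) - (ln (Q n y) - birkhoff_sum n h y)\<bar> \<le> C" for n
  proof -
    note r = rel_pressure_n_bounds[OF \<delta>(2) less_imp_le[OF j], where n = n and h = h and y = y]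
    have "exp (- birkhoff_sum n h y) * Q n y > 0" using Q_pos[OF y, of n] by simp
    then have "K * ?r n > 0" using r(1) by linarith
    then have r0: "?r n > 0" using K1 by (simp add: zero_less_mult_iff)
    have "ln (exp (- birkhoff_sum n h y) * Q n y) \<le> ln (K * ?r n)"
      using r(1) Q_pos[OF y, of n] by (intro ln_mono) auto
    moreover have "ln (?r n) \<le> ln (exp (- birkhoff_sum n h y) * (real k ^ j * Q n y))"
      using r(2) r0 by (intro ln_mono) auto
    moreover have "ln K \<ge> 0" "real j * ln k \<ge> 0" using K1 k1 by auto
    moreover have "ln (exp (- birkhoff_sum n h y) * Q n y) = ln (Q n y) - birkhoff_sum n h y"
      "ln (K * ?r n) = ln K + ln (?r n)"
      "ln (exp (- birkhoff_sum n h y) * (real k ^ j * Q n y)) = real j * ln k + ln (Q n y) - birkhoff_sum n h y"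
      using r0 Q_pos[OF y, of n] K1 k1 by (simp_all add: ln_mult ln_realpow)
    ultimately show ?thesis unfolding C_def by linarith
  qed
  show ?thesis
    unfolding rel_pressure_delta_def
  proof (rule limsup_ereal_cong, rule Lim_null_comparison)
    show "(\<lambda>n. C / real n) \<longlonglongrightarrow> 0" by real_asymp
    show "\<forall>\<^sub>F n in sequentially. norm (ln (?r n) / real n - (ln (Q n y) - birkhoff_sum n h y) / real n) \<le> C / real n"
      using b by (intro always_eventually allI) (auto simp: diff_divide_distrib[symmetric] intro!: divide_right_mono)
  qed
qed

text \<open>The growth rate is the same for every \<open>\<delta> < 1\<close>, so the limit \<open>\<delta> \<rightarrow> 0\<close> is that of a constant.\<close>

lemma rel_pressure_eq:
  assumes y: "y \<in> Y"
  shows "rel_pressure X \<pi> (\<lambda>x. f x - h (\<pi> x)) y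
    = limsup (\<lambda>n. ereal ((ln (Q n y) - birkhoff_sum n h y) / real n))"
  unfolding rel_pressure_def
proof (rule tendsto_Lim, simp, rule tendsto_eventually)

    
  show "\<forall>\<^sub>F \<delta> in at_right 0. rel_pressure_delta X \<pi> (\<lambda>x. f x - h (\<pi> x)) \<delta> y
    = limsup (\<lambda>n. ereal ((ln (Q n y) - birkhoff_sum n h y) / real n))"
    using rel_pressure_delta_eq[OF y] unfolding eventually_at_right_field by (intro exI[of _ 1]) auto
qed

text \<open>Over a periodic point a word of the fibre can only fail to extend to a point of the fibre
  during its last \<open>L\<close> symbols: by compactness there is a uniform bound for the length of the
  words over the (finitely many) shifts of \<open>y\<close> whose first symbol is not live.\<close>

lemma G_le_Q_periodic:
  assumes y: "y \<in> Y" "(shift_map ^^ q) y = y" and q: "q \<ge> 1"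
  obtains L where "\<And>n. n \<ge> 1 \<Longrightarrow> G (n + L) y \<le> M ^ L * Q n y"
proof -
  have "\<exists>L. (\<exists>x\<in>X. x 0 = a \<and> (\<forall>j<L. \<Phi> (x j) = y (i + j))) \<longrightarrow> (\<exists>x\<in>X. x 0 = a \<and> \<pi> x = (shift_map ^^ i) y)" for a i
  proof (rule ccontr)
    assume c: "\<not> ?thesis"
    have "X \<inter> (\<Inter>j\<in>UNIV. {x. x 0 = a} \<inter> {x. \<Phi> (x j) = y (i + j)}) \<noteq> {}"
    proof (rule compact_imp_fip_image[OF compact_subshift[OF subshift_X]])
      show "closed ({x. x 0 = a} \<inter> {x. \<Phi> (x j) = y (i + j)})" for j
        by (intro closed_Int closed_coords)
      fix J :: "nat set" assume J: "finite J"
      then obtain L where L: "\<forall>j\<in>J. j < L" using finite_nat_set_iff_bounded by auto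
      from c obtain x where "x \<in> X" "x 0 = a" "\<forall>j<L. \<Phi> (x j) = y (i + j)" by blast
      with L show "X \<inter> (\<Inter>j\<in>J. {x. x 0 = a} \<inter> {x. \<Phi> (x j) = y (i + j)}) \<noteq> {}" by blast
    qed
    then obtain x where "x \<in> X" "x 0 = a" "\<And>j. \<Phi> (x j) = y (i + j)" by auto
    moreover from this have "\<pi> x = (shift_map ^^ i) y" by (auto simp: pi_nth shift_map_funpow add.commute)
    ultimately show False using c by blast
  qed
  then obtain L where L: "\<And>a i x. x \<in> X \<Longrightarrow> x 0 = a \<Longrightarrow> (\<And>j. j < L a i \<Longrightarrow> \<Phi> (x j) = y (i + j)) \<Longrightarrow>
      \<exists>x\<in>X. x 0 = a \<and> \<pi> x = (shift_map ^^ i) y" by metis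
  define L0 where "L0 = Suc (Max ((\<lambda>(a, i). L a i) ` ({1..k} \<times> {..<q})))"
  have L0: "L a i < L0" if "a \<in> {1..k}" "i < q" for a i
    unfolding L0_def less_Suc_eq_le by (intro Max_ge) (use that in auto)
  have per: "y (n + j) = y (n mod q + j)" for n j
  proof -
    have "(shift_map ^^ (n div q * q)) y = y" using y(2) by (rule funpow_mult_fixpoint)
    then have "y (n mod q + j + n div q * q) = y (n mod q + j)" by (metis shift_map_funpow)
    moreover have "n mod q + j + n div q * q = n + j" by (metis add.assoc add.commute div_mult_mod_eq)
    ultimately show ?thesis by simp
  qed
  have "G (n + L0) y \<le> M ^ L0 * Q n y" if n: "n \<ge> 1" for n
  proof -
    have live: "take n u \<in> live_words n y" if u: "u \<in> FW (n + L0) y" for u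
    proof -
      have lu: "length u = n + L0" using fibre_wordsD(2)[OF u] .
      have uy: "\<Phi> (u ! i) = y i" if "i < n + L0" for i
        using fibre_wordsD(3)[OF u] lu that by (metis nth_map word_at_nth add_0)
      obtain x where x: "x \<in> X" "\<And>i. i < n + L0 \<Longrightarrow> x i = u ! i"
        using words_cylinder[OF fibre_wordsD(1)[OF u]] lu by (auto simp: in_cylinder_iff)
      let ?z = "(shift_map ^^ n) x" and ?a = "u ! n"
      have L0': "L0 > 0" by (simp add: L0_def)
      have z: "?z \<in> X" "?z 0 = ?a"
        using subshift_funpow[OF subshift_X x(1)] x(2)[of n] L0' by (auto simp: shift_map_funpow)
      have "?a \<in> {1..k}" using k[OF x(1), of n] x(2)[of n] L0' by simp
      then have "L ?a (n mod q) < L0" using q by (intro L0) auto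
      then have "\<Phi> (?z j) = y (n mod q + j)" if "j < L ?a (n mod q)" for j
        using that x(2)[of "j + n"] uy[of "j + n"] per[of n j] by (simp add: shift_map_funpow add.commute)
      from L[OF z this] obtain t where t: "t \<in> X" "t 0 = ?a" "\<pi> t = (shift_map ^^ (n mod q)) y" by blast
      let ?v = "take n u"
      have su: "successively (edge X) u" by (rule successively_words[OF fibre_wordsD(1)[OF u]])
      have v: "?v \<noteq> []" "length ?v = n" using lu n by auto
      have "successively (edge X) (?v @ drop n u)" using su by simp
      then have sv: "successively (edge X) ?v" "edge X (last ?v) (hd (drop n u))"
        unfolding successively_append_iff using v lu L0' by auto
      have "hd (drop n u) = t 0" using lu L0' t(2) by (simp add: hd_drop_conv_nth)
      with sv(2) have "edge X (last ?v) (t 0)" by simp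
      from glue_in_sft[OF sft v(1) sv(1) t(1) this, unfolded v(2)]
      have s: "(\<lambda>i. if i < n then ?v ! i else t (i - n)) \<in> X" (is "?s \<in> X") .
      have "\<pi> ?s = y"
      proof
        fix i
        show "\<pi> ?s i = y i"
        proof (cases "i < n")
          case True then show ?thesis using uy[of i] by (simp add: pi_nth[OF s])
        next
          case False
          have "\<pi> ?s i = \<pi> t (i - n)" using False by (simp add: pi_nth[OF s] pi_nth[OF t(1)])
          also have "\<dots> = y (i - n + n mod q)" by (simp add: t(3) shift_map_funpow)
          also have "\<dots> = y i" using per[of n "i - n"] False by (simp add: add.commute)
          finally show ?thesis .
        qed
      qed
      moreover have "word_at ?s 0 n = ?v" using v(2) by (intro word_at_eq_listI) auto
      ultimately show ?thesis unfolding live_words_def using s by (metis (mono_tags, lifting) image_eqI mem_Collect_eq)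
    qed
    have "G (n + L0) y \<le> Q n y * sum W (FW L0 ((shift_map ^^ n) y))"
      unfolding fibre_sum_def[of X \<Phi> f "n + L0"]
    proof (rule weights_sum_split_le[where n = n])
      fix u assume "u \<in> FW (n + L0) y"
      then show "take n u \<in> live_words n y \<and> drop n u \<in> FW L0 ((shift_map ^^ n) y)"
        using live FW_split by blast
    qed (use live_in_words in \<open>auto dest: fibre_wordsD\<close>)
    also have "\<dots> \<le> Q n y * M ^ L0"
      using G_le[of L0 "(shift_map ^^ n) y"] Q_pos[OF y(1), of n] unfolding fibre_sum_def
      by (intro mult_left_mono) auto
    finally show ?thesis by (simp add: mult.commute)
  qed
  then show ?thesis by (rule that)
qed

text \<open>Cutting off the last \<open>L\<close> symbols makes all fibre words live at the cost of a bounded factor, hence live words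
  and all fibre words have the same growth rate.\<close>

lemma rel_pressure_periodic:
  assumes y: "y \<in> Y" "(shift_map ^^ q) y = y" and q: "q \<ge> 1" and h: "continuous_on Y h"
  shows "rel_pressure X \<pi> (\<lambda>x. f x - h (\<pi> x)) y = excess h y"
proof -
  obtain Bh where Bh: "Bh \<ge> 0" "\<And>y n. y \<in> Y \<Longrightarrow> \<bar>birkhoff_sum n h y\<bar> \<le> real n * Bh"
    by (rule h_bound[OF h]) blast
  obtain L where L: "\<And>n. n \<ge> 1 \<Longrightarrow> G (n + L) y \<le> M ^ L * Q n y" by (rule G_le_Q_periodic[OF y q]) blast
  define b where "b n = (ln (Q n y) - birkhoff_sum n h y) / real n" for n
  define a where "a n = (ln (G n y) - birkhoff_sum n h y) / real n" for n
  define E where "E = ln M + Bh"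
  have bE: "\<bar>b n\<bar> \<le> E" if "n \<ge> 1" for n
  proof -
    have "\<bar>ln (Q n y) - birkhoff_sum n h y\<bar> \<le> real n * E"
      using ln_Q_bounds[OF y(1), of n] Bh(2)[OF y(1), of n] by (simp add: E_def algebra_simps)
    then show ?thesis using that by (simp add: b_def abs_divide field_simps)
  qed
  define C where "C = real L * ln M + real L * Bh"
  have "limsup (\<lambda>n. ereal (b n)) \<le> limsup (\<lambda>n. ereal (a n))"
    unfolding a_def b_def using Q_le_G Q_pos[OF y(1)]
    by (intro Limsup_mono always_eventually allI, unfold ereal_less_eq)
      (intro divide_right_mono diff_right_mono ln_mono, auto)
  moreover have "limsup (\<lambda>n. ereal (a n)) \<le> limsup (\<lambda>n. ereal (b n))"
  proof -
    have "limsup (\<lambda>n. ereal (a n)) = limsup (\<lambda>n. ereal (a (n + L)))"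
      using limsup_shift_k[of "\<lambda>n. ereal (a n)" L] by simp
    also have "\<dots> \<le> limsup (\<lambda>n. ereal ((real n * b n + C) / real (n + L)))"
    proof (intro Limsup_mono eventually_sequentiallyI[of 1])
      fix n :: nat assume n: "1 \<le> n"
      have "ln (G (n + L) y) \<le> ln (M ^ L * Q n y)"
        using L[OF n] G_pos[OF y(1), of "n + L"] by simp
      also have "\<dots> = real L * ln M + ln (Q n y)" using M1 Q_pos[OF y(1), of n] by (simp add: ln_mult ln_realpow)
      finally have "ln (G (n + L) y) \<le> real L * ln M + ln (Q n y)" .
      moreover have "birkhoff_sum (n + L) h y \<ge> birkhoff_sum n h y - real L * Bh"
        using Bh(2)[OF Y_funpow[OF y(1), of n], of L] unfolding birkhoff_sum_add by linarith
      moreover have "real n * b n = ln (Q n y) - birkhoff_sum n h y" using n by (simp add: b_def)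
      ultimately have "ln (G (n + L) y) - birkhoff_sum (n + L) h y \<le> real n * b n + C"
        by (simp add: C_def)
      then show "ereal (a (n + L)) \<le> ereal ((real n * b n + C) / real (n + L))"
        unfolding a_def by (simp add: divide_right_mono)
    qed
    also have "\<dots> = limsup (\<lambda>n. ereal (b n))"
    proof (rule limsup_ereal_cong, rule Lim_null_comparison)
      show "(\<lambda>n. (C + real L * E) / (real n + real L)) \<longlonglongrightarrow> 0" by real_asymp
      show "\<forall>\<^sub>F n in sequentially. norm ((real n * b n + C) / real (n + L) - b n) \<le> (C + real L * E) / (real n + real L)"
      proof (intro eventually_sequentiallyI[of 1])
        fix n :: nat assume n: "1 \<le> n"
        have "(real n * b n + C) / real (n + L) - b n = (C - real L * b n) / (real n + real L)"
          using n by (simp add: field_simps)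
        moreover have "\<bar>C - real L * b n\<bar> \<le> C + real L * E"
        proof -
          have "C \<ge> 0" using M1 Bh(1) by (simp add: C_def)
          moreover have "real L * \<bar>b n\<bar> \<le> real L * E" using bE[OF n] by (intro mult_left_mono) auto
          moreover have "\<bar>real L * b n\<bar> = real L * \<bar>b n\<bar>" by (simp add: abs_mult)
          ultimately show ?thesis by linarith
        qed
        ultimately show "norm ((real n * b n + C) / real (n + L) - b n) \<le> (C + real L * E) / (real n + real L)"
          by (simp add: abs_divide divide_right_mono)
      qed
    qed
    finally show ?thesis .
  qed
  ultimately have "limsup (\<lambda>n. ereal (b n)) = excess h y"
    unfolding excess_def a_def by (rule antisym)
  then show ?thesis unfolding rel_pressure_eq[OF y(1)] b_def .
qed

end

section \<open>Invariant measures\<close>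

lemma shift_measurable:
  assumes "subshift X"
  shows "(shift_map ^^ i) \<in> measurable (restrict_space borel X) (restrict_space borel X)"
  by (rule measurable_restrict_space3)
    (auto intro!: borel_measurable_continuous_onI continuous_on_funpow_shift subshift_funpow[OF assms])

text \<open>Averaging over one period turns a \<open>\<sigma>\<^sup>q\<close>-invariant law into a \<open>\<sigma>\<close>-invariant one.\<close>

locale phase_average = prob_space \<Omega> for \<Omega> :: "'w measure" +
  fixes X :: "seq set" and T :: "'w \<Rightarrow> 'w" and c :: "'w \<Rightarrow> seq" and q :: nat
  assumes subshift: "subshift X" and q1: "q \<ge> 1"
    and T [measurable]: "T \<in> measurable \<Omega> \<Omega>" and distr_T: "distr \<Omega> \<Omega> T = \<Omega>"
    and c [measurable]: "c \<in> measurable \<Omega> (restrict_space borel X)"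
    and equivariant: "\<And>\<omega>. \<omega> \<in> space \<Omega> \<Longrightarrow> c (T \<omega>) = (shift_map ^^ q) (c \<omega>)"
begin

definition base :: "(nat \<times> 'w) measure" where
  "base = uniform_count_measure {..<q} \<Otimes>\<^sub>M \<Omega>"

definition point :: "nat \<times> 'w \<Rightarrow> seq" where
  "point = (\<lambda>(i, \<omega>). (shift_map ^^ i) (c \<omega>))"

definition average :: "seq measure" where
  "average = distr base (restrict_space borel X) point"

lemma prob_phases: "prob_space (uniform_count_measure {..<q})"
  using q1 by (intro prob_space_uniform_count_measure) (auto simp: lessThan_empty_iff)

lemma pair: "pair_prob_space (uniform_count_measure {..<q}) \<Omega>"
  using prob_phases prob_space_axioms
  by (simp add: pair_prob_space_def pair_sigma_finite_def prob_space_imp_sigma_finite)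

lemma prob_base: "prob_space base"
  unfolding base_def by (rule prob_space_pair[OF prob_phases prob_space_axioms])

lemma space_base: "space base = {..<q} \<times> space \<Omega>"
  by (simp add: base_def space_pair_measure space_uniform_count_measure)

lemma c_in: "\<omega> \<in> space \<Omega> \<Longrightarrow> c \<omega> \<in> X"
  using measurable_space[OF c] by (simp add: space_restrict_space)

lemma measurable_from_base:
  assumes "\<And>i. i < q \<Longrightarrow> (\<lambda>\<omega>. g (i, \<omega>)) \<in> measurable \<Omega> N"
  shows "g \<in> measurable base N"
proof -
  have "g \<in> measurable (count_space {..<q} \<Otimes>\<^sub>M \<Omega>) N"
    using assms by (intro measurable_pair_measure_countable1) auto
  moreover have "sets base = sets (count_space {..<q} \<Otimes>\<^sub>M \<Omega>)"
    unfolding base_def by (intro sets_pair_measure_cong) (auto simp: sets_uniform_count_measure)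
  ultimately show ?thesis by (simp cong: measurable_cong_sets)
qed

lemma point_measurable [measurable]: "point \<in> measurable base (restrict_space borel X)"
  unfolding point_def
  by (rule measurable_from_base)
    (simp, rule measurable_compose[OF c shift_measurable[OF subshift]])

lemma prob_average: "prob_space average"
  unfolding average_def by (rule prob_space.prob_space_distr[OF prob_base point_measurable])

lemma sets_average [simp]: "sets average = sets (restrict_space borel X)"
  by (simp add: average_def)

lemma space_average [simp]: "space average = X"
  by (simp add: average_def space_restrict_space)

lemma integral_base:
  fixes g :: "nat \<times> 'w \<Rightarrow> real"
  assumes "g \<in> borel_measurable base" "\<And>p. p \<in> space base \<Longrightarrow> \<bar>g p\<bar> \<le> B"
  shows "integral\<^sup>L base g = (\<Sum>i<q. integral\<^sup>L \<Omega> (\<lambda>\<omega>. g (i, \<omega>))) / real q"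
proof -
  interpret P: pair_prob_space "uniform_count_measure {..<q}" \<Omega> by (rule pair)
  have "integrable base g"
    using assms by (intro finite_measure.integrable_const_bound[OF prob_space.finite_measure[OF prob_base], of _ B]) auto
  then have "integral\<^sup>L base g = (\<integral>i. (\<integral>\<omega>. g (i, \<omega>) \<partial>\<Omega>) \<partial>uniform_count_measure {..<q})"
    unfolding base_def by (rule P.integral_fst'[symmetric])
  also have "\<dots> = (\<Sum>i<q. integral\<^sup>L \<Omega> (\<lambda>\<omega>. g (i, \<omega>))) / real q"
    by (simp add: uniform_count_measure_def lebesgue_integral_point_measure_finite sum_divide_distrib)
  finally show ?thesis .
qed

lemma integral_average:
  fixes F :: "seq \<Rightarrow> real"
  assumes F: "F \<in> borel_measurable (restrict_space borel X)" "\<And>x. x \<in> X \<Longrightarrow> \<bar>F x\<bar> \<le> B"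
  shows "integral\<^sup>L average F = integral\<^sup>L \<Omega> (\<lambda>\<omega>. birkhoff_sum q F (c \<omega>)) / real q"
proof -
  have in_X: "(shift_map ^^ i) (c \<omega>) \<in> X" if "\<omega> \<in> space \<Omega>" for i \<omega>
    by (rule subshift_funpow[OF subshift c_in[OF that]])
  have int: "integrable \<Omega> (\<lambda>\<omega>. F ((shift_map ^^ i) (c \<omega>)))" for i
  proof (rule integrable_const_bound[of _ B])
    show "(\<lambda>\<omega>. F ((shift_map ^^ i) (c \<omega>))) \<in> borel_measurable \<Omega>"
      by (rule measurable_compose[OF measurable_compose[OF c shift_measurable[OF subshift]] F(1)])
  qed (use F(2) in_X in auto)
  have "integral\<^sup>L average F = integral\<^sup>L base (\<lambda>p. F (point p))"
    unfolding average_def by (rule integral_distr[OF point_measurable F(1)])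
  also have "\<dots> = (\<Sum>i<q. integral\<^sup>L \<Omega> (\<lambda>\<omega>. F (point (i, \<omega>)))) / real q"
    using F(2) in_X
    by (intro integral_base measurable_compose[OF point_measurable F(1)]) (auto simp: space_base point_def)
  also have "(\<Sum>i<q. integral\<^sup>L \<Omega> (\<lambda>\<omega>. F (point (i, \<omega>)))) = integral\<^sup>L \<Omega> (\<lambda>\<omega>. \<Sum>i<q. F (point (i, \<omega>)))"
    using int by (simp add: point_def)
  finally show ?thesis by (simp add: point_def birkhoff_sum_def)
qed

lemma average_invariant: "average \<in> invariant_measures X"
proof -
  let ?R = "restrict_space borel X"
  have s: "shift_map \<in> measurable ?R ?R" using shift_measurable[OF subshift, of 1] by simp
  then have s': "shift_map \<in> measurable average average" by (simp cong: measurable_cong_sets)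
  have "distr average average shift_map = average"
  proof (rule measure_eqI)
    show "sets (distr average average shift_map) = sets average" by simp
    fix A assume "A \<in> sets (distr average average shift_map)"
    then have A: "A \<in> sets ?R" by simp
    interpret av: prob_space average by (rule prob_average)
    have m: "measure average B = integral\<^sup>L average (indicator B)" if "B \<in> sets ?R" for B
      using sets.sets_into_space[OF that] by (simp add: space_restrict_space Int_absorb2)
    have A': "shift_map -` A \<inter> X \<in> sets ?R"
      using measurable_sets[OF s A] by (simp add: space_restrict_space)
    let ?a = "\<lambda>i. integral\<^sup>L \<Omega> (\<lambda>\<omega>. indicator A ((shift_map ^^ i) (c \<omega>)) :: real)"
    have int: "integrable \<Omega> (\<lambda>\<omega>. indicator B ((shift_map ^^ i) (c \<omega>)) :: real)" if B: "B \<in> sets ?R" for B i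
    proof (rule integrable_const_bound[of _ 1])
      show "(\<lambda>\<omega>. indicator B ((shift_map ^^ i) (c \<omega>)) :: real) \<in> borel_measurable \<Omega>"
        by (rule measurable_compose[OF measurable_compose[OF c shift_measurable[OF subshift]] borel_measurable_indicator[OF B]])
    qed auto
    have avg: "measure average B = (\<Sum>i<q. integral\<^sup>L \<Omega> (\<lambda>\<omega>. indicator B ((shift_map ^^ i) (c \<omega>)))) / real q"
      if B: "B \<in> sets ?R" for B
    proof -
      have "measure average B = integral\<^sup>L \<Omega> (\<lambda>\<omega>. birkhoff_sum q (indicator B) (c \<omega>)) / real q"
        unfolding m[OF B] by (rule integral_average[of _ 1]) (auto intro: borel_measurable_indicator[OF B])
      then show ?thesis using int[OF B] by (simp add: birkhoff_sum_def)
    qed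
    have "measure (distr average average shift_map) A = measure average (shift_map -` A \<inter> X)"
      using s' A by (subst measure_distr) auto
    also have "\<dots> = (\<Sum>i<q. ?a (Suc i)) / real q"
    proof -
      have "integral\<^sup>L \<Omega> (\<lambda>\<omega>. indicator (shift_map -` A \<inter> X) ((shift_map ^^ i) (c \<omega>)) :: real) = ?a (Suc i)" for i
      proof (rule Bochner_Integration.integral_cong[OF refl])
        fix \<omega> assume "\<omega> \<in> space \<Omega>"
        then have "(shift_map ^^ i) (c \<omega>) \<in> X" using subshift_funpow[OF subshift c_in] by blast
        then show "indicator (shift_map -` A \<inter> X) ((shift_map ^^ i) (c \<omega>)) = (indicator A ((shift_map ^^ Suc i) (c \<omega>)) :: real)"
          by (simp add: indicator_def)
      qed
      then show ?thesis by (simp add: avg[OF A'])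
    qed
    also have "(\<Sum>i<q. ?a (Suc i)) = (\<Sum>i<q. ?a i)"
    proof -
      have "?a q = ?a 0"
      proof -
        have "?a q = integral\<^sup>L \<Omega> (\<lambda>\<omega>. indicator A (c (T \<omega>)))"
          using equivariant by (intro Bochner_Integration.integral_cong) auto
        also have "\<dots> = integral\<^sup>L (distr \<Omega> \<Omega> T) (\<lambda>\<omega>. indicator A (c \<omega>))"
          by (rule integral_distr[symmetric, OF T measurable_compose[OF c borel_measurable_indicator[OF A]]])
        finally show ?thesis by (simp add: distr_T)
      qed
      moreover have "(\<Sum>i<Suc q. ?a i) = ?a 0 + (\<Sum>i<q. ?a (Suc i))" by (rule sum.lessThan_Suc_shift)
      moreover have "(\<Sum>i<Suc q. ?a i) = (\<Sum>i<q. ?a i) + ?a q" by (rule sum.lessThan_Suc)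
      ultimately show ?thesis by linarith
    qed
    also have "\<dots> / real q = measure average A" by (rule avg[OF A, symmetric])
    finally have "measure (distr average average shift_map) A = measure average A" .
    moreover interpret d: prob_space "distr average average shift_map" by (rule av.prob_space_distr[OF s'])
    show "emeasure (distr average average shift_map) A = emeasure average A"
      using calculation by (simp add: d.emeasure_eq_measure av.emeasure_eq_measure)
  qed
  then show ?thesis using s' prob_average by (simp add: invariant_measures_def)
qed

end

text \<open>The uniform measure on a periodic orbit is the phase average over a one-point probability space.\<close>

lemma periodic_orbit_measure:
  assumes Y: "subshift Y" and y: "y \<in> Y" "(shift_map ^^ q) y = y" and q: "q \<ge> 1"
  obtains \<nu> where "\<nu> \<in> invariant_measures Y"
    "\<And>(F :: seq \<Rightarrow> real) B. F \<in> borel_measurable (restrict_space borel Y) \<Longrightarrow> (\<And>x. x \<in> Y \<Longrightarrow> \<bar>F x\<bar> \<le> B) \<Longrightarrow>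
      integral\<^sup>L \<nu> F = birkhoff_sum q F y / real q"
proof -
  let ?\<Omega> = "return (count_space UNIV) ()"
  interpret prob_space ?\<Omega> by (rule prob_space_return) simp
  interpret phase_average ?\<Omega> Y "\<lambda>x. x" "\<lambda>_. y" q
  proof
    show "(\<lambda>_. y) \<in> measurable ?\<Omega> (restrict_space borel Y)"
      using y by (intro measurable_const) (simp add: space_restrict_space)
    show "distr ?\<Omega> ?\<Omega> (\<lambda>x. x) = ?\<Omega>" by (rule distr_id)
  qed (use Y q y in auto)
  show ?thesis
  proof (rule that[OF average_invariant])
    fix F :: "seq \<Rightarrow> real" and B assume "F \<in> borel_measurable (restrict_space borel Y)" "\<And>x. x \<in> Y \<Longrightarrow> \<bar>F x\<bar> \<le> B"
    then show "integral\<^sup>L average F = birkhoff_sum q F y / real q"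
      by (subst integral_average[of F B]) (auto simp: prob_space[simplified])
  qed
qed

section \<open>Integrals of the relative pressure\<close>

context factor_system
begin

lemma compact_seq_imp_closed:
  fixes S :: "seq set" assumes "compact S" shows "closed S"
proof -
  have "Hausdorff_space (euclidean :: nat topology)"
    unfolding Hausdorff_space_def
  proof (intro allI impI)
    fix a b :: nat assume "a \<in> topspace euclidean \<and> b \<in> topspace euclidean \<and> a \<noteq> b"
    then show "\<exists>U V. openin euclidean U \<and> openin euclidean V \<and> a \<in> U \<and> b \<in> V \<and> disjnt U V"
      by (intro exI[of _ "{a}"] exI[of _ "{b}"]) (simp add: Topological_Spaces.open_discrete)
  qed
  then have "Hausdorff_space (product_topology (\<lambda>i::nat. euclidean :: nat topology) UNIV)"
    by (simp add: Hausdorff_space_product_topology)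
  then have "Hausdorff_space (euclidean :: seq topology)" by (simp only: euclidean_product_topology)
  then show ?thesis using assms compactin_imp_closedin[of "euclidean :: seq topology" S] by simp
qed

text \<open>The Bochner integral of a function that is not measurable is \<open>0\<close> by convention, so the integral
  of the relative pressure can be evaluated only after its measurability is known. It is an upper limit
  of functions built from indicators of images of cylinders; these images are compact, hence closed.\<close>

lemma closed_image_cylinder: "closed (\<pi> ` cylinder X u)"
proof -
  have eq: "cylinder X u = X \<inter> (\<Inter>i\<in>{..<length u}. {x. x i = u ! i})"
    by (auto simp: in_cylinder_iff)
  have "compact (cylinder X u)"
    unfolding eq by (intro compact_Int_closed compact_subshift[OF subshift_X] closed_INT ballI closed_coords)
  moreover have "continuous_on (cylinder X u) \<pi>"
    using fac continuous_on_subset[of X \<pi> "cylinder X u"] by (auto simp: factor_map_def cylinder_def)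
  ultimately show ?thesis by (intro compact_seq_imp_closed compact_continuous_image)
qed

lemma live_words_eq: "live_words n y = {u \<in> words_of_length X n. y \<in> \<pi> ` cylinder X u}"
proof (intro equalityI subsetI)
  fix u assume "u \<in> live_words n y"
  then obtain x where x: "x \<in> X" "\<pi> x = y" "u = word_at x 0 n" by (auto simp: live_words_def)
  then have "u \<in> words_of_length X n" by (simp add: X_words_eq)
  moreover have "x \<in> cylinder X u" using x by (simp add: in_cylinder_word_at)
  ultimately show "u \<in> {u \<in> words_of_length X n. y \<in> \<pi> ` cylinder X u}" using x(2) by auto
next
  fix u assume "u \<in> {u \<in> words_of_length X n. y \<in> \<pi> ` cylinder X u}"
  then obtain x where "x \<in> cylinder X u" "y = \<pi> x" "length u = n" by (auto dest: length_words_of_length)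
  then show "u \<in> live_words n y" unfolding live_words_def cylinder_def by force
qed

lemma Q_measurable: "Q n \<in> borel_measurable borel"
proof -
  have "Q n y = (\<Sum>u\<in>words_of_length X n. indicator (\<pi> ` cylinder X u) y * W u)" for y
    unfolding live_words_eq sum.inter_filter[OF finite_words_of_length(1)[OF subshift_X]]
    by (auto intro!: sum.cong simp: indicator_def)
  then have "Q n = (\<lambda>y. \<Sum>u\<in>words_of_length X n. indicator (\<pi> ` cylinder X u) y * W u)" by auto
  also have "\<dots> \<in> borel_measurable borel"
    using closed_image_cylinder by (intro borel_measurable_sum borel_measurable_times borel_measurable_indicator) auto
  finally show ?thesis .
qed

lemma rel_pressure_f:
  assumes "y \<in> Y" shows "rel_pressure X \<pi> f y = limsup (\<lambda>n. ereal (ln (Q n y) / real n))"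
  using rel_pressure_eq[OF assms, of "\<lambda>_. 0"] by (simp add: birkhoff_sum_def)

lemma rel_pressure_measurable:
  "(\<lambda>y. real_of_ereal (rel_pressure X \<pi> f y)) \<in> borel_measurable (restrict_space borel Y)"
proof -
  have "(\<lambda>y. real_of_ereal (limsup (\<lambda>n. ereal (ln (Q n y) / real n)))) \<in> borel_measurable borel"
    using Q_measurable by measurable
  then have "(\<lambda>y. real_of_ereal (limsup (\<lambda>n. ereal (ln (Q n y) / real n)))) \<in> borel_measurable (restrict_space borel Y)"
    by (rule measurable_restrict_space1)
  then show ?thesis
    by (rule measurable_cong[THEN iffD1, rotated]) (simp add: space_restrict_space rel_pressure_f)
qed

lemma rel_pressure_bounds:
  assumes "y \<in> Y" shows "\<bar>rel_pressure X \<pi> f y\<bar> \<le> ereal (ln M)"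
proof -
  have b: "ln (Q n y) / real n \<le> ln M" "- ln M \<le> ln (Q n y) / real n" if "n \<ge> 1" for n
    using ln_Q_bounds[OF assms, of n] that by (auto simp: field_simps abs_le_iff)
  have "limsup (\<lambda>n. ereal (ln (Q n y) / real n)) \<le> ereal (ln M)"
  proof (rule Limsup_bounded, rule eventually_sequentiallyI[of 1])
    fix n :: nat assume "1 \<le> n" from b(1)[OF this] show "ereal (ln (Q n y) / real n) \<le> ereal (ln M)" by simp
  qed
  moreover have "ereal (- ln M) \<le> limsup (\<lambda>n. ereal (ln (Q n y) / real n))"
  proof (rule le_Limsup, simp, rule eventually_sequentiallyI[of 1])
    fix n :: nat assume "1 \<le> n" from b(2)[OF this] show "ereal (- ln M) \<le> ereal (ln (Q n y) / real n)" by simp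
  qed
  ultimately show ?thesis unfolding rel_pressure_f[OF assms]
    by (cases "limsup (\<lambda>n. ereal (ln (Q n y) / real n))") auto
qed

lemma birkhoff_sum_periodic_bound:
  assumes y: "y \<in> Y" "(shift_map ^^ q) y = y" and q: "q \<ge> 1" and h: "continuous_on Y h"
  obtains C where "\<And>n. \<bar>birkhoff_sum n h y - real n * (birkhoff_sum q h y / real q)\<bar> \<le> C"
proof -
  obtain Bh where Bh: "Bh \<ge> 0" "\<And>y n. y \<in> Y \<Longrightarrow> \<bar>birkhoff_sum n h y\<bar> \<le> real n * Bh"
    by (rule h_bound[OF h]) blast
  have "\<bar>birkhoff_sum n h y - real n * (birkhoff_sum q h y / real q)\<bar> \<le> 2 * (real q * Bh)" for n
  proof -
    let ?j = "n div q" and ?r = "n mod q" and ?s = "birkhoff_sum q h y"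
    have n: "n = ?j * q + ?r" by simp
    have r: "real ?r \<le> real q" using q by (simp add: less_imp_le)
    have "birkhoff_sum n h y = birkhoff_sum (?j * q + ?r) h y" by simp
    also have "\<dots> = real ?j * ?s + birkhoff_sum ?r h y"
      by (simp only: birkhoff_sum_add birkhoff_sum_period[OF y(2)] funpow_mult_fixpoint[OF y(2)])
    finally have 1: "birkhoff_sum n h y = real ?j * ?s + birkhoff_sum ?r h y" .
    have "real n = real ?j * real q + real ?r" by (metis n of_nat_add of_nat_mult)
    then have 2: "real n * (?s / real q) = real ?j * ?s + real ?r * (?s / real q)"
      using q by (simp add: field_simps)
    have 3: "\<bar>birkhoff_sum ?r h y\<bar> \<le> real q * Bh"
      using Bh(2)[OF y(1), of ?r] mult_right_mono[OF r Bh(1)] by linarith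
    have "\<bar>?s / real q\<bar> \<le> Bh" using Bh(2)[OF y(1), of q] q by (simp add: abs_divide field_simps)
    then have "\<bar>real ?r * (?s / real q)\<bar> \<le> real q * Bh"
      using r Bh(1) unfolding abs_mult by (intro mult_mono) auto
    moreover have "\<bar>s - t\<bar> \<le> 2 * c" if "s = u + v" "t = u + w" "\<bar>v\<bar> \<le> c" "\<bar>w\<bar> \<le> c" for s t u v w c :: real
      using that by linarith
    ultimately show ?thesis using 1 2 3 by blast
  qed
  then show ?thesis by (rule that)
qed

lemma excess_periodic:
  assumes y: "y \<in> Y" "(shift_map ^^ q) y = y" and q: "q \<ge> 1" and h: "continuous_on Y h"
  shows "excess h y + ereal (birkhoff_sum q h y / real q) = excess (\<lambda>_. 0) y"
proof -
  obtain C where C: "\<And>n. \<bar>birkhoff_sum n h y - real n * (birkhoff_sum q h y / real q)\<bar> \<le> C"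
    by (rule birkhoff_sum_periodic_bound[OF y q h]) blast
  have lim: "(\<lambda>n. birkhoff_sum n h y / real n) \<longlonglongrightarrow> birkhoff_sum q h y / real q"
  proof (rule LIM_zero_cancel, rule Lim_null_comparison)
    show "(\<lambda>n. C / real n) \<longlonglongrightarrow> 0" by real_asymp
    show "\<forall>\<^sub>F n in sequentially. norm (birkhoff_sum n h y / real n - birkhoff_sum q h y / real q) \<le> C / real n"
    proof (rule eventually_sequentiallyI[of 1])
      fix n :: nat assume n: "1 \<le> n"
      have "birkhoff_sum n h y / real n - birkhoff_sum q h y / real q
        = (birkhoff_sum n h y - real n * (birkhoff_sum q h y / real q)) / real n"
        using n by (simp add: diff_divide_distrib)
      then show "norm (birkhoff_sum n h y / real n - birkhoff_sum q h y / real q) \<le> C / real n"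
        using C[of n] by (simp add: abs_divide divide_right_mono)
    qed
  qed
  have "excess (\<lambda>_. 0) y = limsup (\<lambda>n. ereal (birkhoff_sum n h y / real n) + ereal ((ln (G n y) - birkhoff_sum n h y) / real n))"
    unfolding excess_def by (simp add: birkhoff_sum_def diff_divide_distrib)
  also have "\<dots> = ereal (birkhoff_sum q h y / real q) + excess h y"
    unfolding excess_def using lim by (intro ereal_limsup_lim_add) auto
  finally show ?thesis by (simp add: add.commute)
qed

text \<open>Removing the first symbol of the words costs only a factor \<open>M\<close>.\<close>

lemma excess_shift_le:
  assumes y: "y \<in> Y"
  shows "excess (\<lambda>_. 0) y \<le> excess (\<lambda>_. 0) (shift_map y)"
proof -
  have "excess (\<lambda>_. 0) y = limsup (\<lambda>n. ereal (ln (G n y) / real n))"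
    by (simp add: excess_def birkhoff_sum_def)
  also have "\<dots> = limsup (\<lambda>n. ereal (ln (G (n + 1) y) / real (n + 1)))"
    using limsup_shift_k[of "\<lambda>n. ereal (ln (G n y) / real n)" 1] by simp
  also have "\<dots> \<le> limsup (\<lambda>n. ereal ((ln M + ln (G n (shift_map y))) / real (n + 1)))"
  proof (intro Limsup_mono always_eventually allI)
    fix n
    have s: "shift_map y \<in> Y" using Y_funpow[OF y, of 1] by simp
    have "G (1 + n) y \<le> M ^ 1 * G n ((shift_map ^^ 1) y)" by (rule G_add_const'[OF y])
    then have "ln (G (n + 1) y) \<le> ln (M * G n (shift_map y))"
      using G_pos[OF y, of "n + 1"] by simp
    also have "\<dots> = ln M + ln (G n (shift_map y))" using M1 G_pos[OF s, of n] by (simp add: ln_mult)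
    finally show "ereal (ln (G (n + 1) y) / real (n + 1)) \<le> ereal ((ln M + ln (G n (shift_map y))) / real (n + 1))"
      by (simp add: divide_right_mono del: of_nat_add)
  qed
  also have "\<dots> = limsup (\<lambda>n. ereal (ln (G n (shift_map y)) / real n))"
  proof (rule limsup_ereal_cong, rule Lim_null_comparison)
    show "(\<lambda>n. 2 * ln M / real (n + 1)) \<longlonglongrightarrow> 0" by real_asymp
    show "\<forall>\<^sub>F n in sequentially. norm ((ln M + ln (G n (shift_map y))) / real (n + 1) - ln (G n (shift_map y)) / real n)
        \<le> 2 * ln M / real (n + 1)"
    proof (rule eventually_sequentiallyI[of 1])
      fix n :: nat assume n: "1 \<le> n"
      let ?x = "ln (G n (shift_map y))"
      have "\<bar>?x\<bar> \<le> real n * ln M" using ln_G_bounds[OF Y_funpow[OF y, of 1], of n] by simp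
      then have b: "\<bar>?x / real n\<bar> \<le> ln M" using n by (simp add: abs_divide field_simps)
      have "(ln M + ?x) / real (n + 1) - ?x / real n = (ln M - ?x / real n) / real (n + 1)"
        using n by (simp add: field_simps)
      moreover have "\<bar>ln M - ?x / real n\<bar> \<le> 2 * ln M" using b by linarith
      ultimately show "norm ((ln M + ?x) / real (n + 1) - ?x / real n) \<le> 2 * ln M / real (n + 1)"
        by (simp add: abs_divide divide_right_mono)
    qed
  qed
  also have "\<dots> = excess (\<lambda>_. 0) (shift_map y)" by (simp add: excess_def birkhoff_sum_def)
  finally show ?thesis .
qed

text \<open>Along a periodic orbit the growth rate is nondecreasing and returns to its initial value.\<close>

lemma excess_orbit_constant:
  assumes y: "y \<in> Y" "(shift_map ^^ q) y = y" and i: "i \<le> q"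
  shows "excess (\<lambda>_. 0) ((shift_map ^^ i) y) = excess (\<lambda>_. 0) y"
proof (rule antisym)
  have step: "excess (\<lambda>_. 0) z \<le> excess (\<lambda>_. 0) ((shift_map ^^ j) z)" if "z \<in> Y" for z j
  proof (induction j)
    case (Suc j)
    then show ?case using excess_shift_le[OF Y_funpow[OF that, of j]] by (simp add: order_trans)
  qed simp
  show "excess (\<lambda>_. 0) y \<le> excess (\<lambda>_. 0) ((shift_map ^^ i) y)" by (rule step[OF y(1)])
  have "(shift_map ^^ (q - i)) ((shift_map ^^ i) y) = (shift_map ^^ (q - i + i)) y" by (simp only: funpow_add comp_apply)
  then have "(shift_map ^^ (q - i)) ((shift_map ^^ i) y) = y" using y(2) i by simp
  then show "excess (\<lambda>_. 0) ((shift_map ^^ i) y) \<le> excess (\<lambda>_. 0) y"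
    using step[OF Y_funpow[OF y(1), of i], of "q - i"] by simp
qed

text \<open>For the uniform measure on the orbit of \<open>y\<close> the two integrals are the growth rate of \<open>G\<^sub>n(y)\<close> and the average of \<open>h\<close> over the
  orbit; their difference is the excess.\<close>

lemma excess_zero_if_integrals_agree:
  assumes y: "y \<in> Y" "(shift_map ^^ q) y = y" and q: "q \<ge> 1" and h: "continuous_on Y h"
    and int: "\<And>\<mu>. \<mu> \<in> invariant_measures Y \<Longrightarrow>
      (\<integral>y. real_of_ereal (rel_pressure X \<pi> f y) \<partial>\<mu>) = (\<integral>y. h y \<partial>\<mu>)"
  shows "excess h y = 0"
proof -
  obtain \<nu> where \<nu>: "\<nu> \<in> invariant_measures Y" "\<And>F B. F \<in> borel_measurable (restrict_space borel Y) \<Longrightarrow>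
      (\<And>x. x \<in> Y \<Longrightarrow> \<bar>F x\<bar> \<le> B) \<Longrightarrow> integral\<^sup>L \<nu> F = birkhoff_sum q F y / real q"
    by (rule periodic_orbit_measure[OF subshift_Y y q]) blast
  obtain Bh where Bh: "\<And>x. x \<in> Y \<Longrightarrow> \<bar>h x\<bar> \<le> Bh"
    by (rule continuous_on_subshift_bounded[OF subshift_Y h]) blast
  let ?P = "\<lambda>y. real_of_ereal (rel_pressure X \<pi> f y)"
  have Pb: "\<bar>?P z\<bar> \<le> ln M" if "z \<in> Y" for z
    using rel_pressure_bounds[OF that] by (cases "rel_pressure X \<pi> f z") auto
  have "birkhoff_sum q ?P y / real q = birkhoff_sum q h y / real q"
    using \<nu>(2)[OF rel_pressure_measurable Pb] \<nu>(2)[OF borel_measurable_continuous_on_restrict[OF h] Bh] int[OF \<nu>(1)]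
    by metis
  moreover have "?P ((shift_map ^^ i) y) = real_of_ereal (excess (\<lambda>_. 0) y)" if "i < q" for i
  proof -
    have z: "(shift_map ^^ i) y \<in> Y" by (rule Y_funpow[OF y(1)])
    have "(shift_map ^^ q) ((shift_map ^^ i) y) = (shift_map ^^ i) ((shift_map ^^ q) y)"
      by (metis add.commute comp_apply funpow_add)
    then have "(shift_map ^^ q) ((shift_map ^^ i) y) = (shift_map ^^ i) y" using y(2) by simp
    from rel_pressure_periodic[OF z this q, of "\<lambda>_. 0"] excess_orbit_constant[OF y, of i] that
    show ?thesis by simp
  qed
  then have "birkhoff_sum q ?P y / real q = real_of_ereal (excess (\<lambda>_. 0) y)"
    using q by (simp add: birkhoff_sum_def)
  ultimately have "real_of_ereal (excess (\<lambda>_. 0) y) = birkhoff_sum q h y / real q" by simp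
  moreover have "excess (\<lambda>_. 0) y = rel_pressure X \<pi> f y"
    using rel_pressure_periodic[OF y q, of "\<lambda>_. 0"] by simp
  then have "\<bar>excess (\<lambda>_. 0) y\<bar> \<le> ereal (ln M)" using rel_pressure_bounds[OF y(1)] by simp
  ultimately have "excess (\<lambda>_. 0) y = ereal (birkhoff_sum q h y / real q)"
    by (cases "excess (\<lambda>_. 0) y") auto
  then have "excess h y + ereal (birkhoff_sum q h y / real q) = ereal (birkhoff_sum q h y / real q)"
    using excess_periodic[OF y q h] by simp
  then show ?thesis by (cases "excess h y") (auto simp: zero_ereal_def)
qed

end

section \<open>Shannon entropy of finite-valued random variables\<close>

text \<open>Fekete's lemma. The entropy in \<open>ks_entropy\<close> is defined through \<open>lim\<close>, which is meaningful only
  because of this convergence.\<close>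

lemma subadditive_converges:
  fixes a :: "nat \<Rightarrow> real"
  assumes sub: "\<And>m n. a (m + n) \<le> a m + a n" and nonneg: "\<And>n. 0 \<le> a n"
  obtains L where "(\<lambda>n. a n / real n) \<longlonglongrightarrow> L" "\<And>n. n \<ge> 1 \<Longrightarrow> L \<le> a n / real n"
proof -
  define L where "L = (INF n\<in>{1..}. a n / real n)"
  have bdd: "bdd_below ((\<lambda>n. a n / real n) ` {1..})"
    using nonneg by (intro bdd_belowI2[of _ 0]) auto
  have L: "L \<le> a n / real n" if "n \<ge> 1" for n
    unfolding L_def using that bdd by (intro cINF_lower) auto
  have mult: "a (j * m) \<le> real j * a m + a 0" for j m
  proof (induction j)
    case (Suc j)
    have "a (m + j * m) \<le> a m + a (j * m)" by (rule sub)
    with Suc show ?case by (simp add: algebra_simps)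
  qed (use nonneg in simp)
  have "(\<lambda>n. a n / real n) \<longlonglongrightarrow> L"
  proof (rule LIMSEQ_I)
    fix e :: real assume e: "e > 0"
    obtain m where m: "m \<ge> 1" "a m / real m < L + e / 2"
      using cInf_lessD[of "(\<lambda>n. a n / real n) ` {1..}" "L + e / 2"] e unfolding L_def by auto
    define C where "C = a 0 + (\<Sum>r<m. a r)"
    have C0: "C \<ge> 0" using nonneg by (auto simp: C_def intro!: add_nonneg_nonneg sum_nonneg)
    obtain n0 :: nat where n0: "real n0 > 2 * C / e" using reals_Archimedean2 by blast
    show "\<exists>no. \<forall>n\<ge>no. norm (a n / real n - L) < e"
    proof (intro exI[of _ "Suc n0"] allI impI)
      fix n assume n: "Suc n0 \<le> n"
      have r: "a (n mod m) \<le> (\<Sum>r<m. a r)"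
        using m(1) nonneg by (intro member_le_sum) auto
      have "a n = a (n div m * m + n mod m)" by simp
      also have "\<dots> \<le> a (n div m * m) + a (n mod m)" by (rule sub)
      also have "\<dots> \<le> real (n div m) * a m + C" using mult[of "n div m" m] r by (simp add: C_def)
      also have "real (n div m) * a m \<le> (real n / real m) * a m"
        using nonneg of_nat_div_le_of_nat[of n m, where ?'a = real] by (intro mult_right_mono)
      finally have "a n \<le> real n * (a m / real m) + C" by simp
      also have "\<dots> \<le> real n * (L + e / 2) + C"
        using m(2) by (intro add_right_mono mult_left_mono) auto
      finally have "a n / real n \<le> (real n * (L + e / 2) + C) / real n" by (rule divide_right_mono) simp
      also have "\<dots> = L + e / 2 + C / real n" using n by (simp add: add_divide_distrib)
      also have "C / real n < e / 2"
      proof -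
        have "2 * C / e < real n" using n n0 by linarith
        then show ?thesis using e n by (simp add: field_simps)
      qed
      finally have "a n / real n < L + e" by simp
      moreover have "L \<le> a n / real n" using n by (intro L) simp
      ultimately show "norm (a n / real n - L) < e" by simp
    qed
  qed
  then show ?thesis using L by (rule that)
qed

lemma mult_ln_ratio_le:
  fixes p r :: real assumes "p \<ge> 0" "r \<ge> 0" "p > 0 \<Longrightarrow> r > 0"
  shows "p * (ln r - ln p) \<le> r - p"
proof (cases "p = 0")
  case False
  then have p: "p > 0" "r > 0" using assms by auto
  have "ln r - ln p = ln (r / p)" using p by (simp add: ln_div)
  also have "\<dots> \<le> r / p - 1" using p by (intro ln_le_minus_one) simp
  finally have "p * (ln r - ln p) \<le> p * (r / p - 1)" using p by (intro mult_left_mono) auto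
  then show ?thesis using p by (simp add: algebra_simps)
qed (use assms in simp)

text \<open>Continuity of \<open>t ln t\<close> on the closed half-line; the point \<open>0\<close> needs the one-sided limit.\<close>

lemma tendsto_mult_ln:
  fixes x :: "nat \<Rightarrow> real"
  assumes x: "x \<longlonglongrightarrow> l" and nonneg: "\<And>n. x n \<ge> 0"
  shows "(\<lambda>n. x n * ln (x n)) \<longlonglongrightarrow> l * ln l"
proof (cases "l = 0")
  case False
  then have "l > 0" using LIMSEQ_le_const[OF x, of 0] nonneg by fastforce
  then show ?thesis using x by (intro tendsto_mult tendsto_ln) auto
next
  case True
  have "((\<lambda>t::real. t * ln t) \<longlongrightarrow> 0) (at_right 0)" by real_asymp
  then have c: "((\<lambda>t::real. t * ln t) \<longlongrightarrow> 0 * ln 0) (at 0 within {0..})"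
    by (simp add: at_within_Ici_at_right)
  then have "continuous (at 0 within {0..}) (\<lambda>t::real. t * ln t)" by (simp add: continuous_within)
  from continuous_within_tendsto_compose[OF this, of x sequentially] x nonneg True
  show ?thesis by simp
qed

context prob_space
begin

definition pr :: "('a \<Rightarrow> 'l) \<Rightarrow> 'l \<Rightarrow> real" where
  "pr X a = prob {\<omega> \<in> space M. X \<omega> = a}"

text \<open>Finite partitions are represented by functions with finitely many values. Labels of arbitrary type
  allow joins to be written as pairs and lists, and refinement as composition with a function.\<close>

definition ent :: "('a \<Rightarrow> 'l) \<Rightarrow> real" where
  "ent X = - (\<Sum>a\<in>X ` space M. pr X a * ln (pr X a))"

lemma pr_nonneg: "pr X a \<ge> 0" by (simp add: pr_def)

lemma pr_le_1: "pr X a \<le> 1" by (simp add: pr_def)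

lemma simple_finite: "simple_function M X \<Longrightarrow> finite (X ` space M)"
  by (rule simple_functionD)

lemma simple_sets: "simple_function M X \<Longrightarrow> {\<omega> \<in> space M. P (X \<omega>)} \<in> sets M"
proof -
  assume "simple_function M X"
  from simple_functionD(2)[OF this, of "Collect P"]
  show ?thesis by (simp add: vimage_def Int_def conj_commute)
qed

lemma pr_eq_0: "a \<notin> X ` space M \<Longrightarrow> pr X a = 0"
proof -
  assume "a \<notin> X ` space M"
  then have "{\<omega> \<in> space M. X \<omega> = a} = {}" by auto
  then show ?thesis unfolding pr_def by (simp only: measure_empty)
qed

lemma prob_label_event:
  assumes V: "simple_function M V"
  shows "prob {\<omega> \<in> space M. P (V \<omega>)} = (\<Sum>v\<in>{v \<in> V ` space M. P v}. pr V v)"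
proof -
  have "{\<omega> \<in> space M. P (V \<omega>)} = (\<Union>v\<in>{v \<in> V ` space M. P v}. {\<omega> \<in> space M. V \<omega> = v})" by auto
  also have "prob \<dots> = (\<Sum>v\<in>{v \<in> V ` space M. P v}. prob {\<omega> \<in> space M. V \<omega> = v})"
    using simple_finite[OF V] simple_sets[OF V]
    by (intro finite_measure_finite_Union) (auto simp: disjoint_family_on_def)
  finally show ?thesis by (simp add: pr_def)
qed

lemma sum_pr: "simple_function M V \<Longrightarrow> (\<Sum>v\<in>V ` space M. pr V v) = 1"
  using prob_label_event[of V "\<lambda>_. True"] by (simp add: prob_space)

lemma pr_marginal:
  assumes V: "simple_function M V" and Y: "\<And>\<omega>. \<omega> \<in> space M \<Longrightarrow> Y \<omega> = g (V \<omega>)"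
  shows "pr Y a = (\<Sum>v\<in>{v \<in> V ` space M. g v = a}. pr V v)"
proof -
  have "{\<omega> \<in> space M. Y \<omega> = a} = {\<omega> \<in> space M. g (V \<omega>) = a}" using Y by auto
  then show ?thesis using prob_label_event[OF V, of "\<lambda>v. g v = a"] by (simp add: pr_def)
qed

lemma pr_le_marginal:
  assumes V: "simple_function M V" and Y: "\<And>\<omega>. \<omega> \<in> space M \<Longrightarrow> Y \<omega> = g (V \<omega>)" and v: "v \<in> V ` space M"
  shows "pr V v \<le> pr Y (g v)"
proof -
  have "pr Y (g v) = (\<Sum>w\<in>{w \<in> V ` space M. g w = g v}. pr V w)"
    by (rule pr_marginal[OF V]) (rule Y)
  also have "\<dots> \<ge> pr V v"
    using v simple_finite[OF V] by (intro member_le_sum pr_nonneg) auto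
  finally show ?thesis .
qed

lemma ent_superset:
  assumes "finite S" "X ` space M \<subseteq> S"
  shows "ent X = - (\<Sum>a\<in>S. pr X a * ln (pr X a))"
  unfolding ent_def using assms by (intro arg_cong[of _ _ uminus] sum.mono_neutral_left) (auto simp: pr_eq_0)

text \<open>Entropies of several functions of one \<open>V\<close> become averages over the same distribution and can be compared
  term by term.\<close>

lemma ent_factor:
  assumes V: "simple_function M V" and Y: "\<And>\<omega>. \<omega> \<in> space M \<Longrightarrow> Y \<omega> = g (V \<omega>)"
  shows "ent Y = - (\<Sum>v\<in>V ` space M. pr V v * ln (pr Y (g v)))"
proof -
  have im: "Y ` space M = g ` V ` space M" using Y by (auto simp: image_iff)
  have "(\<Sum>v\<in>V ` space M. pr V v * ln (pr Y (g v)))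
    = (\<Sum>a\<in>Y ` space M. \<Sum>v\<in>{v \<in> V ` space M. g v = a}. pr V v * ln (pr Y (g v)))"
    using simple_finite[OF V] by (intro sum.group[symmetric]) (auto simp: im)
  also have "\<dots> = (\<Sum>a\<in>Y ` space M. pr Y a * ln (pr Y a))"
  proof (rule sum.cong[OF refl])
    fix a
    have "(\<Sum>v\<in>{v \<in> V ` space M. g v = a}. pr V v * ln (pr Y (g v)))
      = (\<Sum>v\<in>{v \<in> V ` space M. g v = a}. pr V v) * ln (pr Y a)"
      by (simp add: sum_distrib_right)
    then show "(\<Sum>v\<in>{v \<in> V ` space M. g v = a}. pr V v * ln (pr Y (g v))) = pr Y a * ln (pr Y a)"
      using pr_marginal[where V = V and Y = Y and g = g and a = a, OF V Y] by simp
  qed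
  finally show ?thesis by (simp add: ent_def)
qed

text \<open>Passing to a function of \<open>V\<close> merges values and so increases their probabilities.\<close>

lemma ent_mono:
  assumes V: "simple_function M V" and Y: "\<And>\<omega>. \<omega> \<in> space M \<Longrightarrow> Y \<omega> = g (V \<omega>)"
  shows "ent Y \<le> ent V"
proof -
  have "(\<Sum>v\<in>V ` space M. pr V v * ln (pr V v)) \<le> (\<Sum>v\<in>V ` space M. pr V v * ln (pr Y (g v)))"
  proof (rule sum_mono)
    fix v assume v: "v \<in> V ` space M"
    show "pr V v * ln (pr V v) \<le> pr V v * ln (pr Y (g v))"
    proof (cases "pr V v = 0")
      case False
      then have "pr V v > 0" using pr_nonneg[of V v] by linarith
      then show ?thesis using pr_le_marginal[where V = V and Y = Y and g = g, OF V Y v] by (intro mult_left_mono ln_mono) auto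
    qed simp
  qed
  moreover have "ent Y = - (\<Sum>v\<in>V ` space M. pr V v * ln (pr Y (g v)))"
    by (rule ent_factor[OF V]) (rule Y)
  ultimately show ?thesis by (simp add: ent_def[of V])
qed

lemma ent_nonneg: "ent X \<ge> 0"
proof -
  have "pr X a * ln (pr X a) \<le> 0" for a
    using pr_nonneg[of X a] pr_le_1[of X a]
    by (cases "pr X a = 0") (auto intro!: mult_nonneg_nonpos)
  then have "(\<Sum>a\<in>X ` space M. pr X a * ln (pr X a)) \<le> 0" by (intro sum_nonpos) auto
  then show ?thesis by (simp add: ent_def)
qed

text \<open>Gibbs' inequality: entropy plus energy is largest for probabilities proportional to
  \<open>exp (s a)\<close>, where it equals the logarithm of the partition sum.\<close>

lemma gibbs_inequality:
  assumes X: "simple_function M X" and S: "finite S" "S \<noteq> {}" "X ` space M \<subseteq> S"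
  shows "ent X + (\<Sum>a\<in>S. pr X a * s a) \<le> ln (\<Sum>a\<in>S. exp (s a))"
proof -
  let ?Z = "\<Sum>a\<in>S. exp (s a)"
  have Z: "?Z > 0" using S by (intro sum_pos) auto
  have one: "(\<Sum>a\<in>S. pr X a) = 1"
    using sum_pr[OF X] sum.mono_neutral_left[OF S(1,3), of "pr X"] by (auto simp: pr_eq_0)
  have "ent X + (\<Sum>a\<in>S. pr X a * s a) - ln ?Z = (\<Sum>a\<in>S. pr X a * s a) - (\<Sum>a\<in>S. pr X a * ln (pr X a)) - (\<Sum>a\<in>S. pr X a) * ln ?Z"
    using ent_superset[OF S(1,3)] one by simp
  also have "\<dots> = (\<Sum>a\<in>S. pr X a * (ln (exp (s a) / ?Z) - ln (pr X a)))"
    unfolding sum_distrib_right sum_subtractf[symmetric]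
    using Z by (intro sum.cong refl) (simp add: ln_div algebra_simps)
  also have "\<dots> \<le> (\<Sum>a\<in>S. exp (s a) / ?Z - pr X a)"
    using Z pr_nonneg by (intro sum_mono mult_ln_ratio_le) auto
  also have "\<dots> = 0" using one Z by (simp add: sum_subtractf sum_divide_distrib[symmetric])
  finally show ?thesis by simp
qed

lemma ent_le_ln_card:
  assumes X: "simple_function M X" and S: "finite S" "X ` space M \<subseteq> S"
  shows "ent X \<le> ln (real (card S))"
proof -
  have "S \<noteq> {}" using S not_empty by auto
  from gibbs_inequality[OF X S(1) this S(2), of "\<lambda>_. 0"] show ?thesis by simp
qed

text \<open>Strong subadditivity. The difference of the two sides is the average of \<open>ln (r / p)\<close>, where \<open>p\<close> is the
  joint distribution and \<open>r\<close> makes \<open>A\<close> and \<open>B\<close> conditionally independent given \<open>C\<close>; since \<open>r\<close> has total mass at most \<open>1\<close>,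
  \<open>ln t \<le> t - 1\<close> applies.\<close>

lemma ent_strong_subadditive:
  assumes A: "simple_function M A" and B: "simple_function M B" and C: "simple_function M C"
  shows "ent (\<lambda>\<omega>. (A \<omega>, B \<omega>, C \<omega>)) + ent C \<le> ent (\<lambda>\<omega>. (A \<omega>, C \<omega>)) + ent (\<lambda>\<omega>. (B \<omega>, C \<omega>))"
proof -
  let ?V = "\<lambda>\<omega>. (A \<omega>, B \<omega>, C \<omega>)" and ?AC = "\<lambda>\<omega>. (A \<omega>, C \<omega>)" and ?BC = "\<lambda>\<omega>. (B \<omega>, C \<omega>)"
  have V: "simple_function M ?V" and AC: "simple_function M ?AC" and BC: "simple_function M ?BC"
    using A B C by (auto intro!: simple_function_Pair)
  let ?S = "?V ` space M"
  let ?SA = "A ` space M" and ?SB = "B ` space M" and ?SC = "C ` space M"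
  define r where "r = (\<lambda>(a, b, c). pr ?AC (a, c) * pr ?BC (b, c) / pr C c)"
  have eAC: "ent ?AC = - (\<Sum>v\<in>?S. pr ?V v * ln (pr ?AC (case v of (a, b, c) \<Rightarrow> (a, c))))"
    by (rule ent_factor[OF V]) auto
  have eBC: "ent ?BC = - (\<Sum>v\<in>?S. pr ?V v * ln (pr ?BC (case v of (a, b, c) \<Rightarrow> (b, c))))"
    by (rule ent_factor[OF V]) auto
  have eC: "ent C = - (\<Sum>v\<in>?S. pr ?V v * ln (pr C (case v of (a, b, c) \<Rightarrow> c)))"
    by (rule ent_factor[OF V]) auto
  have "ent ?V + ent C - ent ?AC - ent ?BC
    = (\<Sum>v\<in>?S. pr ?V v * (ln (pr ?AC (case v of (a, b, c) \<Rightarrow> (a, c))) + ln (pr ?BC (case v of (a, b, c) \<Rightarrow> (b, c)))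
        - ln (pr C (case v of (a, b, c) \<Rightarrow> c)) - ln (pr ?V v)))"
    unfolding eAC eBC eC ent_def[of ?V] right_diff_distrib distrib_left sum.distrib sum_subtractf by simp
  also have "\<dots> \<le> (\<Sum>v\<in>?S. r v - pr ?V v)"
  proof (rule sum_mono)
    fix v assume v: "v \<in> ?S"
    obtain a b c where abc: "v = (a, b, c)" by (cases v)
    have le: "pr ?V v \<le> pr ?AC (a, c)" "pr ?V v \<le> pr ?BC (b, c)" "pr ?V v \<le> pr C c"
      using pr_le_marginal[OF V _ v, of ?AC "\<lambda>(a, b, c). (a, c)"] pr_le_marginal[OF V _ v, of ?BC "\<lambda>(a, b, c). (b, c)"]
        pr_le_marginal[OF V _ v, of C "\<lambda>(a, b, c). c"] abc by auto
    show "pr ?V v * (ln (pr ?AC (case v of (a, b, c) \<Rightarrow> (a, c))) + ln (pr ?BC (case v of (a, b, c) \<Rightarrow> (b, c)))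
        - ln (pr C (case v of (a, b, c) \<Rightarrow> c)) - ln (pr ?V v)) \<le> r v - pr ?V v"
    proof (cases "pr ?V v = 0")
      case True
      moreover have "0 \<le> r v"
        unfolding r_def abc by (auto intro!: divide_nonneg_nonneg mult_nonneg_nonneg pr_nonneg)
      ultimately show ?thesis by simp
    next
      case False
      then have p: "pr ?V v > 0" using pr_nonneg[of ?V v] by linarith
      then have q: "pr ?AC (a, c) > 0" "pr ?BC (b, c) > 0" "pr C c > 0" using le by auto
      have "ln (r v) = ln (pr ?AC (a, c)) + ln (pr ?BC (b, c)) - ln (pr C c)"
        using q by (simp add: r_def abc ln_div ln_mult)
      moreover have "r v > 0" using q by (simp add: r_def abc)
      ultimately show ?thesis using mult_ln_ratio_le[of "pr ?V v" "r v"] p by (simp add: abc)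
    qed
  qed
  also have "\<dots> = (\<Sum>v\<in>?S. r v) - 1" using sum_pr[OF V] by (simp add: sum_subtractf)
  also have "(\<Sum>v\<in>?S. r v) \<le> (\<Sum>v\<in>?SA \<times> ?SB \<times> ?SC. r v)"
    using simple_finite[OF A] simple_finite[OF B] simple_finite[OF C]
    by (intro sum_mono2) (auto simp: r_def intro!: divide_nonneg_nonneg mult_nonneg_nonneg pr_nonneg)
  also have "\<dots> = (\<Sum>a\<in>?SA. \<Sum>b\<in>?SB. \<Sum>c\<in>?SC. r (a, b, c))"
    by (simp add: sum.cartesian_product case_prod_beta)
  also have "\<dots> = (\<Sum>a\<in>?SA. \<Sum>c\<in>?SC. \<Sum>b\<in>?SB. r (a, b, c))"
    by (intro sum.cong refl sum.swap)
  also have "\<dots> = (\<Sum>c\<in>?SC. \<Sum>a\<in>?SA. \<Sum>b\<in>?SB. r (a, b, c))"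
    by (rule sum.swap)
  also have "\<dots> = (\<Sum>c\<in>?SC. pr C c)"
  proof (rule sum.cong[OF refl])
    fix c
    have marg: "(\<Sum>d\<in>D ` space M. pr (\<lambda>\<omega>. (D \<omega>, C \<omega>)) (d, c)) = pr C c" if D: "simple_function M D" for D :: "'a \<Rightarrow> 'z"
    proof -
      let ?D = "\<lambda>\<omega>. (D \<omega>, C \<omega>)"
      have DC: "simple_function M ?D" using D C by (rule simple_function_Pair)
      have "pr C c = (\<Sum>v\<in>{v \<in> ?D ` space M. snd v = c}. pr ?D v)"
        by (rule pr_marginal[OF DC]) auto
      also have "\<dots> = (\<Sum>v\<in>D ` space M \<times> {c}. pr ?D v)"
        using simple_finite[OF D] by (intro sum.mono_neutral_left) (auto intro!: pr_eq_0)
      also have "\<dots> = (\<Sum>d\<in>D ` space M. pr ?D (d, c))"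
        by (rule sum.reindex_bij_witness[of _ "\<lambda>d. (d, c)" fst]) auto
      finally show ?thesis by simp
    qed
    have "(\<Sum>a\<in>?SA. \<Sum>b\<in>?SB. r (a, b, c)) = (\<Sum>a\<in>?SA. pr ?AC (a, c)) * (\<Sum>b\<in>?SB. pr ?BC (b, c)) / pr C c"
      by (simp add: r_def sum_product sum_divide_distrib)
    also have "\<dots> = pr C c" using marg[OF A] marg[OF B] by simp
    finally show "(\<Sum>a\<in>?SA. \<Sum>b\<in>?SB. r (a, b, c)) = pr C c" .
  qed
  also have "\<dots> = 1" by (rule sum_pr[OF C])
  finally show ?thesis by simp
qed

lemma ent_cong_factor:
  assumes V: "simple_function M V" and U: "simple_function M U"
    and "\<And>\<omega>. \<omega> \<in> space M \<Longrightarrow> U \<omega> = g (V \<omega>)" "\<And>\<omega>. \<omega> \<in> space M \<Longrightarrow> V \<omega> = g' (U \<omega>)"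
  shows "ent U = ent V"
  using ent_mono[where V = V and Y = U and g = g, OF V assms(3)]
    ent_mono[where V = U and Y = V and g = g', OF U assms(4)] by simp

lemma ent_subadditive:
  assumes A: "simple_function M A" and B: "simple_function M B"
  shows "ent (\<lambda>\<omega>. (A \<omega>, B \<omega>)) \<le> ent A + ent B"
proof -
  have C: "simple_function M (\<lambda>_. ())" by simp
  have "ent (\<lambda>_. ()) \<le> ln (real (card {()}))" by (rule ent_le_ln_card[OF C]) auto
  then have "ent (\<lambda>_. ()) = 0" using ent_nonneg[of "\<lambda>_. ()"] by simp
  moreover have "ent (\<lambda>\<omega>. (A \<omega>, ())) \<le> ent A" by (rule ent_mono[OF A, of _ "\<lambda>a. (a, ())"]) simp
  moreover have "ent (\<lambda>\<omega>. (B \<omega>, ())) \<le> ent B" by (rule ent_mono[OF B, of _ "\<lambda>a. (a, ())"]) simp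
  moreover have "ent (\<lambda>\<omega>. (A \<omega>, B \<omega>)) \<le> ent (\<lambda>\<omega>. (A \<omega>, B \<omega>, ()))"
    by (rule ent_mono[of _ _ "\<lambda>(a, b, c). (a, b)"]) (use A B C in \<open>auto intro!: simple_function_Pair\<close>)
  ultimately show ?thesis using ent_strong_subadditive[OF A B C] by linarith
qed

end

section \<open>Entropy of measure-preserving maps\<close>

locale mp_system = prob_space M for M :: "'a measure" +
  fixes T :: "'a \<Rightarrow> 'a"
  assumes T [measurable]: "T \<in> measurable M M" and distr_T: "distr M M T = M"
begin

definition itin :: "('a \<Rightarrow> 'l) \<Rightarrow> nat \<Rightarrow> 'a \<Rightarrow> 'l list" where
  "itin \<xi> n \<omega> = map (\<lambda>i. \<xi> ((T ^^ i) \<omega>)) [0..<n]"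

lemma funpow_measurable [measurable]: "(T ^^ i) \<in> measurable M M"
  by (induction i) (auto intro: measurable_comp simp: id_def[symmetric])

lemma funpow_space: "\<omega> \<in> space M \<Longrightarrow> (T ^^ i) \<omega> \<in> space M"
  by (rule measurable_space[OF funpow_measurable])

lemma distr_funpow: "distr M M (T ^^ i) = M"
proof (induction i)
  case 0 then show ?case by (simp add: id_def distr_id)
next
  case (Suc i)
  have "distr M M (T \<circ> (T ^^ i)) = distr (distr M M (T ^^ i)) M T"
    by (rule distr_distr[symmetric]) auto
  then show ?case using Suc distr_T by (simp only: funpow.simps)
qed

lemma simple_shift: "simple_function M X \<Longrightarrow> simple_function M (\<lambda>\<omega>. X ((T ^^ i) \<omega>))"
proof -
  assume X: "simple_function M X"
  show ?thesis
    unfolding simple_function_def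
  proof (intro conjI ballI)
    show "finite ((\<lambda>\<omega>. X ((T ^^ i) \<omega>)) ` space M)"
      using simple_finite[OF X] by (rule finite_subset[rotated]) (auto intro: funpow_space)
    fix a
    have "(\<lambda>\<omega>. X ((T ^^ i) \<omega>)) -` {a} \<inter> space M = (T ^^ i) -` {\<omega> \<in> space M. X \<omega> = a} \<inter> space M"
      by (auto intro: funpow_space)
    then show "(\<lambda>\<omega>. X ((T ^^ i) \<omega>)) -` {a} \<inter> space M \<in> sets M"
      using measurable_sets[OF funpow_measurable simple_sets[OF X, of "\<lambda>l. l = a"]] by simp
  qed
qed

lemma pr_shift: "simple_function M X \<Longrightarrow> pr (\<lambda>\<omega>. X ((T ^^ i) \<omega>)) a = pr X a"
proof -
  assume X: "simple_function M X"
  have "prob {\<omega> \<in> space M. X \<omega> = a} = measure (distr M M (T ^^ i)) {\<omega> \<in> space M. X \<omega> = a}"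
    by (simp add: distr_funpow)
  also have "\<dots> = prob ((T ^^ i) -` {\<omega> \<in> space M. X \<omega> = a} \<inter> space M)"
    using simple_sets[OF X] by (intro measure_distr) auto
  also have "(T ^^ i) -` {\<omega> \<in> space M. X \<omega> = a} \<inter> space M = {\<omega> \<in> space M. X ((T ^^ i) \<omega>) = a}"
    by (auto intro: funpow_space)
  finally show ?thesis by (simp add: pr_def)
qed

lemma ent_shift: "simple_function M X \<Longrightarrow> ent (\<lambda>\<omega>. X ((T ^^ i) \<omega>)) = ent X"
proof -
  assume X: "simple_function M X"
  have "(\<lambda>\<omega>. X ((T ^^ i) \<omega>)) ` space M \<subseteq> X ` space M" by (auto intro: funpow_space)
  from ent_superset[OF simple_finite[OF X] this] show ?thesis by (simp add: pr_shift[OF X] ent_def[of X])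
qed

lemma itin_simple: "simple_function M \<xi> \<Longrightarrow> simple_function M (itin \<xi> n)"
proof (induction n)
  case 0 then show ?case by (simp add: itin_def[abs_def])
next
  case (Suc n)
  have "simple_function M (\<lambda>\<omega>. (itin \<xi> n \<omega>, \<xi> ((T ^^ n) \<omega>)))"
    using Suc by (intro simple_function_Pair simple_shift) auto
  then have "simple_function M ((\<lambda>(l, a). l @ [a]) \<circ> (\<lambda>\<omega>. (itin \<xi> n \<omega>, \<xi> ((T ^^ n) \<omega>))))"
    by (rule simple_function_compose)
  then show ?case by (simp add: o_def itin_def[abs_def])
qed

lemma itin_Suc: "itin \<xi> (Suc n) \<omega> = itin \<xi> n \<omega> @ [\<xi> ((T ^^ n) \<omega>)]"
  by (simp add: itin_def)

lemma itin_add: "itin \<xi> (m + n) \<omega> = itin \<xi> m \<omega> @ itin \<xi> n ((T ^^ m) \<omega>)"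
  by (induction n) (auto simp: itin_def funpow_add add.commute[of m])

lemma ent_itin_subadditive:
  assumes \<xi>: "simple_function M \<xi>"
  shows "ent (itin \<xi> (m + n)) \<le> ent (itin \<xi> m) + ent (itin \<xi> n)"
proof -
  let ?B = "\<lambda>\<omega>. itin \<xi> n ((T ^^ m) \<omega>)"
  have s: "simple_function M (itin \<xi> m)" "simple_function M ?B"
    using itin_simple[OF \<xi>] simple_shift by auto
  have "ent (itin \<xi> (m + n)) \<le> ent (\<lambda>\<omega>. (itin \<xi> m \<omega>, ?B \<omega>))"
    by (rule ent_mono[where g = "\<lambda>(a, b). a @ b", OF simple_function_Pair[OF s]]) (simp add: itin_add)
  also have "\<dots> \<le> ent (itin \<xi> m) + ent ?B" by (rule ent_subadditive[OF s])
  also have "ent ?B = ent (itin \<xi> n)" by (rule ent_shift[OF itin_simple[OF \<xi>]])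
  finally show ?thesis .
qed

text \<open>Conditionally on the itinerary of \<open>\<kappa>\<close>, each further step of the itinerary of \<open>\<xi>\<close> costs at
  most the conditional entropy of \<open>\<xi>\<close> given \<open>\<kappa>\<close>.\<close>

lemma ent_itin_relative:
  assumes \<xi>: "simple_function M \<xi>" and \<kappa>: "simple_function M \<kappa>"
  shows "ent (\<lambda>\<omega>. (itin \<xi> n \<omega>, itin \<kappa> n \<omega>)) - ent (itin \<kappa> n)
    \<le> real n * (ent (\<lambda>\<omega>. (\<xi> \<omega>, \<kappa> \<omega>)) - ent \<kappa>)"
proof (induction n)
  case 0
  have "ent (\<lambda>\<omega>. (itin \<xi> 0 \<omega>, itin \<kappa> 0 \<omega>)) \<le> ent (itin \<kappa> 0)"
    by (rule ent_mono[where g = "\<lambda>l. ([], l)", OF itin_simple[OF \<kappa>]]) (simp add: itin_def)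
  then show ?case by simp
next
  case (Suc n)
  let ?\<xi> = "\<lambda>\<omega>. \<xi> ((T ^^ n) \<omega>)" and ?\<kappa> = "\<lambda>\<omega>. \<kappa> ((T ^^ n) \<omega>)"
  note s = itin_simple[OF \<xi>, of n] itin_simple[OF \<kappa>, of n] simple_shift[OF \<xi>, of n] simple_shift[OF \<kappa>, of n]
  have p: "simple_function M (\<lambda>\<omega>. (itin \<xi> n \<omega>, itin \<kappa> n \<omega>))" by (rule simple_function_Pair[OF s(1,2)])
  have sp: "simple_function M (\<lambda>\<omega>. (?\<xi> \<omega>, (itin \<xi> n \<omega>, itin \<kappa> n \<omega>), ?\<kappa> \<omega>))"
    by (intro simple_function_Pair s p)
  have sp2: "simple_function M (\<lambda>\<omega>. (itin \<xi> n \<omega>, ?\<kappa> \<omega>, itin \<kappa> n \<omega>))"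
    by (intro simple_function_Pair s p)
  have 1: "ent (\<lambda>\<omega>. (itin \<xi> (Suc n) \<omega>, itin \<kappa> (Suc n) \<omega>)) \<le> ent (\<lambda>\<omega>. (?\<xi> \<omega>, (itin \<xi> n \<omega>, itin \<kappa> n \<omega>), ?\<kappa> \<omega>))"
    by (rule ent_mono[where g = "\<lambda>(a, (l, m), b). (l @ [a], m @ [b])", OF sp]) (simp add: itin_Suc)
  have 2: "ent (\<lambda>\<omega>. (?\<xi> \<omega>, (itin \<xi> n \<omega>, itin \<kappa> n \<omega>), ?\<kappa> \<omega>)) + ent ?\<kappa>
    \<le> ent (\<lambda>\<omega>. (?\<xi> \<omega>, ?\<kappa> \<omega>)) + ent (\<lambda>\<omega>. ((itin \<xi> n \<omega>, itin \<kappa> n \<omega>), ?\<kappa> \<omega>))"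
    by (rule ent_strong_subadditive[OF s(3) p s(4)])
  have 3: "ent (\<lambda>\<omega>. ((itin \<xi> n \<omega>, itin \<kappa> n \<omega>), ?\<kappa> \<omega>)) \<le> ent (\<lambda>\<omega>. (itin \<xi> n \<omega>, ?\<kappa> \<omega>, itin \<kappa> n \<omega>))"
    by (rule ent_mono[where g = "\<lambda>(l, b, m). ((l, m), b)", OF sp2]) simp
  have 4: "ent (\<lambda>\<omega>. (itin \<xi> n \<omega>, ?\<kappa> \<omega>, itin \<kappa> n \<omega>)) + ent (itin \<kappa> n)
    \<le> ent (\<lambda>\<omega>. (itin \<xi> n \<omega>, itin \<kappa> n \<omega>)) + ent (\<lambda>\<omega>. (?\<kappa> \<omega>, itin \<kappa> n \<omega>))"
    by (rule ent_strong_subadditive[OF s(1) s(4) s(2)])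
  have 5: "ent (\<lambda>\<omega>. (?\<kappa> \<omega>, itin \<kappa> n \<omega>)) \<le> ent (itin \<kappa> (Suc n))"
    by (rule ent_mono[where g = "\<lambda>l. (last l, butlast l)", OF itin_simple[OF \<kappa>]]) (simp add: itin_Suc)
  have 6: "ent ?\<kappa> = ent \<kappa>" by (rule ent_shift[OF \<kappa>])
  have 7: "ent (\<lambda>\<omega>. (?\<xi> \<omega>, ?\<kappa> \<omega>)) = ent (\<lambda>\<omega>. (\<xi> \<omega>, \<kappa> \<omega>))"
    by (rule ent_shift[OF simple_function_Pair[OF \<xi> \<kappa>]])
  have "real (Suc n) * (ent (\<lambda>\<omega>. (\<xi> \<omega>, \<kappa> \<omega>)) - ent \<kappa>)
    = real n * (ent (\<lambda>\<omega>. (\<xi> \<omega>, \<kappa> \<omega>)) - ent \<kappa>) + (ent (\<lambda>\<omega>. (\<xi> \<omega>, \<kappa> \<omega>)) - ent \<kappa>)"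
    by (simp add: algebra_simps)
  then show ?case using Suc 1 2 3 4 5 6 7 by linarith
qed

definition cell :: "'a set set \<Rightarrow> 'a \<Rightarrow> 'a set" where
  "cell P x = (THE A. A \<in> P \<and> x \<in> A)"

lemma cell_eq:
  assumes "finite_meas_partition M P" "A \<in> P" "x \<in> A" shows "cell P x = A"
  unfolding cell_def
proof (rule the_equality)
  fix B assume "B \<in> P \<and> x \<in> B"
  then show "B = A" using assms unfolding finite_meas_partition_def disjoint_def by blast
qed (use assms in simp)

lemma cell_mem:
  assumes "finite_meas_partition M P" "x \<in> space M" shows "cell P x \<in> P" "x \<in> cell P x"
proof -
  obtain A where "A \<in> P" "x \<in> A" using assms unfolding finite_meas_partition_def by blast
  then show "cell P x \<in> P" "x \<in> cell P x" using cell_eq[OF assms(1)] by auto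
qed

lemma cell_simple:
  assumes P: "finite_meas_partition M P" shows "simple_function M (cell P)"
  unfolding simple_function_def
proof (intro conjI ballI)
  have fin: "finite P" using P by (simp add: finite_meas_partition_def)
  show "finite (cell P ` space M)" by (rule finite_subset[OF _ fin]) (use cell_mem[OF P] in auto)
  fix A assume "A \<in> cell P ` space M"
  then have A: "A \<in> P" using cell_mem[OF P] by auto
  have "A \<subseteq> space M" using A P unfolding finite_meas_partition_def by blast
  have "cell P -` {A} \<inter> space M = A"
  proof (intro equalityI subsetI)
    fix x assume "x \<in> cell P -` {A} \<inter> space M"
    then show "x \<in> A" using cell_mem(2)[OF P, of x] by simp
  next
    fix x assume "x \<in> A"
    then show "x \<in> cell P -` {A} \<inter> space M" using cell_eq[OF P A] \<open>A \<subseteq> space M\<close> by auto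
  qed
  then show "cell P -` {A} \<inter> space M \<in> sets M" using A P by (auto simp: finite_meas_partition_def)
qed

text \<open>Different itineraries define different atoms unless both are empty, and empty atoms contribute
  \<open>0 ln 0 = 0\<close>.\<close>

lemma partition_entropy_iterated_join:
  assumes P: "finite_meas_partition M P"
  shows "partition_entropy M (iterated_join M T P n) = ent (itin (cell P) n)"
proof -
  let ?J = "iterated_join M T P n" and ?X = "itin (cell P) n"
  define pre where "pre l = {\<omega> \<in> space M. ?X \<omega> = l}" for l
  have fin: "finite P" using P by (simp add: finite_meas_partition_def)
  have eq: "{x \<in> space M. \<forall>i<n. (T ^^ i) x \<in> s i} = pre (map s [0..<n])" if s: "\<forall>i<n. s i \<in> P" for s
  proof -
    have "(T ^^ i) x \<in> s i \<longleftrightarrow> cell P ((T ^^ i) x) = s i" if "x \<in> space M" "i < n" for x i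
      using cell_eq[OF P] cell_mem[OF P funpow_space[OF that(1)]] s that(2) by metis
    then show ?thesis unfolding pre_def itin_def by (auto simp: list_eq_iff_nth_eq)
  qed
  have J: "?J = pre ` {l. set l \<subseteq> P \<and> length l = n}" (is "_ = pre ` ?L")
  proof (intro equalityI subsetI)
    fix A assume "A \<in> ?J"
    then obtain s where s: "\<forall>i<n. s i \<in> P" "A = {x \<in> space M. \<forall>i<n. (T ^^ i) x \<in> s i}"
      unfolding iterated_join_def by blast
    then have "A = pre (map s [0..<n])" using eq by simp
    moreover have "map s [0..<n] \<in> ?L" using s(1) by auto
    ultimately show "A \<in> pre ` ?L" by blast
  next
    fix A assume "A \<in> pre ` ?L"
    then obtain l where l: "set l \<subseteq> P" "length l = n" "A = pre l" by auto
    have s: "\<forall>i<n. l ! i \<in> P" using l by auto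
    have "map ((!) l) [0..<n] = l" using l(2) by (metis map_nth)
    then have "A = {x \<in> space M. \<forall>i<n. (T ^^ i) x \<in> l ! i}" using eq[OF s] l(3) by simp
    then show "A \<in> ?J" unfolding iterated_join_def using s by blast
  qed
  have finL: "finite ?L" by (rule finite_lists_length_eq[OF fin])
  have sub: "?X ` space M \<subseteq> ?L" using cell_mem[OF P funpow_space] by (auto simp: itin_def)
  have "(\<Sum>A\<in>?J. prob A * ln (prob A)) = (\<Sum>A\<in>pre ` (?X ` space M). prob A * ln (prob A))"
  proof (rule sum.mono_neutral_right)
    show "finite ?J" unfolding J using finL by simp
    show "pre ` (?X ` space M) \<subseteq> ?J" unfolding J using sub by auto
    show "\<forall>A\<in>?J - pre ` (?X ` space M). prob A * ln (prob A) = 0"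
    proof
      fix A assume A: "A \<in> ?J - pre ` (?X ` space M)"
      then obtain l where "A = pre l" "l \<notin> ?X ` space M" unfolding J by auto
      then have "A = {}" by (auto simp: pre_def)
      then show "prob A * ln (prob A) = 0" by simp
    qed
  qed
  also have "\<dots> = (\<Sum>l\<in>?X ` space M. prob (pre l) * ln (prob (pre l)))"
    by (rule sum.reindex_cong[of pre]) (auto simp: inj_on_def pre_def)
  finally show ?thesis by (simp add: partition_entropy_def ent_def pr_def pre_def)
qed

lemma partition_rate:
  assumes P: "finite_meas_partition M P"
  obtains L where "lim (\<lambda>n. partition_entropy M (iterated_join M T P n) / real n) = L"
    "(\<lambda>n. ent (itin (cell P) n) / real n) \<longlonglongrightarrow> L"
proof -
  obtain L where "(\<lambda>n. ent (itin (cell P) n) / real n) \<longlonglongrightarrow> L"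
    by (rule subadditive_converges[of "\<lambda>n. ent (itin (cell P) n)"])
      (use ent_itin_subadditive[OF cell_simple[OF P]] ent_nonneg in auto)
  then show ?thesis
    by (intro that[OF limI]) (simp_all add: partition_entropy_iterated_join[OF P])
qed

lemma ks_entropy_nonneg: "ks_entropy M T \<ge> 0"
proof -
  have P: "finite_meas_partition M {space M}" by (simp add: finite_meas_partition_def)
  obtain L where L: "lim (\<lambda>n. partition_entropy M (iterated_join M T {space M} n) / real n) = L"
    "(\<lambda>n. ent (itin (cell {space M}) n) / real n) \<longlonglongrightarrow> L"
    by (rule partition_rate[OF P])
  have "0 \<le> L"
    by (rule LIMSEQ_le_const[OF L(2)], intro exI[of _ 0] allI impI divide_nonneg_nonneg ent_nonneg) simp
  then have "0 \<le> ereal L" by simp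
  also have "\<dots> \<le> ks_entropy M T"
    unfolding ks_entropy_def by (rule SUP_upper2[of "{space M}"]) (use P L(1) in auto)
  finally show ?thesis .
qed

end

section \<open>The generator theorem for subshifts\<close>

locale shift_system = mp_system M shift_map for M :: "seq measure" +
  fixes X :: "seq set"
  assumes subshift: "subshift X" and sets_M: "sets M = sets (restrict_space borel X)"
begin

abbreviation wd :: "nat \<Rightarrow> seq \<Rightarrow> nat list" where "wd n x \<equiv> word_at x 0 n"

lemma space_M: "space M = X"
  using sets_eq_imp_space_eq[OF sets_M] by (simp add: space_restrict_space)

lemma X_nonempty: "X \<noteq> {}" using not_empty space_M by simp

lemma wd_words: "wd n ` space M = words_of_length X n"
  unfolding space_M by (rule words_of_length_eq[OF subshift X_nonempty, symmetric])

lemma wd_simple: "simple_function M (wd n)"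
  unfolding simple_function_def
proof (intro conjI ballI)
  show "finite (wd n ` space M)" unfolding wd_words by (rule finite_words_of_length(1)[OF subshift])
  fix u
  have "{x::seq. word_at x 0 n \<noteq> u} \<in> sets borel" using closed_word_at_neq by auto
  then have "- {x::seq. word_at x 0 n \<noteq> u} \<in> sets borel" by (rule borel_comp)
  then have "- {x::seq. word_at x 0 n \<noteq> u} \<inter> X \<in> sets M"
    unfolding sets_M sets_restrict_space by (auto simp: Int_commute)
  moreover have "wd n -` {u} \<inter> space M = - {x::seq. word_at x 0 n \<noteq> u} \<inter> X" by (auto simp: space_M)
  ultimately show "wd n -` {u} \<inter> space M \<in> sets M" by simp
qed

lemma wd_event: "{x \<in> X. wd n x \<in> S} \<in> sets M"
  using simple_sets[OF wd_simple, of "\<lambda>u. u \<in> S" n] by (simp add: space_M)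

lemma ent_wd_add: "ent (wd (m + n)) \<le> ent (wd m) + ent (wd n)"
proof -
  let ?B = "\<lambda>x. wd n ((shift_map ^^ m) x)"
  have s: "simple_function M (wd m)" "simple_function M ?B"
    using wd_simple simple_shift by auto
  have "ent (wd (m + n)) \<le> ent (\<lambda>x. (wd m x, ?B x))"
    by (rule ent_mono[where g = "\<lambda>(a, b). a @ b", OF simple_function_Pair[OF s]]) (simp add: word_at_append word_at_funpow)
  also have "\<dots> \<le> ent (wd m) + ent ?B" by (rule ent_subadditive[OF s])
  also have "ent ?B = ent (wd n)" by (rule ent_shift[OF wd_simple])
  finally show ?thesis .
qed

text \<open>The sets that can be approximated in measure by sets depending on finitely many symbols contain the
  open sets and form a \<open>\<sigma>\<close>-algebra, hence contain all Borel sets.\<close>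

definition err :: "seq set \<Rightarrow> nat \<Rightarrow> nat list set \<Rightarrow> real" where
  "err A N S = prob ((A \<inter> X - {x \<in> X. wd N x \<in> S}) \<union> ({x \<in> X. wd N x \<in> S} - A \<inter> X))"

definition near :: "seq set \<Rightarrow> bool" where
  "near A \<longleftrightarrow> (\<forall>\<delta>>0. \<exists>N S. err A N S < \<delta>)"

lemma borel_Int_X: "A \<in> sets borel \<Longrightarrow> A \<inter> X \<in> sets M"
  unfolding sets_M sets_restrict_space by (auto simp: Int_commute)

lemma near_cylinder: "near {x. wd N x = u}"
proof -
  have "({x. wd N x = u} \<inter> X - {x \<in> X. wd N x \<in> {u}}) \<union> ({x \<in> X. wd N x \<in> {u}} - {x. wd N x = u} \<inter> X) = {}"
    by auto
  then have "err {x. wd N x = u} N {u} = 0" unfolding err_def by (simp only: measure_empty)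
  then show ?thesis unfolding near_def by metis
qed

lemma near_Compl: "near A \<Longrightarrow> near (UNIV - A)"
proof -
  assume A: "near A"
  have "(A \<inter> X - {x \<in> X. wd N x \<in> S}) \<union> ({x \<in> X. wd N x \<in> S} - A \<inter> X)
    = ((UNIV - A) \<inter> X - {x \<in> X. wd N x \<in> - S}) \<union> ({x \<in> X. wd N x \<in> - S} - (UNIV - A) \<inter> X)" for N S by blast
  then have "err (UNIV - A) N (- S) = err A N S" for N S unfolding err_def by (simp only:)
  then show ?thesis using A unfolding near_def by metis
qed

lemma take_wd: "n \<le> N \<Longrightarrow> take n (wd N x) = wd n x"
  by (simp add: word_at_def take_map)

lemma near_UN:
  assumes A: "\<And>i::nat. A i \<in> sets borel" "\<And>i. near (A i)"
  shows "near (\<Union>i. A i)"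
  unfolding near_def
proof (intro allI impI)
  fix \<delta> :: real assume \<delta>: "\<delta> > 0"
  let ?U = "\<lambda>n. (\<Union>i<n. A i) \<inter> X" and ?U' = "(\<Union>i. A i) \<inter> X"
  have U: "?U n \<in> sets M" for n using A by (intro borel_Int_X) auto
  have U': "?U' \<in> sets M" using A by (intro borel_Int_X) auto
  have "(\<lambda>n. prob (?U n)) \<longlonglongrightarrow> prob (\<Union>n. ?U n)"
    using U by (intro finite_Lim_measure_incseq) (auto simp: incseq_def intro: less_le_trans)
  moreover have "(\<Union>n. ?U n) = ?U'" by auto
  ultimately have "(\<lambda>n. prob (?U n)) \<longlonglongrightarrow> prob ?U'" by simp
  from LIMSEQ_D[OF this, of "\<delta> / 2"] \<delta> obtain n where n: "\<bar>prob (?U n) - prob ?U'\<bar> < \<delta> / 2" by auto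
  have "?U n \<subseteq> ?U'" by auto
  from finite_measure_Diff[OF U' U this] have tail: "prob (?U' - ?U n) < \<delta> / 2" using n by linarith
  have "\<delta> / (2 * real (Suc n)) > 0" using \<delta> by simp
  then have "\<forall>i. \<exists>N S. err (A i) N S < \<delta> / (2 * real (Suc n))"
    using A(2) unfolding near_def by blast
  then obtain N S where NS: "\<And>i. err (A i) (N i) (S i) < \<delta> / (2 * real (Suc n))"
    by metis
  let ?E = "\<lambda>i. (A i \<inter> X - {x \<in> X. wd (N i) x \<in> S i}) \<union> ({x \<in> X. wd (N i) x \<in> S i} - A i \<inter> X)"
  have E: "?E i \<in> sets M" for i using borel_Int_X[OF A(1)] wd_event by auto
  define N0 where "N0 = Max (insert 0 (N ` {..<n}))"
  have N0: "N i \<le> N0" if "i < n" for i unfolding N0_def using that by (intro Max_ge) auto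
  define S0 where "S0 = {w. \<exists>i<n. take (N i) w \<in> S i}"
  have S0: "wd N0 x \<in> S0 \<longleftrightarrow> (\<exists>i<n. wd (N i) x \<in> S i)" for x
    unfolding S0_def using N0 by (auto simp: take_wd)
  let ?D = "(?U' - {x \<in> X. wd N0 x \<in> S0}) \<union> ({x \<in> X. wd N0 x \<in> S0} - ?U')"
  have "?D \<subseteq> (?U' - ?U n) \<union> (\<Union>i<n. ?E i)" unfolding S0 by blast
  then have "prob ?D \<le> prob ((?U' - ?U n) \<union> (\<Union>i<n. ?E i))"
    using U U' E by (intro finite_measure_mono) auto
  also have "\<dots> \<le> prob (?U' - ?U n) + prob (\<Union>i<n. ?E i)"
    using U U' E by (intro measure_Un_le) auto
  also have "prob (\<Union>i<n. ?E i) \<le> (\<Sum>i<n. prob (?E i))"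
    using E by (intro finite_measure_subadditive_finite) auto
  also have "\<dots> \<le> (\<Sum>i<n. \<delta> / (2 * real (Suc n)))"
    using NS by (intro sum_mono less_imp_le) (simp only: err_def)
  also have "\<dots> = real n * (\<delta> / (2 * real (Suc n)))" by simp
  also have "\<dots> \<le> \<delta> / 2" using \<delta> by (simp add: field_simps)
  finally have "prob ?D < \<delta>" using tail by linarith
  then show "\<exists>N S. err (\<Union>i. A i) N S < \<delta>" unfolding err_def by blast
qed

lemma near_open:
  assumes "open A" shows "near A"
proof -
  define C where "C p = {x::seq. wd (fst p) x = snd p}" for p :: "nat \<times> nat list"
  define I where "I = {p. C p \<subseteq> A}"
  define F where "F i = (if from_nat i \<in> I then C (from_nat i) else {})" for i
  have "A \<subseteq> (\<Union>i. F i)"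
  proof
    fix z assume "z \<in> A"
    from open_seq_contains_cylinder[OF assms this] obtain n where n: "{x. \<forall>i<n. x i = z i} \<subseteq> A" .
    let ?p = "(n, wd n z)"
    have "C ?p = {x. \<forall>i<n. x i = z i}" by (auto simp: C_def word_at_eq_iff)
    then have "?p \<in> I" "z \<in> C ?p" using n by (auto simp: I_def)
    then show "z \<in> (\<Union>i. F i)" by (auto simp: F_def intro!: exI[of _ "to_nat ?p"])
  qed
  then have "A = (\<Union>i. F i)" by (auto simp: F_def I_def)
  moreover have "near (F i)" for i
  proof (cases "from_nat i \<in> I")
    case True then show ?thesis by (simp add: F_def C_def near_cylinder)
  next
    case False
    have "near (UNIV - (UNIV - {x. wd 0 x = [0]}))" by (intro near_Compl near_cylinder)
    then show ?thesis using False by (simp add: F_def word_at_def)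
  qed
  moreover have "F i \<in> sets borel" for i
  proof -
    have "- {x. word_at x 0 n \<noteq> u} \<in> sets borel" for n u using closed_word_at_neq by (intro borel_comp) auto
    then show ?thesis by (auto simp: F_def C_def Collect_neg_eq)
  qed
  ultimately show ?thesis using near_UN[of F] by simp
qed

lemma near_borel: "A \<in> sets borel \<Longrightarrow> near A"
proof -
  assume "A \<in> sets borel"
  then have "A \<in> sigma_sets UNIV {S :: seq set. open S}" by (simp add: borel_def)
  then show ?thesis
  proof induction
    case Empty then show ?case by (rule near_open) simp
  next
    case (Union a)
    then have "a i \<in> sets borel" for i by (simp add: borel_def)
    then show ?case using Union by (intro near_UN) auto
  qed (auto intro: near_open near_Compl)
qed

text \<open>Every finite partition is, up to small conditional entropy, read off from a long enough word. Each
  \<open>A \<in> P\<close> is approximated separately, and the label of \<open>x\<close> is the set of all \<open>A\<close> whose approximation contains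
  \<open>x\<close>; this avoids making the approximations disjoint. Outside a small set the label is the singleton of the
  cell of \<open>x\<close>, and entropy is continuous in the finitely many probabilities involved.\<close>

lemma partition_approx:
  assumes P: "finite_meas_partition M P" and e: "e > 0"
  obtains N g where "ent (\<lambda>x. (cell P x, g (wd N x) :: seq set set)) - ent (\<lambda>x. g (wd N x)) < e"
proof -
  have fin: "finite P" using P by (simp add: finite_meas_partition_def)
  have AX: "A \<inter> X = A" if "A \<in> P" for A
    using that P space_M unfolding finite_meas_partition_def by blast
  have "\<exists>N S. err A N S < 1 / real (Suc j)" if "A \<in> P" for A j
  proof -
    have "A \<in> sets M" using that P by (auto simp: finite_meas_partition_def)
    then obtain B where B: "B \<in> sets borel" "A = B \<inter> X" unfolding sets_M sets_restrict_space by auto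
    have "1 / real (Suc j) > 0" by simp
    then have "\<exists>N S. err B N S < 1 / real (Suc j)" using near_borel[OF B(1)] unfolding near_def by blast
    moreover have "err A N S = err B N S" for N S unfolding err_def B(2) by (simp only: Int_assoc Int_absorb)
    ultimately show ?thesis by simp
  qed
  then obtain N S where NS: "\<And>A j. A \<in> P \<Longrightarrow> err A (N A j) (S A j) < 1 / real (Suc j)"
    by metis
  define E where "E A j = (A - {x \<in> X. wd (N A j) x \<in> S A j}) \<union> ({x \<in> X. wd (N A j) x \<in> S A j} - A)" for A j
  define Bad where "Bad j = (\<Union>A\<in>P. E A j)" for j
  have E: "E A j \<in> sets M" if "A \<in> P" for A j
    using that P wd_event unfolding E_def by (auto simp: finite_meas_partition_def)
  have Bad: "Bad j \<in> sets M" for j unfolding Bad_def using E fin by auto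
  have probBad: "prob (Bad j) \<le> real (card P) / real (Suc j)" for j
  proof -
    have "prob (Bad j) \<le> (\<Sum>A\<in>P. prob (E A j))"
      unfolding Bad_def using E fin by (intro finite_measure_subadditive_finite) auto
    also have "\<dots> \<le> (\<Sum>A\<in>P. 1 / real (Suc j))" using NS AX unfolding E_def err_def by (intro sum_mono less_imp_le) simp
    finally show ?thesis by simp
  qed
  define N0 where "N0 j = Max (insert 0 ((\<lambda>A. N A j) ` P))" for j
  have N0: "N A j \<le> N0 j" if "A \<in> P" for A j unfolding N0_def using that fin by (intro Max_ge) auto
  define g where "g j w = {A \<in> P. take (N A j) w \<in> S A j}" for j w
  have g: "g j (wd (N0 j) x) = {A \<in> P. wd (N A j) x \<in> S A j}" for j x
    unfolding g_def using N0 by (auto simp: take_wd)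
  let ?\<xi> = "cell P" and ?\<eta> = "\<lambda>j x. g j (wd (N0 j) x)"
  have good: "?\<eta> j x = {?\<xi> x}" if x: "x \<in> X" "x \<notin> Bad j" for j x
  proof -
    have "wd (N A j) x \<in> S A j \<longleftrightarrow> x \<in> A" if "A \<in> P" for A
      using x that unfolding Bad_def E_def by blast
    then have "?\<eta> j x = {A \<in> P. x \<in> A}" unfolding g by blast
    also have "\<dots> = {?\<xi> x}" using cell_eq[OF P] cell_mem[OF P] x(1) space_M by auto
    finally show ?thesis .
  qed
  have s\<xi>: "simple_function M ?\<xi>" by (rule cell_simple[OF P])
  have s\<eta>: "simple_function M (?\<eta> j)" for j
    using simple_function_compose[OF wd_simple, of "g j" "N0 j"] by (simp add: o_def)
  have s\<zeta>: "simple_function M (\<lambda>x. {?\<xi> x})"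
    using simple_function_compose[OF s\<xi>, of "\<lambda>A. {A}"] by (simp add: o_def)
  have pr_lim: "(\<lambda>j. pr (V j) v) \<longlonglongrightarrow> pr V' v"
    if V: "\<And>j. simple_function M (V j)" and V': "simple_function M V'"
      and eq: "\<And>j x. x \<in> X \<Longrightarrow> x \<notin> Bad j \<Longrightarrow> V j x = V' x" for V and V' :: "seq \<Rightarrow> 'z" and v
  proof (rule LIM_zero_cancel, rule Lim_null_comparison)
    show "(\<lambda>j. real (card P) / real (Suc j)) \<longlonglongrightarrow> 0" by real_asymp
    show "\<forall>\<^sub>F j in sequentially. norm (pr (V j) v - pr V' v) \<le> real (card P) / real (Suc j)"
    proof (intro always_eventually allI)
      fix j
      let ?a = "{x \<in> space M. V j x = v}" and ?b = "{x \<in> space M. V' x = v}"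
      have ab: "?a \<in> sets M" "?b \<in> sets M" using simple_sets[OF V] simple_sets[OF V'] by auto
      have "?a \<subseteq> ?b \<union> Bad j" "?b \<subseteq> ?a \<union> Bad j" using eq space_M by auto
      then have "prob ?a \<le> prob (?b \<union> Bad j)" "prob ?b \<le> prob (?a \<union> Bad j)"
        using ab Bad by (auto intro!: finite_measure_mono)
      moreover have "prob (?b \<union> Bad j) \<le> prob ?b + prob (Bad j)" "prob (?a \<union> Bad j) \<le> prob ?a + prob (Bad j)"
        using ab Bad by (auto intro!: measure_Un_le)
      ultimately show "norm (pr (V j) v - pr V' v) \<le> real (card P) / real (Suc j)"
        using probBad[of j] by (simp add: pr_def abs_le_iff)
    qed
  qed
  have ent_lim: "(\<lambda>j. ent (V j)) \<longlonglongrightarrow> ent V'"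
    if V: "\<And>j. simple_function M (V j)" and V': "simple_function M V'"
      and eq: "\<And>j x. x \<in> X \<Longrightarrow> x \<notin> Bad j \<Longrightarrow> V j x = V' x"
      and R: "finite R" "\<And>j. V j ` space M \<subseteq> R" "V' ` space M \<subseteq> R" for V and V' :: "seq \<Rightarrow> 'z" and R
  proof -
    have "(\<lambda>j. - (\<Sum>v\<in>R. pr (V j) v * ln (pr (V j) v))) \<longlonglongrightarrow> - (\<Sum>v\<in>R. pr V' v * ln (pr V' v))"
      by (intro tendsto_minus tendsto_sum tendsto_mult_ln pr_lim[OF V V' eq] pr_nonneg)
    then show ?thesis using ent_superset[OF R(1) R(2)] ent_superset[OF R(1) R(3)] by simp
  qed
  have finR: "finite (P \<times> Pow P)" "finite (Pow P)" using fin by auto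
  have "(\<lambda>j. ent (\<lambda>x. (?\<xi> x, ?\<eta> j x))) \<longlonglongrightarrow> ent (\<lambda>x. (?\<xi> x, {?\<xi> x}))"
  proof (rule ent_lim[OF _ _ _ finR(1)])
    show "(\<lambda>x. (?\<xi> x, ?\<eta> j x)) ` space M \<subseteq> P \<times> Pow P" for j unfolding g using cell_mem[OF P] by auto
    show "(\<lambda>x. (?\<xi> x, {?\<xi> x})) ` space M \<subseteq> P \<times> Pow P" using cell_mem[OF P] by auto
  qed (auto intro!: simple_function_Pair s\<xi> s\<eta> s\<zeta> good)
  moreover have "(\<lambda>j. ent (?\<eta> j)) \<longlonglongrightarrow> ent (\<lambda>x. {?\<xi> x})"
  proof (rule ent_lim[OF _ _ _ finR(2)])
    show "?\<eta> j ` space M \<subseteq> Pow P" for j unfolding g by auto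
    show "(\<lambda>x. {?\<xi> x}) ` space M \<subseteq> Pow P" using cell_mem[OF P] by auto
  qed (auto intro!: s\<eta> s\<zeta> good)
  ultimately have "(\<lambda>j. ent (\<lambda>x. (?\<xi> x, ?\<eta> j x)) - ent (?\<eta> j)) \<longlonglongrightarrow> ent (\<lambda>x. (?\<xi> x, {?\<xi> x})) - ent (\<lambda>x. {?\<xi> x})"
    by (rule tendsto_diff)
  moreover have "ent (\<lambda>x. (?\<xi> x, {?\<xi> x})) \<le> ent (\<lambda>x. {?\<xi> x})"
    by (rule ent_mono[where g = "\<lambda>s. (the_elem s, s)", OF s\<zeta>]) simp
  then have "ent (\<lambda>x. (?\<xi> x, {?\<xi> x})) - ent (\<lambda>x. {?\<xi> x}) < e" using e by linarith
  ultimately have "\<forall>\<^sub>F j in sequentially. ent (\<lambda>x. (?\<xi> x, ?\<eta> j x)) - ent (?\<eta> j) < e"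
    by (rule order_tendstoD(2))
  then obtain j where "ent (\<lambda>x. (?\<xi> x, ?\<eta> j x)) - ent (?\<eta> j) < e"
    by (auto simp: eventually_sequentially)
  then show ?thesis by (rule that)
qed

text \<open>Kolmogorov--Sinai: by the approximation above, the entropy rate of any finite partition exceeds that of
  the words by at most \<open>e\<close>, and the entropy rate of the words is an infimum over \<open>n\<close> by Fekete's lemma.\<close>

lemma ks_entropy_le:
  assumes n: "n \<ge> 1" shows "ks_entropy M shift_map \<le> ereal (ent (wd n) / real n)"
  unfolding ks_entropy_def
proof (rule SUP_least)
  fix P assume "P \<in> {P. finite_meas_partition M P}"
  then have P: "finite_meas_partition M P" by simp
  obtain L where L: "lim (\<lambda>n. partition_entropy M (iterated_join M shift_map P n) / real n) = L"
    "(\<lambda>n. ent (itin (cell P) n) / real n) \<longlonglongrightarrow> L"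
    by (rule partition_rate[OF P])
  obtain Lc where Lc: "(\<lambda>n. ent (wd n) / real n) \<longlonglongrightarrow> Lc" "\<And>n. n \<ge> 1 \<Longrightarrow> Lc \<le> ent (wd n) / real n"
    by (rule subadditive_converges[of "\<lambda>n. ent (wd n)"]) (use ent_wd_add ent_nonneg in auto)
  have "L \<le> Lc + e" if e: "e > 0" for e
  proof -
    obtain N and g :: "nat list \<Rightarrow> seq set set" where
      g: "ent (\<lambda>x. (cell P x, g (wd N x))) - ent (\<lambda>x. g (wd N x)) < e"
      by (rule partition_approx[OF P e])
    let ?\<eta> = "\<lambda>x. g (wd N x)"
    have s\<xi>: "simple_function M (cell P)" by (rule cell_simple[OF P])
    have s\<eta>: "simple_function M ?\<eta>"
      using simple_function_compose[OF wd_simple, of g N] by (simp add: o_def)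
    have b: "ent (itin (cell P) m) \<le> ent (wd m) + ent (wd N) + real m * e" for m
    proof -
      have "ent (itin (cell P) m) \<le> ent (\<lambda>x. (itin (cell P) m x, itin ?\<eta> m x))"
        by (rule ent_mono[where g = fst, OF simple_function_Pair[OF itin_simple[OF s\<xi>] itin_simple[OF s\<eta>]]]) simp
      also have "\<dots> \<le> ent (itin ?\<eta> m) + real m * (ent (\<lambda>x. (cell P x, ?\<eta> x)) - ent ?\<eta>)"
        using ent_itin_relative[OF s\<xi> s\<eta>, of m] by simp
      also have "real m * (ent (\<lambda>x. (cell P x, ?\<eta> x)) - ent ?\<eta>) \<le> real m * e"
        using g by (intro mult_left_mono) auto
      also have "ent (itin ?\<eta> m) \<le> ent (wd (m + N))"
      proof (rule ent_mono[where g = "\<lambda>u. map (\<lambda>i. g (take N (drop i u))) [0..<m]", OF wd_simple])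
        fix x
        have "wd N ((shift_map ^^ i) x) = take N (drop i (wd (m + N) x))" if "i < m" for i
          using that by (auto simp: list_eq_iff_nth_eq word_at_nth word_at_funpow)
        then show "itin ?\<eta> m x = map (\<lambda>i. g (take N (drop i (wd (m + N) x)))) [0..<m]"
          by (simp add: itin_def)
      qed
      also have "ent (wd (m + N)) \<le> ent (wd m) + ent (wd N)" by (rule ent_wd_add)
      finally show ?thesis by simp
    qed
    show ?thesis
    proof (rule LIMSEQ_le[OF L(2)])
      have "(\<lambda>m. ent (wd m) / real m + ent (wd N) / real m + e) \<longlonglongrightarrow> Lc + 0 + e"
        by (intro tendsto_add Lc(1) tendsto_const lim_const_over_n)
      then show "(\<lambda>m. ent (wd m) / real m + ent (wd N) / real m + e) \<longlonglongrightarrow> Lc + e" by simp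
      show "\<exists>m0. \<forall>m\<ge>m0. ent (itin (cell P) m) / real m \<le> ent (wd m) / real m + ent (wd N) / real m + e"
      proof (intro exI[of _ 1] allI impI)
        fix m :: nat assume m: "1 \<le> m"
        have "ent (itin (cell P) m) / real m \<le> (ent (wd m) + ent (wd N) + real m * e) / real m"
          by (rule divide_right_mono[OF b]) simp
        then show "ent (itin (cell P) m) / real m \<le> ent (wd m) / real m + ent (wd N) / real m + e"
          using m by (simp add: add_divide_distrib)
      qed
    qed
  qed
  then have "L \<le> Lc" by (rule field_le_epsilon)
  also have "\<dots> \<le> ent (wd n) / real n" by (rule Lc(2)[OF n])
  finally show "ereal (lim (\<lambda>n. partition_entropy M (iterated_join M shift_map P n) / real n)) \<le> ereal (ent (wd n) / real n)"
    by (simp add: L(1))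
qed

text \<open>The partition into cylinders of length one already attains the entropy rate of the words.\<close>

lemma ks_entropy_ge:
  assumes "\<And>n. real n * r - C \<le> ent (wd n)" shows "ereal r \<le> ks_entropy M shift_map"
proof -
  define P where "P = (\<lambda>x. {z \<in> X. z 0 = x 0}) ` X"
  have P_fin: "finite P"
  proof -
    have "P = (\<lambda>a. {z \<in> X. z 0 = a}) ` symbols X" by (auto simp: P_def symbols_def)
    moreover have "finite (symbols X)"
    proof -
      obtain k where k: "\<And>x i. x \<in> X \<Longrightarrow> x i \<in> {1..k}" by (rule subshift_bound[OF subshift]) blast
      have "symbols X \<subseteq> {1..k}" unfolding symbols_def using k by blast
      then show ?thesis by (rule finite_subset) simp
    qed
    ultimately show ?thesis by simp
  qed
  have "{z \<in> X. z 0 = a} \<in> sets M" for a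
  proof -
    have "{z \<in> X. z 0 = a} = {z \<in> X. wd 1 z \<in> {[a]}}" by (auto simp: word_at_def)
    then show ?thesis using wd_event[of 1 "{[a]}"] by simp
  qed
  then have P: "finite_meas_partition M P"
    using P_fin space_M unfolding finite_meas_partition_def P_def by (auto simp: disjoint_def)
  obtain L where L: "lim (\<lambda>n. partition_entropy M (iterated_join M shift_map P n) / real n) = L"
    "(\<lambda>n. ent (itin (cell P) n) / real n) \<longlonglongrightarrow> L"
    by (rule partition_rate[OF P])
  have cell: "cell P x = {z \<in> X. z 0 = x 0}" if "x \<in> X" for x
    by (rule cell_eq[OF P]) (use that in \<open>auto simp: P_def\<close>)
  have le: "ent (wd n) \<le> ent (itin (cell P) n)" for n
  proof (rule ent_mono[where g = "map (\<lambda>A. (SOME z. z \<in> A) 0)", OF itin_simple[OF cell_simple[OF P]]])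
    fix x assume "x \<in> space M"
    then have x: "x \<in> X" by (simp add: space_M)
    have "(SOME z. z \<in> cell P ((shift_map ^^ i) x)) 0 = x i" for i
    proof -
      have xi: "(shift_map ^^ i) x \<in> X" by (rule subshift_funpow[OF subshift x])
      then have "(shift_map ^^ i) x \<in> cell P ((shift_map ^^ i) x)" by (simp add: cell)
      then have "(SOME z. z \<in> cell P ((shift_map ^^ i) x)) \<in> cell P ((shift_map ^^ i) x)"
        by (rule someI[where P = "\<lambda>z. z \<in> cell P ((shift_map ^^ i) x)"])
      then show ?thesis using cell[OF xi] by (simp add: shift_map_funpow)
    qed
    then show "wd n x = map (\<lambda>A. (SOME z. z \<in> A) 0) (itin (cell P) n x)"
      by (simp add: itin_def word_at_def)
  qed
  have "(\<lambda>n. r - C / real n) \<longlonglongrightarrow> r - 0" by (intro tendsto_diff tendsto_const) real_asymp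
  then have "(\<lambda>n. r - C / real n) \<longlonglongrightarrow> r" by simp
  then have "r \<le> L"
  proof (rule LIMSEQ_le[OF _ L(2)])
    show "\<exists>m0. \<forall>m\<ge>m0. r - C / real m \<le> ent (itin (cell P) m) / real m"
    proof (intro exI[of _ 1] allI impI)
      fix m :: nat assume m: "1 \<le> m"
      have "(real m * r - C) / real m \<le> ent (itin (cell P) m) / real m"
        using order_trans[OF assms le, of m] by (rule divide_right_mono) simp
      then show "r - C / real m \<le> ent (itin (cell P) m) / real m" using m by (simp add: diff_divide_distrib)
    qed
  qed
  then have "ereal r \<le> ereal L" by simp
  also have "\<dots> \<le> ks_entropy M shift_map"
    unfolding ks_entropy_def by (rule SUP_upper2[of P]) (use P L(1) in auto)
  finally show ?thesis .
qed

text \<open>The elementary half of the variational principle, in a form valid for each single \<open>n\<close>: Gibbs' inequality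
  for the distribution of the words of length \<open>n\<close>.\<close>

lemma free_energy_le:
  assumes F: "F \<in> borel_measurable M" "\<And>x. x \<in> X \<Longrightarrow> \<bar>F x\<bar> \<le> B" and n: "n \<ge> 1"
    and s: "\<And>x. x \<in> X \<Longrightarrow> birkhoff_sum n F x \<le> s (wd n x)"
  shows "ks_entropy M shift_map + ereal (integral\<^sup>L M F) \<le> ereal (ln (\<Sum>u\<in>words_of_length X n. exp (s u)) / real n)"
proof -
  let ?S = "words_of_length X n"
  have fin: "finite ?S" by (rule finite_words_of_length(1)[OF subshift])
  have intF: "integrable M (\<lambda>x. F ((shift_map ^^ i) x))" for i
  proof (rule integrable_const_bound[of _ B])
    show "(\<lambda>x. F ((shift_map ^^ i) x)) \<in> borel_measurable M" by (rule measurable_compose[OF funpow_measurable F(1)])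
  qed (use F(2) subshift_funpow[OF subshift] space_M in auto)
  have inv: "integral\<^sup>L M (\<lambda>x. F ((shift_map ^^ i) x)) = integral\<^sup>L M F" for i
    using integral_distr[OF funpow_measurable F(1), of i] by (simp add: distr_funpow)
  have ind: "integrable M (\<lambda>x. indicator {x \<in> space M. wd n x = u} x :: real)" for u
    using simple_sets[OF wd_simple, of "\<lambda>w. w = u" n] by (intro integrable_real_indicator) (auto simp: less_top[symmetric])
  have "real n * integral\<^sup>L M F = integral\<^sup>L M (birkhoff_sum n F)"
    unfolding birkhoff_sum_def[abs_def] using intF inv by simp
  also have "\<dots> \<le> integral\<^sup>L M (\<lambda>x. \<Sum>u\<in>?S. indicator {x \<in> space M. wd n x = u} x * s u)"
  proof (rule integral_mono)
    show "integrable M (birkhoff_sum n F)" unfolding birkhoff_sum_def[abs_def] using intF by simp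
    show "integrable M (\<lambda>x. \<Sum>u\<in>?S. indicator {x \<in> space M. wd n x = u} x * s u)"
      by (intro Bochner_Integration.integrable_sum integrable_mult_left ind)
    fix x assume x: "x \<in> space M"
    have wx: "wd n x \<in> ?S" using wd_words x by blast
    have "(\<Sum>u\<in>?S. indicator {x \<in> space M. wd n x = u} x * s u) = (\<Sum>u\<in>?S. if u = wd n x then s u else 0)"
      using x by (intro sum.cong) (auto simp: indicator_def)
    also have "\<dots> = s (wd n x)" using wx fin by simp
    finally show "birkhoff_sum n F x \<le> (\<Sum>u\<in>?S. indicator {x \<in> space M. wd n x = u} x * s u)"
      using s[of x] x space_M by simp
  qed
  also have "\<dots> = (\<Sum>u\<in>?S. pr (wd n) u * s u)"
  proof -
    have "integral\<^sup>L M (\<lambda>x. \<Sum>u\<in>?S. indicator {x \<in> space M. wd n x = u} x * s u)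
      = (\<Sum>u\<in>?S. integral\<^sup>L M (\<lambda>x. indicator {x \<in> space M. wd n x = u} x * s u))"
      by (intro Bochner_Integration.integral_sum integrable_mult_left ind)
    also have "\<dots> = (\<Sum>u\<in>?S. prob ({x \<in> space M. wd n x = u} \<inter> space M) * s u)"
      by (simp only: integral_mult_left_zero Bochner_Integration.integral_indicator)
    also have "\<dots> = (\<Sum>u\<in>?S. pr (wd n) u * s u)"
      unfolding pr_def by (intro sum.cong refl arg_cong2[of _ _ _ _ "(*)"] arg_cong[of _ _ prob]) auto
    finally show ?thesis .
  qed
  finally have 1: "real n * integral\<^sup>L M F \<le> (\<Sum>u\<in>?S. pr (wd n) u * s u)" .
  have "ent (wd n) + (\<Sum>u\<in>?S. pr (wd n) u * s u) \<le> ln (\<Sum>u\<in>?S. exp (s u))"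
    by (rule gibbs_inequality[OF wd_simple fin]) (use wd_words[of n] not_empty in auto)
  with 1 have "ent (wd n) + real n * integral\<^sup>L M F \<le> ln (\<Sum>u\<in>?S. exp (s u))" by linarith
  then have "(ent (wd n) + real n * integral\<^sup>L M F) / real n \<le> ln (\<Sum>u\<in>?S. exp (s u)) / real n"
    by (rule divide_right_mono) simp
  then have "ent (wd n) / real n + integral\<^sup>L M F \<le> ln (\<Sum>u\<in>?S. exp (s u)) / real n"
    using n by (simp add: add_divide_distrib)
  moreover have "ks_entropy M shift_map + ereal (integral\<^sup>L M F) \<le> ereal (ent (wd n) / real n) + ereal (integral\<^sup>L M F)"
    by (intro add_right_mono ks_entropy_le[OF n])
  ultimately show ?thesis by (simp add: order_trans)
qed

end

section \<open>Independent blocks\<close>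

context prob_space
begin

lemma ent_indep:
  assumes A: "simple_function M A" and B: "simple_function M B"
    and ind: "\<And>a b. pr (\<lambda>\<omega>. (A \<omega>, B \<omega>)) (a, b) = pr A a * pr B b"
  shows "ent (\<lambda>\<omega>. (A \<omega>, B \<omega>)) = ent A + ent B"
proof -
  let ?SA = "A ` space M" and ?SB = "B ` space M"
  have "ent (\<lambda>\<omega>. (A \<omega>, B \<omega>)) = - (\<Sum>v\<in>?SA \<times> ?SB. pr (\<lambda>\<omega>. (A \<omega>, B \<omega>)) v * ln (pr (\<lambda>\<omega>. (A \<omega>, B \<omega>)) v))"
    using simple_finite[OF A] simple_finite[OF B] by (intro ent_superset) auto
  also have "(\<Sum>v\<in>?SA \<times> ?SB. pr (\<lambda>\<omega>. (A \<omega>, B \<omega>)) v * ln (pr (\<lambda>\<omega>. (A \<omega>, B \<omega>)) v))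
    = (\<Sum>(a, b)\<in>?SA \<times> ?SB. pr B b * (pr A a * ln (pr A a)) + pr A a * (pr B b * ln (pr B b)))"
  proof (rule sum.cong[OF refl], clarify)
    fix a b :: "'a"
    show "pr (\<lambda>\<omega>. (A \<omega>, B \<omega>)) (A a, B b) * ln (pr (\<lambda>\<omega>. (A \<omega>, B \<omega>)) (A a, B b))
      = pr B (B b) * (pr A (A a) * ln (pr A (A a))) + pr A (A a) * (pr B (B b) * ln (pr B (B b)))"
    proof (cases "pr A (A a) = 0 \<or> pr B (B b) = 0")
      case False
      then have "pr A (A a) > 0" "pr B (B b) > 0" using pr_nonneg by (simp_all add: less_le)
      then show ?thesis by (simp add: ind ln_mult algebra_simps)
    qed (auto simp: ind)
  qed
  also have "\<dots> = (\<Sum>a\<in>?SA. \<Sum>b\<in>?SB. pr B b * (pr A a * ln (pr A a)) + pr A a * (pr B b * ln (pr B b)))"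
    by (simp add: sum.cartesian_product)
  also have "\<dots> = (\<Sum>a\<in>?SA. pr A a * ln (pr A a)) + (\<Sum>b\<in>?SB. pr B b * ln (pr B b))"
    by (simp add: sum.distrib sum_distrib_left[symmetric] sum_distrib_right[symmetric] sum_pr[OF A] sum_pr[OF B])
  finally show ?thesis by (simp add: ent_def)
qed

lemma ent_distr:
  assumes g: "g \<in> measurable M N" and X: "simple_function N X"
  shows "prob_space.ent (distr M N g) X = ent (\<lambda>\<omega>. X (g \<omega>))"
proof -
  interpret D: prob_space "distr M N g" by (rule prob_space_distr[OF g])
  have fin: "finite (X ` space N)" by (rule simple_functionD(1)[OF X])
  have pr: "D.pr X a = pr (\<lambda>\<omega>. X (g \<omega>)) a" for a
  proof -
    have "{\<omega> \<in> space N. X \<omega> = a} \<in> sets N"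
      using simple_functionD(2)[OF X, of "{a}"] by (simp add: vimage_def Int_def conj_commute)
    then have "D.pr X a = prob (g -` {\<omega> \<in> space N. X \<omega> = a} \<inter> space M)"
      unfolding D.pr_def by (simp add: measure_distr[OF g])
    also have "g -` {\<omega> \<in> space N. X \<omega> = a} \<inter> space M = {\<omega> \<in> space M. X (g \<omega>) = a}"
      using measurable_space[OF g] by auto
    finally show ?thesis by (simp add: pr_def)
  qed
  have "D.ent X = - (\<Sum>a\<in>X ` space N. D.pr X a * ln (D.pr X a))" by (simp add: D.ent_def)
  also have "\<dots> = ent (\<lambda>\<omega>. X (g \<omega>))"
    unfolding pr using measurable_space[OF g] by (intro ent_superset[symmetric] fin) auto
  finally show ?thesis .
qed

end

locale iid_blocks =
  fixes L :: "'l set" and p :: "'l \<Rightarrow> real"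
  assumes finite_L: "finite L" and p_nonneg: "\<And>w. w \<in> L \<Longrightarrow> p w \<ge> 0" and sum_p: "sum p L = 1"
begin

definition D :: "'l measure" where "D = point_measure L (\<lambda>w. ennreal (p w))"

definition \<Omega> :: "(nat \<Rightarrow> 'l) measure" where "\<Omega> = PiM UNIV (\<lambda>_. D)"

lemma space_D [simp]: "space D = L" by (simp add: D_def space_point_measure)

lemma sets_D [simp]: "sets D = Pow L" by (simp add: D_def sets_point_measure)

lemma prob_D: "prob_space D"
proof
  have "emeasure D (space D) = (\<Sum>w\<in>L. ennreal (p w))"
    unfolding space_D unfolding D_def using finite_L by (intro emeasure_point_measure_finite) auto
  also have "\<dots> = ennreal (sum p L)" using p_nonneg by (rule sum_ennreal)
  finally show "emeasure D (space D) = 1" by (simp add: sum_p)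
qed

lemma measure_D: "b \<in> L \<Longrightarrow> measure D {b} = p b"
proof -
  assume b: "b \<in> L"
  have "emeasure D {b} = ennreal (p b)"
    unfolding D_def using finite_L b by (subst emeasure_point_measure_finite) auto
  then show ?thesis using p_nonneg[OF b] by (simp add: measure_def)
qed

sublocale product: product_prob_space "\<lambda>_::nat. D" UNIV
proof -
  interpret D: prob_space D by (rule prob_D)
  show "product_prob_space (\<lambda>_::nat. D)"
    by (simp add: product_prob_space_def product_prob_space_axioms_def product_sigma_finite_def
        prob_D D.sigma_finite_measure_axioms)
qed

sublocale prob_space \<Omega>
  unfolding \<Omega>_def by (rule product.P.prob_space_axioms)

lemma space_\<Omega>: "space \<Omega> = {\<omega>. \<forall>j. \<omega> j \<in> L}"
  by (auto simp: \<Omega>_def space_PiM PiE_def)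

lemma prob_Collect:
  assumes J: "finite J" "\<And>i. i \<in> J \<Longrightarrow> A i \<subseteq> L"
  shows "prob {\<omega> \<in> space \<Omega>. \<forall>i\<in>J. \<omega> i \<in> A i} = (\<Prod>i\<in>J. measure D (A i))"
proof -
  have "emeasure \<Omega> {\<omega> \<in> space \<Omega>. \<forall>i\<in>J. \<omega> i \<in> A i} = (\<Prod>i\<in>J. emeasure D (A i))"
    unfolding \<Omega>_def using J by (intro product.emeasure_PiM_Collect) auto
  also have "\<dots> = ennreal (\<Prod>i\<in>J. measure D (A i))"
    by (simp add: product.M.emeasure_eq_measure prod_ennreal)
  finally show ?thesis by (simp add: emeasure_eq_measure prod_nonneg)
qed

lemma coord_measurable [measurable]: "(\<lambda>\<omega>. \<omega> j) \<in> measurable \<Omega> D"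
  unfolding \<Omega>_def by simp

lemma coord_simple: "simple_function \<Omega> (\<lambda>\<omega>. \<omega> j)"
  unfolding simple_function_def
proof (intro conjI ballI)
  show "finite ((\<lambda>\<omega>. \<omega> j) ` space \<Omega>)" by (rule finite_subset[OF _ finite_L]) (auto simp: space_\<Omega>)
  fix b assume "b \<in> (\<lambda>\<omega>. \<omega> j) ` space \<Omega>"
  then have "{b} \<in> sets D" by (auto simp: space_\<Omega>)
  then show "(\<lambda>\<omega>. \<omega> j) -` {b} \<inter> space \<Omega> \<in> sets \<Omega>" by (rule measurable_sets[OF coord_measurable])
qed

text \<open>The block with index \<open>0\<close> is left out: a phase shift may cut it.\<close>

definition blocks :: "nat \<Rightarrow> (nat \<Rightarrow> 'l) \<Rightarrow> 'l list" where
  "blocks r \<omega> = map (\<lambda>j. \<omega> (Suc j)) [0..<r]"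

lemma blocks_simple: "simple_function \<Omega> (blocks r)"
proof (induction r)
  case 0 then show ?case by (simp add: blocks_def[abs_def])
next
  case (Suc r)
  have "simple_function \<Omega> ((\<lambda>(l, a). l @ [a]) \<circ> (\<lambda>\<omega>. (blocks r \<omega>, \<omega> (Suc r))))"
    by (intro simple_function_compose simple_function_Pair Suc coord_simple)
  then show ?case by (simp add: o_def blocks_def[abs_def])
qed

lemma prob_coords:
  assumes "\<And>j. j < r \<Longrightarrow> l j \<in> L"
  shows "prob {\<omega> \<in> space \<Omega>. \<forall>j<r. \<omega> (Suc j) = l j} = (\<Prod>j<r. p (l j))"
proof -
  have eq: "{\<omega> \<in> space \<Omega>. \<forall>j<r. \<omega> (Suc j) = l j} = {\<omega> \<in> space \<Omega>. \<forall>i\<in>{1..r}. \<omega> i \<in> {l (i - 1)}}"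
    by (auto simp: Suc_le_eq) (metis Suc_le_eq Suc_pred)
  have "prob {\<omega> \<in> space \<Omega>. \<forall>i\<in>{1..r}. \<omega> i \<in> {l (i - 1)}} = (\<Prod>i\<in>{1..r}. measure D {l (i - 1)})"
    using assms by (intro prob_Collect) auto
  also have "\<dots> = (\<Prod>i\<in>{1..r}. p (l (i - 1)))" using assms by (intro prod.cong refl measure_D) auto
  also have "\<dots> = (\<Prod>j<r. p (l j))"
    by (rule prod.reindex_bij_witness[of _ Suc "\<lambda>i. i - 1"]) auto
  finally show ?thesis by (simp only: eq)
qed

lemma pr_blocks:
  "pr (blocks r) l = (if length l = r \<and> set l \<subseteq> L then (\<Prod>j<r. p (l ! j)) else 0)"
proof (cases "length l = r \<and> set l \<subseteq> L")
  case True
  then have "{\<omega> \<in> space \<Omega>. blocks r \<omega> = l} = {\<omega> \<in> space \<Omega>. \<forall>j<r. \<omega> (Suc j) = l ! j}"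
    by (auto simp: blocks_def list_eq_iff_nth_eq)
  moreover have "prob {\<omega> \<in> space \<Omega>. \<forall>j<r. \<omega> (Suc j) = l ! j} = (\<Prod>j<r. p (l ! j))"
    by (rule prob_coords) (use True in auto)
  ultimately show ?thesis using True by (simp add: pr_def)
next
  case False
  then have "l \<notin> blocks r ` space \<Omega>" by (auto simp: blocks_def space_\<Omega>)
  then show ?thesis using pr_eq_0[of l "blocks r"] False by auto
qed

lemma pr_coord: "pr (\<lambda>\<omega>. \<omega> j) b = (if b \<in> L then p b else 0)"
proof (cases "b \<in> L")
  case True
  have "{\<omega> \<in> space \<Omega>. \<omega> j = b} = {\<omega> \<in> space \<Omega>. \<forall>i\<in>{j}. \<omega> i \<in> {b}}" by auto
  also have "prob \<dots> = (\<Prod>i\<in>{j}. measure D {b})"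
    using True by (intro prob_Collect) auto
  finally show ?thesis using True by (simp add: pr_def measure_D)
next
  case False
  then have "b \<notin> (\<lambda>\<omega>. \<omega> j) ` space \<Omega>" by (auto simp: space_\<Omega>)
  then show ?thesis using pr_eq_0[of b "\<lambda>\<omega>. \<omega> j"] False by auto
qed

definition H1 :: real where "H1 = - (\<Sum>w\<in>L. p w * ln (p w))"

lemma ent_coord: "ent (\<lambda>\<omega>. \<omega> j) = H1"
proof -
  have "ent (\<lambda>\<omega>. \<omega> j) = - (\<Sum>b\<in>L. pr (\<lambda>\<omega>. \<omega> j) b * ln (pr (\<lambda>\<omega>. \<omega> j) b))"
    by (rule ent_superset[OF finite_L]) (auto simp: space_\<Omega>)
  then show ?thesis by (simp add: pr_coord H1_def cong: sum.cong)
qed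

lemma ent_blocks: "ent (blocks r) = real r * H1"
proof (induction r)
  case 0
  have "ent (blocks 0) \<le> ln (real (card {[] :: 'l list}))"
    by (rule ent_le_ln_card[OF blocks_simple]) (auto simp: blocks_def)
  then show ?case using ent_nonneg[of "blocks 0"] by simp
next
  case (Suc r)
  let ?P = "\<lambda>\<omega>. (blocks r \<omega>, \<omega> (Suc r))"
  have s: "simple_function \<Omega> ?P" by (intro simple_function_Pair blocks_simple coord_simple)
  have snoc: "blocks (Suc r) \<omega> = blocks r \<omega> @ [\<omega> (Suc r)]" for \<omega> by (simp add: blocks_def)
  have "ent (blocks (Suc r)) = ent ?P"
    by (rule ent_cong_factor[OF s blocks_simple, of _ "\<lambda>(l, a). l @ [a]" "\<lambda>l. (butlast l, last l)"])
      (auto simp: snoc)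
  also have "\<dots> = ent (blocks r) + ent (\<lambda>\<omega>. \<omega> (Suc r))"
  proof (rule ent_indep[OF blocks_simple coord_simple])
    fix l b
    have "pr ?P (l, b) = pr (blocks (Suc r)) (l @ [b])"
      unfolding pr_def by (rule arg_cong[of _ _ prob]) (auto simp: snoc)
    also have "\<dots> = pr (blocks r) l * pr (\<lambda>\<omega>. \<omega> (Suc r)) b"
      unfolding pr_blocks pr_coord by (auto simp: nth_append)
    finally show "pr ?P (l, b) = pr (blocks r) l * pr (\<lambda>\<omega>. \<omega> (Suc r)) b" .
  qed
  finally show ?case using Suc by (simp add: ent_coord algebra_simps)
qed

lemma expectation_coord: "integral\<^sup>L \<Omega> (\<lambda>\<omega>. v (\<omega> j)) = (\<Sum>w\<in>L. p w * v w)" for v :: "'l \<Rightarrow> real"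
proof -
  have "integral\<^sup>L \<Omega> (\<lambda>\<omega>. v (\<omega> j)) = integral\<^sup>L (distr \<Omega> D (\<lambda>\<omega>. \<omega> j)) v"
    by (rule integral_distr[symmetric, OF coord_measurable]) (simp add: D_def)
  also have "distr \<Omega> D (\<lambda>\<omega>. \<omega> j) = D" unfolding \<Omega>_def by (rule product.PiM_component) simp
  also have "integral\<^sup>L D v = (\<Sum>w\<in>L. p w * v w)"
  proof -
    have "D = point_measure L (\<lambda>w. ennreal (p w))" by (simp add: D_def)
    also have "integral\<^sup>L \<dots> v = (\<Sum>w\<in>L. p w *\<^sub>R v w)"
      using finite_L p_nonneg by (rule lebesgue_integral_point_measure_finite)
    finally show ?thesis by simp
  qed
  finally show ?thesis .
qed

definition shift_blocks :: "(nat \<Rightarrow> 'l) \<Rightarrow> nat \<Rightarrow> 'l" where "shift_blocks \<omega> = (\<lambda>n. \<omega> (Suc n))"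

lemma shift_blocks_measurable: "shift_blocks \<in> measurable \<Omega> \<Omega>"
proof -
  have "(\<lambda>\<omega>. \<lambda>n\<in>UNIV. \<omega> (Suc n)) \<in> measurable \<Omega> (PiM UNIV (\<lambda>_. D))"
    by (intro measurable_restrict coord_measurable)
  then show ?thesis by (simp add: \<Omega>_def shift_blocks_def[abs_def] restrict_UNIV)
qed

lemma distr_shift_blocks: "distr \<Omega> \<Omega> shift_blocks = \<Omega>"
proof -
  have "distr (PiM UNIV (\<lambda>_. D)) (\<Pi>\<^sub>M i\<in>(UNIV::nat set). D) (\<lambda>\<omega>. \<lambda>n\<in>UNIV. \<omega> (Suc n)) = (\<Pi>\<^sub>M i\<in>(UNIV::nat set). D)"
    by (rule distr_PiM_reindex[where f = Suc]) (auto intro: prob_D)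
  then show ?thesis by (simp add: \<Omega>_def shift_blocks_def[abs_def] restrict_UNIV)
qed

end

section \<open>The measure generated by the loops at a symbol\<close>

lemma cat_shift: "q \<ge> 1 \<Longrightarrow> cat q (\<lambda>n. \<omega> (Suc n)) = (shift_map ^^ q) (cat q \<omega>)"
  by (auto simp: cat_def shift_map_funpow)

context factor_system
begin

lemma loop_cat:
  assumes q: "q \<ge> 1" and per: "(shift_map ^^ q) y = y" and \<omega>: "\<And>j. \<omega> j \<in> loops X \<Phi> q y a"
  shows "cat q \<omega> \<in> X" "\<pi> (cat q \<omega>) = y"
proof -
  have l: "\<omega> j \<in> words X" "length (\<omega> j) = q" "map \<Phi> (\<omega> j) = word_at y 0 q" "hd (\<omega> j) = a" "edge X (last (\<omega> j)) a" for j
    using \<omega>[of j] fibre_wordsD[of "\<omega> j" q y] by (auto simp: loops_def)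
  show c: "cat q \<omega> \<in> X"
    using l by (intro cat_in_sft[OF sft q] successively_words) auto
  show "\<pi> (cat q \<omega>) = y"
  proof
    fix i
    have m: "i mod q < q" using q by simp
    have "\<pi> (cat q \<omega>) i = \<Phi> (\<omega> (i div q) ! (i mod q))" by (simp add: pi_nth[OF c] cat_def)
    also have "\<dots> = map \<Phi> (\<omega> (i div q)) ! (i mod q)" using l(2) m by simp
    also have "\<dots> = y (i mod q)" unfolding l(3) using m by (simp add: word_at_nth)
    also have "\<dots> = ((shift_map ^^ (i div q * q)) y) (i mod q)"
      using funpow_mult_fixpoint[OF per, of "i div q"] by simp
    also have "\<dots> = y i" by (simp add: shift_map_funpow)
    finally show "\<pi> (cat q \<omega>) i = y i" .
  qed
qed

text \<open>Concatenating independent loops at \<open>a\<close>, chosen with probabilities proportional to their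
  weights, gives a measure over the orbit of \<open>y\<close> whose free energy is at least the growth rate of
  the total weight of the loops, up to \<open>ln K / q\<close>: the Bowen property compares the sums of \<open>f\<close> along a sample
  with the weights of its blocks.\<close>

lemma loop_measure:
  assumes y: "y \<in> Y" "(shift_map ^^ q) y = y" and q: "q \<ge> 1" and ne: "loops X \<Phi> q y a \<noteq> {}"
  obtains \<mu> where "\<mu> \<in> invariant_measures X"
    "ereal ((ln (Z q y a) - ln K) / real q) \<le> ks_entropy \<mu> shift_map + ereal (integral\<^sup>L \<mu> f)"
    "\<And>g b. g \<in> borel_measurable (restrict_space borel Y) \<Longrightarrow> (\<And>z. z \<in> Y \<Longrightarrow> \<bar>g z\<bar> \<le> b) \<Longrightarrow>
      integral\<^sup>L \<mu> (\<lambda>x. g (\<pi> x)) = birkhoff_sum q g y / real q"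
proof -
  let ?L = "loops X \<Phi> q y a" and ?Z = "Z q y a"
  have Z: "?Z > 0" by (rule Z_pos[OF ne])
  interpret iid_blocks ?L "\<lambda>w. W w / ?Z"
  proof
    show "(\<Sum>w\<in>?L. W w / ?Z) = 1" using Z by (simp add: sum_divide_distrib[symmetric])
  qed (use Z weight_pos[OF loops_words] in \<open>auto intro: less_imp_le\<close>)
  have cat_X: "cat q \<omega> \<in> X" "\<pi> (cat q \<omega>) = y" if "\<omega> \<in> space \<Omega>" for \<omega>
    using loop_cat[OF q y(2), of \<omega> a] that by (auto simp: space_\<Omega>)
  have cat_meas: "cat q \<in> measurable \<Omega> (restrict_space borel X)"
  proof (rule measurable_restrict_space2)
    show "cat q \<in> space \<Omega> \<rightarrow> X" using cat_X by auto
    show "cat q \<in> borel_measurable \<Omega>"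
    proof (rule measurable_coordinatewise_then_product)
      fix i
      have "simple_function \<Omega> ((\<lambda>u. u ! (i mod q)) \<circ> (\<lambda>\<omega>. \<omega> (i div q)))"
        by (intro simple_function_compose coord_simple)
      then have "simple_function \<Omega> (\<lambda>\<omega>. cat q \<omega> i)" by (simp add: o_def cat_def)
      then show "(\<lambda>\<omega>. cat q \<omega> i) \<in> borel_measurable \<Omega>" by (rule borel_measurable_simple_function)
    qed
  qed
  interpret phase_average \<Omega> X shift_blocks "cat q" q
    by unfold_locales
      (use subshift_X q shift_blocks_measurable distr_shift_blocks cat_meas cat_shift[OF q] in \<open>auto simp: shift_blocks_def\<close>)
  interpret base: prob_space base by (rule prob_base)
  interpret av: shift_system average X
    using average_invariant subshift_X prob_average
    by (simp add: shift_system_def mp_system_def mp_system_axioms_def shift_system_axioms_def invariant_measures_def)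
  let ?wd = "\<lambda>n x. word_at x 0 n"
  have R: "simple_function (restrict_space borel X) (?wd n)" for n
  proof -
    have "simple_function average (?wd n) \<longleftrightarrow> simple_function (restrict_space borel X) (?wd n)"
      by (rule simple_function_cong_algebra) (simp_all add: space_restrict_space)
    then show ?thesis using av.wd_simple[of n] by blast
  qed
  have ent_av: "av.ent (?wd n) = base.ent (\<lambda>p. ?wd n (point p))" for n
    unfolding average_def by (rule base.ent_distr[OF point_measurable R])
  have snd_meas: "snd \<in> measurable base \<Omega>" unfolding base_def by simp
  have distr_snd: "distr base \<Omega> snd = \<Omega>"
  proof (rule measure_eqI)
    fix A assume "A \<in> sets (distr base \<Omega> snd)"
    then have A: "A \<in> sets \<Omega>" by simp
    have "base.prob (snd -` A \<inter> space base) = integral\<^sup>L base (\<lambda>p. indicator A (snd p))"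
    proof -
      have "integral\<^sup>L base (\<lambda>p. indicator A (snd p) :: real) = integral\<^sup>L base (indicator (snd -` A \<inter> space base))"
        by (rule Bochner_Integration.integral_cong) (auto simp: indicator_def)
      then show ?thesis by simp
    qed
    also have "\<dots> = (\<Sum>i<q. integral\<^sup>L \<Omega> (\<lambda>\<omega>. indicator A (snd (i, \<omega>)))) / real q"
      by (rule integral_base[of _ 1])
        (auto intro: measurable_compose[OF snd_meas borel_measurable_indicator[OF A]])
    also have "\<dots> = prob A" using q sets.sets_into_space[OF A] by (simp add: Int_absorb2)
    finally have "base.prob (snd -` A \<inter> space base) = prob A" .
    then show "emeasure (distr base \<Omega> snd) A = emeasure \<Omega> A"
      using A snd_meas by (simp add: emeasure_distr base.emeasure_eq_measure emeasure_eq_measure)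
  qed simp
  have ent_bl: "base.ent (\<lambda>p. blocks r (snd p)) = real r * H1" for r
    using base.ent_distr[OF snd_meas blocks_simple, of r] by (simp add: distr_snd ent_blocks)
  have fst_simple: "simple_function base fst"
    unfolding simple_function_def
  proof (intro conjI ballI)
    show "finite (fst ` space base)" by (rule finite_subset[of _ "{..<q}"]) (auto simp: space_base split: if_splits)
    fix i assume "i \<in> fst ` space base"
    then have i: "{i} \<in> sets (uniform_count_measure {..<q})" by (auto simp: space_base sets_uniform_count_measure split: if_splits)
    show "fst -` {i} \<inter> space base \<in> sets base"
      using measurable_sets[OF measurable_fst i, of \<Omega>] by (simp add: base_def)
  qed
  have wd_simple': "simple_function base (\<lambda>p. ?wd n (point p))" for n
    unfolding simple_function_def
  proof (intro conjI ballI)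
    have "(\<lambda>p. ?wd n (point p)) ` space base \<subseteq> words_of_length X n"
      using measurable_space[OF point_measurable] by (auto simp: X_words_eq space_restrict_space)
    then show "finite ((\<lambda>p. ?wd n (point p)) ` space base)"
      by (rule finite_subset) (rule finite_words_of_length(1)[OF subshift_X])
    fix u
    have "?wd n -` {u} \<inter> space (restrict_space borel X) \<in> sets (restrict_space borel X)"
      by (rule simple_functionD(2)[OF R])
    from measurable_sets[OF point_measurable this]
    show "(\<lambda>p. ?wd n (point p)) -` {u} \<inter> space base \<in> sets base"
      using measurable_space[OF point_measurable] by (simp add: vimage_def Int_def conj_commute) (metis (no_types, lifting) Collect_cong)
  qed
  (* The word of length n seen from phase i, together with i, determines the blocks 1, ..., r; knowing i costs at most ln q. *)
  have ent_lower: "real r * H1 - ln (real q) \<le> av.ent (?wd n)" if r: "Suc r * q \<le> n" for r n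
  proof -
    let ?U = "\<lambda>p. ?wd n (point p)"
    have s: "simple_function base (\<lambda>p. (?U p, fst p))" by (rule simple_function_Pair[OF wd_simple' fst_simple])
    have "base.ent (\<lambda>p. blocks r (snd p)) \<le> base.ent (\<lambda>p. (?U p, fst p))"
    proof (rule base.ent_mono[where g = "\<lambda>(u, i). map (\<lambda>j. take q (drop (Suc j * q - i) u)) [0..<r]", OF s])
      fix p assume "p \<in> space base"
      then obtain i \<omega> where p: "p = (i, \<omega>)" "i < q" "\<omega> \<in> space \<Omega>" by (auto simp: space_base)
      have "\<omega> (Suc j) = take q (drop (Suc j * q - i) (?wd n (point p)))" if j: "j < r" for j
      proof (rule nth_equalityI)
        have len: "length (\<omega> (Suc j)) = q" 
        proof -
          have "\<omega> (Suc j) \<in> ?L" using p(3) by (simp add: space_\<Omega>)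
          then show ?thesis using loops_FW fibre_wordsD(2) by blast
        qed
        have "Suc (Suc j) * q \<le> Suc r * q" using j by (intro mult_le_mono1) simp
        then have le: "Suc j * q + q \<le> n" using r by simp
        have ij: "i \<le> Suc j * q" using p(2) by simp
        show "length (\<omega> (Suc j)) = length (take q (drop (Suc j * q - i) (?wd n (point p))))"
          using len le by simp
        fix t assume "t < length (\<omega> (Suc j))"
        then have t: "t < q" using len by simp
        have "take q (drop (Suc j * q - i) (?wd n (point p))) ! t = ?wd n (point p) ! (Suc j * q - i + t)"
          using t le by simp
        also have "\<dots> = point p (Suc j * q - i + t)" using t le by (subst word_at_nth) auto
        also have "\<dots> = cat q \<omega> (Suc j * q + t)" using ij by (simp add: point_def p(1) shift_map_funpow)
        also have "\<dots> = \<omega> (Suc j) ! t"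
        proof -
          have "(Suc j * q + t) div q = Suc j" "(Suc j * q + t) mod q = t"
            using t by (simp_all del: mult_Suc)
          then show ?thesis by (simp only: cat_def)
        qed
        finally show "\<omega> (Suc j) ! t = take q (drop (Suc j * q - i) (?wd n (point p))) ! t" ..
      qed
      then show "blocks r (snd p) = (case (?U p, fst p) of (u, i) \<Rightarrow> map (\<lambda>j. take q (drop (Suc j * q - i) u)) [0..<r])"
        by (simp add: p(1) blocks_def)
    qed
    also have "\<dots> \<le> base.ent ?U + base.ent fst" by (rule base.ent_subadditive[OF wd_simple' fst_simple])
    also have "base.ent fst \<le> ln (real (card {..<q}))"
      by (rule base.ent_le_ln_card[OF fst_simple]) (auto simp: space_base)
    finally show ?thesis by (simp add: ent_bl ent_av)
  qed
  have H1_nonneg: "H1 \<ge> 0" using ent_nonneg[of "\<lambda>\<omega>. \<omega> 0"] by (simp add: ent_coord)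
  (* A word of length n contains at least n div q - 1 complete blocks with index at least 1, whatever its phase; this costs the constant 2 * H1. *)
  have ks: "ereal (H1 / real q) \<le> ks_entropy average shift_map"
  proof (rule av.ks_entropy_ge)
    fix n
    let ?d = "n div q"
    have "real n \<le> (real ?d + 1) * real q"
    proof -
      have "n < Suc ?d * q" using q dividend_less_times_div[of q n] by (simp add: mult.commute)
      then have "real n \<le> real (Suc ?d * q)" by (simp only: of_nat_le_iff less_imp_le)
      then show ?thesis by (simp add: algebra_simps)
    qed
    then have "real n * (H1 / real q) \<le> ((real ?d + 1) * real q) * (H1 / real q)"
      using H1_nonneg by (intro mult_right_mono) auto
    also have "\<dots> = (real ?d + 1) * H1" using q by simp
    finally have 1: "real n * (H1 / real q) \<le> (real ?d + 1) * H1" .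
    show "real n * (H1 / real q) - (2 * H1 + ln (real q)) \<le> av.ent (?wd n)"
    proof (cases "?d = 0")
      case True
      have "0 \<le> ln (real q)" using q by simp
      with 1 True H1_nonneg av.ent_nonneg[of "?wd n"] show ?thesis by simp
    next
      case False
      then obtain r where r: "?d = Suc r" by (cases ?d) auto
      have "Suc r * q \<le> n" using r by (metis div_times_less_eq_dividend)
      from ent_lower[OF this] 1 r show ?thesis by (simp add: algebra_simps)
    qed
  qed
  have f_meas: "f \<in> borel_measurable (restrict_space borel X)"
    by (rule borel_measurable_continuous_on_restrict[OF cont_f])
  have int_f: "(\<Sum>w\<in>?L. W w / ?Z * (ln (W w) - ln K)) / real q \<le> integral\<^sup>L average f"
  proof -
    have S_meas: "(\<lambda>\<omega>. birkhoff_sum q f (cat q \<omega>)) \<in> borel_measurable \<Omega>"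
      unfolding birkhoff_sum_def
      by (intro borel_measurable_sum measurable_compose[OF measurable_compose[OF cat_meas shift_measurable[OF subshift_X]] f_meas])
    have int1: "integrable \<Omega> (\<lambda>\<omega>. ln (W (\<omega> 0)) - ln K)"
    proof -
      have s: "simple_function \<Omega> ((\<lambda>w. ln (W w) - ln K) \<circ> (\<lambda>\<omega>. \<omega> 0))"
        by (intro simple_function_compose coord_simple)
      then have "(\<lambda>\<omega>. ln (W (\<omega> 0)) - ln K) \<in> borel_measurable \<Omega>"
        using borel_measurable_simple_function[OF s] by (simp add: o_def)
      then show ?thesis
      proof (rule integrable_const_bound[where B = "Max ((\<lambda>w. \<bar>ln (W w) - ln K\<bar>) ` ?L)", rotated])
        show "AE \<omega> in \<Omega>. norm (ln (W (\<omega> 0)) - ln K) \<le> Max ((\<lambda>w. \<bar>ln (W w) - ln K\<bar>) ` ?L)"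
          by (rule AE_I2) (auto simp: space_\<Omega> intro!: Max_ge)
      qed
    qed
    have int2: "integrable \<Omega> (\<lambda>\<omega>. birkhoff_sum q f (cat q \<omega>))"
      by (rule integrable_const_bound[where B = "real q * B", OF _ S_meas], rule AE_I2)
        (auto intro: S_bounded cat_X(1))
    have "(\<Sum>w\<in>?L. W w / ?Z * (ln (W w) - ln K)) = integral\<^sup>L \<Omega> (\<lambda>\<omega>. ln (W (\<omega> 0)) - ln K)"
      by (rule expectation_coord[symmetric])
    also have "\<dots> \<le> integral\<^sup>L \<Omega> (\<lambda>\<omega>. birkhoff_sum q f (cat q \<omega>))"
    proof (rule integral_mono[OF int1 int2])
      fix \<omega> assume \<omega>: "\<omega> \<in> space \<Omega>"
      then have w: "\<omega> 0 \<in> ?L" by (simp add: space_\<Omega>)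
      have len: "length (\<omega> 0) = q" using w by (auto simp: loops_def dest: fibre_wordsD(2))
      have "cat q \<omega> \<in> cylinder X (\<omega> 0)"
        using cat_X(1)[OF \<omega>] len by (auto simp: in_cylinder_iff cat_def)
      from weight_le[OF this] have "W (\<omega> 0) \<le> K * exp (birkhoff_sum q f (cat q \<omega>))" by (simp add: len)
      then have "ln (W (\<omega> 0)) \<le> ln (K * exp (birkhoff_sum q f (cat q \<omega>)))"
        using weight_pos[OF loops_words[OF w]] by (intro ln_mono) auto
      then show "ln (W (\<omega> 0)) - ln K \<le> birkhoff_sum q f (cat q \<omega>)" using K1 by (simp add: ln_mult)
    qed
    finally have "(\<Sum>w\<in>?L. W w / ?Z * (ln (W w) - ln K)) / real q
      \<le> integral\<^sup>L \<Omega> (\<lambda>\<omega>. birkhoff_sum q f (cat q \<omega>)) / real q" by (rule divide_right_mono) simp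
    also have "\<dots> = integral\<^sup>L average f" by (rule integral_average[symmetric, OF f_meas]) (rule B)
    finally show ?thesis .
  qed
  have p1: "(\<Sum>w\<in>?L. W w / ?Z) = 1" using sum_p .
  (* Equality case of Gibbs' inequality: the block probabilities are proportional to the weights. *)
  have "H1 + (\<Sum>w\<in>?L. W w / ?Z * (ln (W w) - ln K)) = (\<Sum>w\<in>?L. W w / ?Z * (ln (W w) - ln K - ln (W w / ?Z)))"
    unfolding H1_def by (simp add: sum_subtractf[symmetric] right_diff_distrib)
  also have "\<dots> = (\<Sum>w\<in>?L. W w / ?Z * (ln ?Z - ln K))"
    using Z weight_pos[OF loops_words] by (intro sum.cong refl) (simp add: ln_div)
  also have "\<dots> = ln ?Z - ln K" using p1 by (simp only: sum_distrib_right[symmetric]) simp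
  finally have free: "H1 + (\<Sum>w\<in>?L. W w / ?Z * (ln (W w) - ln K)) = ln ?Z - ln K" .
  show ?thesis
  proof (rule that[OF average_invariant])
    have "(ln ?Z - ln K) / real q = H1 / real q + (\<Sum>w\<in>?L. W w / ?Z * (ln (W w) - ln K)) / real q"
      by (simp only: free[symmetric] add_divide_distrib)
    also have "\<dots> \<le> H1 / real q + integral\<^sup>L average f" using int_f by simp
    finally have "ereal ((ln ?Z - ln K) / real q) \<le> ereal (H1 / real q) + ereal (integral\<^sup>L average f)" by simp
    also have "\<dots> \<le> ks_entropy average shift_map + ereal (integral\<^sup>L average f)"
      by (intro add_right_mono ks)
    finally show "ereal ((ln ?Z - ln K) / real q) \<le> ks_entropy average shift_map + ereal (integral\<^sup>L average f)" .
    fix g :: "seq \<Rightarrow> real" and b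
    assume g: "g \<in> borel_measurable (restrict_space borel Y)" "\<And>z. z \<in> Y \<Longrightarrow> \<bar>g z\<bar> \<le> b"
    have pim: "\<pi> \<in> measurable (restrict_space borel X) (restrict_space borel Y)"
    proof (rule measurable_restrict_space2)
      show "\<pi> \<in> borel_measurable (restrict_space borel X)"
        using fac by (intro borel_measurable_continuous_on_restrict) (simp add: factor_map_def)
    qed (auto simp: space_restrict_space intro: pi_in)
    have "integral\<^sup>L average (\<lambda>x. g (\<pi> x)) = integral\<^sup>L \<Omega> (\<lambda>\<omega>. birkhoff_sum q (\<lambda>x. g (\<pi> x)) (cat q \<omega>)) / real q"
      by (rule integral_average[of _ b]) (auto intro: measurable_compose[OF pim g(1)] g(2) pi_in)
    also have "integral\<^sup>L \<Omega> (\<lambda>\<omega>. birkhoff_sum q (\<lambda>x. g (\<pi> x)) (cat q \<omega>)) = integral\<^sup>L \<Omega> (\<lambda>\<omega>. birkhoff_sum q g y)"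
      using cat_X by (intro Bochner_Integration.integral_cong refl) (simp add: birkhoff_sum_def pi_funpow)
    also have "\<dots> = birkhoff_sum q g y" by (simp add: prob_space)
    finally show "integral\<^sup>L average (\<lambda>x. g (\<pi> x)) = birkhoff_sum q g y / real q" .
  qed
qed

end

section \<open>Compensation functions\<close>

lemma continuous_on_word_function:
  "continuous_on S (\<lambda>z::seq. g (word_at z 0 n) :: real)"
  unfolding continuous_on_def
proof (intro ballI tendsto_eventually)
  fix z
  have "\<forall>\<^sub>F x in at z within S. x \<in> {x. \<forall>i<n. x i = z i}"
    by (rule eventually_at_topological[THEN iffD2]) (use open_seq_cylinder[of n z] in blast)
  then show "\<forall>\<^sub>F x in at z within S. g (word_at x 0 n) = g (word_at z 0 n)"
    by (rule eventually_mono) (auto intro!: arg_cong[of _ _ g] simp: word_at_eq_iff)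
qed

lemma sum_UN_le:
  fixes g :: "'b \<Rightarrow> real"
  assumes "finite I" "\<And>i. i \<in> I \<Longrightarrow> finite (A i)" "\<And>i x. i \<in> I \<Longrightarrow> x \<in> A i \<Longrightarrow> 0 \<le> g x"
  shows "sum g (\<Union>i\<in>I. A i) \<le> (\<Sum>i\<in>I. sum g (A i))"
  using assms
proof (induction I)
  case (insert i I)
  have "sum g (A i \<union> (\<Union>i\<in>I. A i)) = sum g (A i) + sum g (\<Union>i\<in>I. A i) - sum g (A i \<inter> (\<Union>i\<in>I. A i))"
    using insert.prems insert.hyps by (intro sum_Un) auto
  moreover have "sum g (A i \<inter> (\<Union>i\<in>I. A i)) \<ge> 0" using insert.prems by (intro sum_nonneg) auto
  moreover have "sum g (\<Union>i\<in>I. A i) \<le> (\<Sum>i\<in>I. sum g (A i))" using insert by auto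
  ultimately show ?case using insert.hyps by simp
qed simp

lemma shift_systemI:
  "\<mu> \<in> invariant_measures X \<Longrightarrow> subshift X \<Longrightarrow> shift_system \<mu> X"
  by (simp add: shift_system_def mp_system_def mp_system_axioms_def shift_system_axioms_def invariant_measures_def)

context factor_system
begin

definition orbit_words :: "nat \<Rightarrow> seq \<Rightarrow> nat \<Rightarrow> nat list set" where
  "orbit_words q y n = (\<lambda>i. word_at y i n) ` {..<q}"

text \<open>To isolate one periodic orbit in a variational identity, a potential charges \<open>t\<close> to every word of length \<open>n\<close>
  that is not a word of the orbit. It vanishes on the orbit. With \<open>n\<close> fixed and \<open>t\<close> large, partition sums over all
  words of length \<open>n\<close> reduce to sums over the at most \<open>q\<close> words of the orbit.\<close>

definition penalty :: "nat \<Rightarrow> seq \<Rightarrow> nat \<Rightarrow> real \<Rightarrow> seq \<Rightarrow> real" where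
  "penalty q y n t z = (if word_at z 0 n \<in> orbit_words q y n then 0 else - t)"

lemma penalty_continuous: "continuous_on S (penalty q y n t)"
  unfolding penalty_def[abs_def]
  by (rule continuous_on_word_function[of S "\<lambda>u. if u \<in> orbit_words q y n then 0 else - t" n])

lemma penalty_orbit:
  assumes "(shift_map ^^ q) y = y" "q \<ge> 1"
  shows "penalty q y n t ((shift_map ^^ i) y) = 0"
proof -
  have "word_at ((shift_map ^^ i) y) 0 n = word_at ((shift_map ^^ (i mod q)) y) 0 n"
    using funpow_mod_eq[OF assms(1), of i] by simp
  also have "\<dots> = word_at y (i mod q) n" by (simp add: word_at_funpow)
  finally show ?thesis using assms(2) by (simp add: penalty_def orbit_words_def)
qed

text \<open>All terms are nonpositive, and the first one alone already contains the charge.\<close>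

lemma penalty_sum_le:
  assumes "t \<ge> 0" "n \<ge> 1"
  shows "birkhoff_sum n (penalty q y n t) z \<le> penalty q y n t z"
proof -
  have "birkhoff_sum n (penalty q y n t) z
    = penalty q y n t ((shift_map ^^ 0) z) + (\<Sum>i\<in>{..<n} - {0}. penalty q y n t ((shift_map ^^ i) z))"
    unfolding birkhoff_sum_def using assms(2) by (intro sum.remove) auto
  moreover have "(\<Sum>i\<in>{..<n} - {0}. penalty q y n t ((shift_map ^^ i) z)) \<le> 0"
    using assms(1) by (intro sum_nonpos) (simp add: penalty_def)
  ultimately show ?thesis by simp
qed

lemma penalty_bound: "t \<ge> 0 \<Longrightarrow> \<bar>penalty q y n t z\<bar> \<le> t"
  by (simp add: penalty_def)

abbreviation "free_Y \<phi> \<equiv> (SUP \<nu> \<in> invariant_measures Y. ks_entropy \<nu> shift_map + ereal (\<integral>y. \<phi> y \<partial>\<nu>))"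

text \<open>The measure on the orbit pays nothing.\<close>

lemma free_penalty_nonneg:
  assumes y: "y \<in> Y" "(shift_map ^^ q) y = y" and q: "q \<ge> 1" and t: "t \<ge> 0"
  shows "0 \<le> free_Y (penalty q y n t)"
proof -
  obtain \<nu> where \<nu>: "\<nu> \<in> invariant_measures Y" "\<And>(F :: seq \<Rightarrow> real) B. F \<in> borel_measurable (restrict_space borel Y) \<Longrightarrow>
      (\<And>x. x \<in> Y \<Longrightarrow> \<bar>F x\<bar> \<le> B) \<Longrightarrow> integral\<^sup>L \<nu> F = birkhoff_sum q F y / real q"
    by (rule periodic_orbit_measure[OF subshift_Y y q]) blast
  interpret shift_system \<nu> Y by (rule shift_systemI[OF \<nu>(1) subshift_Y])
  have "integral\<^sup>L \<nu> (penalty q y n t) = birkhoff_sum q (penalty q y n t) y / real q"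
    using t by (intro \<nu>(2)[of _ t] borel_measurable_continuous_on_restrict penalty_continuous) (simp add: penalty_bound)
  then have "integral\<^sup>L \<nu> (penalty q y n t) = 0"
    by (simp add: birkhoff_sum_def penalty_orbit[OF y(2) q])
  then have "0 \<le> ks_entropy \<nu> shift_map + ereal (integral\<^sup>L \<nu> (penalty q y n t))"
    using ks_entropy_nonneg by simp
  also have "\<dots> \<le> free_Y (penalty q y n t)" by (rule SUP_upper[OF \<nu>(1)])
  finally show ?thesis .
qed

text \<open>Here \<open>t = n ln k'\<close> is chosen so that the at most \<open>k'\<^sup>n\<close> words outside the orbit contribute at most \<open>1\<close> to
  the partition sum.\<close>

lemma free_penalty_le:
  assumes q: "q \<ge> 1" and n: "n \<ge> 1"
  obtains t where "t \<ge> 0" "free_Y (penalty q y n t) \<le> ereal (ln (real q + 1) / real n)"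
proof -
  obtain k' where k': "k' \<ge> 1" "\<And>x i. x \<in> Y \<Longrightarrow> x i \<in> {1..k'}" by (rule subshift_bound[OF subshift_Y]) blast
  define t where "t = real n * ln (real k')"
  have t0: "t \<ge> 0" using k'(1) by (simp add: t_def)
  have et: "exp (- t) * real k' ^ n = 1"
  proof -
    have "exp t = real k' ^ n" unfolding t_def exp_of_nat_mult using k'(1) by simp
    then show ?thesis using k'(1) by (simp add: exp_minus)
  qed
  let ?G = "\<lambda>u. if u \<in> orbit_words q y n then 0 else - t"
  let ?S = "words_of_length Y n"
  have fin: "finite ?S" by (rule finite_words_of_length(1)[OF subshift_Y])
  have O: "finite (orbit_words q y n)" "card (orbit_words q y n) \<le> q"
    unfolding orbit_words_def using card_image_le[of "{..<q}"] by auto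
  have card: "real (card ?S) \<le> real k' ^ n"
  proof -
    have "card ?S \<le> k' ^ n" by (rule finite_words_of_length(2)[OF subshift_Y]) (rule k'(2))
    then have "real (card ?S) \<le> real (k' ^ n)" by (simp only: of_nat_le_iff)
    then show ?thesis by simp
  qed
  have sum_le: "(\<Sum>u\<in>?S. exp (?G u)) \<le> real q + 1"
  proof -
    have "(\<Sum>u\<in>?S. exp (?G u)) \<le> (\<Sum>u\<in>?S. (if u \<in> orbit_words q y n then 1 else 0) + exp (- t))"
      by (intro sum_mono) auto
    also have "\<dots> = real (card (?S \<inter> orbit_words q y n)) + real (card ?S) * exp (- t)"
      using fin by (simp add: sum.distrib sum.If_cases Int_def)
    also have "real (card (?S \<inter> orbit_words q y n)) \<le> real q"
      using card_mono[of "orbit_words q y n" "?S \<inter> orbit_words q y n"] O by (simp add: order_trans)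
    also have "real (card ?S) * exp (- t) \<le> real k' ^ n * exp (- t)" using card by (intro mult_right_mono) auto
    also have "\<dots> = 1" using et by (simp add: mult.commute)
    finally show ?thesis by simp
  qed
  have "ks_entropy \<nu> shift_map + ereal (integral\<^sup>L \<nu> (penalty q y n t)) \<le> ereal (ln (real q + 1) / real n)"
    if \<nu>: "\<nu> \<in> invariant_measures Y" for \<nu>
  proof -
    interpret shift_system \<nu> Y by (rule shift_systemI[OF \<nu> subshift_Y])
    have m: "penalty q y n t \<in> borel_measurable \<nu>"
      using borel_measurable_continuous_on_restrict[OF penalty_continuous[where S = Y and q = q and y = y and n = n and t = t]] sets_M
      by (simp cong: measurable_cong_sets)
    have "ks_entropy \<nu> shift_map + ereal (integral\<^sup>L \<nu> (penalty q y n t)) \<le> ereal (ln (\<Sum>u\<in>?S. exp (?G u)) / real n)"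
    proof (rule free_energy_le[OF m _ n, of t])
      show "\<bar>penalty q y n t x\<bar> \<le> t" for x using t0 by (rule penalty_bound)
      show "birkhoff_sum n (penalty q y n t) x \<le> ?G (word_at x 0 n)" for x
        using penalty_sum_le[OF t0 n, of q y x] by (simp add: penalty_def)
    qed
    also have "ln (\<Sum>u\<in>?S. exp (?G u)) / real n \<le> ln (real q + 1) / real n"
    proof (rule divide_right_mono)
      have "?S \<noteq> {}" using wd_words[of n] not_empty by auto
      then have "(\<Sum>u\<in>?S. exp (?G u)) > 0" using fin by (intro sum_pos) auto
      then show "ln (\<Sum>u\<in>?S. exp (?G u)) \<le> ln (real q + 1)" using sum_le by (intro ln_mono) auto
    qed simp
    finally show ?thesis by simp
  qed
  then have "free_Y (penalty q y n t) \<le> ereal (ln (real q + 1) / real n)" by (rule SUP_least)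
  with t0 show ?thesis by (rule that)
qed

lemma pi_measurable: "\<pi> \<in> measurable (restrict_space borel X) (restrict_space borel Y)"
proof (rule measurable_restrict_space2)
  show "\<pi> \<in> borel_measurable (restrict_space borel X)"
    using fac by (intro borel_measurable_continuous_on_restrict) (simp add: factor_map_def)
qed (auto simp: space_restrict_space intro: pi_in)

lemma X_integrable:
  fixes g :: "seq \<Rightarrow> real"
  assumes \<mu>: "\<mu> \<in> invariant_measures X" and g: "g \<in> borel_measurable (restrict_space borel X)" "\<And>x. x \<in> X \<Longrightarrow> \<bar>g x\<bar> \<le> b"
  shows "integrable \<mu> g"
proof -
  interpret shift_system \<mu> X by (rule shift_systemI[OF \<mu> subshift_X])
  show ?thesis
  proof (rule integrable_const_bound[of _ b])
    show "g \<in> borel_measurable \<mu>" using g(1) sets_M by (simp cong: measurable_cong_sets)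
    show "AE x in \<mu>. norm (g x) \<le> b" by (rule AE_I2) (use g(2) space_M in auto)
  qed
qed

text \<open>The measure generated by the loops lives over the orbit of \<open>y\<close>, so it is a competitor on the \<open>X\<close> side that
  pays no penalty, while the \<open>Y\<close> side is at most \<open>ln (q + 1) / n\<close>. Letting \<open>n\<close> grow gives the bound.\<close>

lemma loop_sum_upper_if_compensation:
  assumes y: "y \<in> Y" "(shift_map ^^ q) y = y" and q: "q \<ge> 1" and h: "continuous_on Y h"
    and comp: "compensation_function X Y \<pi> (\<lambda>x. f x - h (\<pi> x))" and lp: "loops X \<Phi> q y a \<noteq> {}"
  shows "ln (Z q y a) \<le> birkhoff_sum q h y + 2 * ln K"
proof -
  obtain \<mu> where \<mu>: "\<mu> \<in> invariant_measures X"
    "ereal ((ln (Z q y a) - ln K) / real q) \<le> ks_entropy \<mu> shift_map + ereal (integral\<^sup>L \<mu> f)"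
    "\<And>g b. g \<in> borel_measurable (restrict_space borel Y) \<Longrightarrow> (\<And>z. z \<in> Y \<Longrightarrow> \<bar>g z\<bar> \<le> b) \<Longrightarrow>
      integral\<^sup>L \<mu> (\<lambda>x. g (\<pi> x)) = birkhoff_sum q g y / real q"
    by (rule loop_measure[OF y q lp]) blast
  obtain Bh where Bh: "\<And>x. x \<in> Y \<Longrightarrow> \<bar>h x\<bar> \<le> Bh"
    by (rule continuous_on_subshift_bounded[OF subshift_Y h]) blast
  have hm: "h \<in> borel_measurable (restrict_space borel Y)" by (rule borel_measurable_continuous_on_restrict[OF h])
  define d where "d = (ln (Z q y a) - ln K - birkhoff_sum q h y) / real q"
  have int_F: "integral\<^sup>L \<mu> (\<lambda>x. f x - h (\<pi> x)) = integral\<^sup>L \<mu> f - birkhoff_sum q h y / real q"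
  proof -
    have "integrable \<mu> f"
      by (rule X_integrable[OF \<mu>(1) borel_measurable_continuous_on_restrict[OF cont_f] B])
    moreover have "integrable \<mu> (\<lambda>x. h (\<pi> x))"
      by (rule X_integrable[OF \<mu>(1) measurable_compose[OF pi_measurable hm], of Bh]) (auto intro: Bh pi_in)
    ultimately show ?thesis using \<mu>(3)[OF hm Bh] by simp
  qed
  have bound: "d \<le> ln (real q + 1) / real n" if n: "n \<ge> 1" for n
  proof -
    obtain t where t: "t \<ge> 0" "free_Y (penalty q y n t) \<le> ereal (ln (real q + 1) / real n)"
      by (rule free_penalty_le[OF q n])
    have "integral\<^sup>L \<mu> (\<lambda>x. penalty q y n t (\<pi> x)) = birkhoff_sum q (penalty q y n t) y / real q"
      by (rule \<mu>(3)[of _ t]) (auto intro: borel_measurable_continuous_on_restrict penalty_continuous penalty_bound[OF t(1)])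
    then have pen: "integral\<^sup>L \<mu> (\<lambda>x. penalty q y n t (\<pi> x)) = 0"
      by (simp add: birkhoff_sum_def penalty_orbit[OF y(2) q])
    have "ereal d = ereal ((ln (Z q y a) - ln K) / real q) + ereal (- (birkhoff_sum q h y / real q))"
      by (simp add: d_def diff_divide_distrib)
    also have "\<dots> \<le> ks_entropy \<mu> shift_map + ereal (integral\<^sup>L \<mu> f) + ereal (- (birkhoff_sum q h y / real q))"
      by (intro add_right_mono \<mu>(2))
    also have "\<dots> = ks_entropy \<mu> shift_map + ereal (integral\<^sup>L \<mu> (\<lambda>x. f x - h (\<pi> x)))
        + ereal (integral\<^sup>L \<mu> (\<lambda>x. penalty q y n t (\<pi> x)))"
      unfolding int_F pen by (simp add: add.assoc)
    also have "\<dots> \<le> (SUP \<mu> \<in> invariant_measures X. ks_entropy \<mu> shift_map + ereal (\<integral>x. f x - h (\<pi> x) \<partial>\<mu>)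
        + ereal (\<integral>x. penalty q y n t (\<pi> x) \<partial>\<mu>))"
      by (rule SUP_upper[OF \<mu>(1)])
    also have "\<dots> = free_Y (penalty q y n t)"
      using comp penalty_continuous unfolding compensation_function_def by blast
    finally have "ereal d \<le> free_Y (penalty q y n t)" .
    then have "ereal d \<le> ereal (ln (real q + 1) / real n)" using t(2) by (rule order_trans)
    then show ?thesis by simp
  qed
  have "d \<le> 0"
    by (rule LIMSEQ_le_const[OF lim_const_over_n[of "ln (real q + 1)"]]) (use bound in blast)
  then have "ln (Z q y a) - ln K - birkhoff_sum q h y \<le> 0"
    using q by (simp add: d_def divide_le_0_iff)
  moreover have "ln K \<ge> 0" using K1 by simp
  ultimately show ?thesis by linarith
qed

lemma sum_weights_le: "(\<Sum>u\<in>words_of_length X n. W u) \<le> M ^ n"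
proof -
  have "(\<Sum>u\<in>words_of_length X n. W u) \<le> (\<Sum>u\<in>words_of_length X n. exp B ^ n)"
    using weight_exp_le by (intro sum_mono) (auto simp: words_of_length_words)
  also have "\<dots> = real (card (words_of_length X n)) * exp B ^ n" by simp
  also have "card (words_of_length X n) \<le> k ^ n"
    by (rule finite_words_of_length(2)[OF subshift_X]) (rule k)
  finally show ?thesis by (simp add: M_def power_mult_distrib mult_right_mono)
qed

text \<open>If the excess were below \<open>- d < 0\<close>, the fibre sums over the orbit would decay relative to \<open>exp (S\<^sub>n h)\<close> like \<open>exp (- d n)\<close>.
  With a penalty that makes all other words equally negligible, the \<open>X\<close> side of the variational identity
  would be at most \<open>- d / 2 + o(1)\<close>, whereas the \<open>Y\<close> side is nonnegative because of the measure on the orbit.\<close>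

lemma excess_nonneg_if_compensation:
  assumes y: "y \<in> Y" "(shift_map ^^ q) y = y" and q: "q \<ge> 1" and h: "continuous_on Y h"
    and comp: "compensation_function X Y \<pi> (\<lambda>x. f x - h (\<pi> x))"
  shows "excess h y \<ge> 0"
proof (rule ccontr)
  assume "\<not> excess h y \<ge> 0"
  then have "excess h y < ereal 0" by (simp add: zero_ereal_def)
  then obtain d' where d': "excess h y < ereal d'" "d' < 0"
    using ereal_dense2[of "excess h y" "ereal 0"] by auto
  define d where "d = - d'"
  have d: "d > 0" using d' by (simp add: d_def)
  have "\<forall>\<^sub>F n in sequentially. ereal ((ln (G n y) - birkhoff_sum n h y) / real n) < ereal d'"
    using d'(1) unfolding excess_def by (rule Limsup_lessD)
  then obtain n0 where n0: "\<And>n. n \<ge> n0 \<Longrightarrow> (ln (G n y) - birkhoff_sum n h y) / real n < - d"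
    by (auto simp: eventually_sequentially d_def)
  define c where "c = birkhoff_sum q h y / real q"
  obtain C where C: "\<And>n. \<bar>birkhoff_sum n h y - real n * c\<bar> \<le> C"
    unfolding c_def by (rule birkhoff_sum_periodic_bound[OF y q h]) blast
  have C0: "C \<ge> 0" using C[of 0] by simp
  obtain Bh where Bh: "Bh \<ge> 0" "\<And>y n. y \<in> Y \<Longrightarrow> \<bar>birkhoff_sum n h y\<bar> \<le> real n * Bh"
    by (rule h_bound[OF h]) blast
  obtain Bh' where Bh': "\<And>x. x \<in> Y \<Longrightarrow> \<bar>h x\<bar> \<le> Bh'"
    by (rule continuous_on_subshift_bounded[OF subshift_Y h]) blast
  have "d / 2 > 0" using d by simp
  then obtain Cv where Cv: "Cv \<ge> 0" "\<And>n x y. x \<in> Y \<Longrightarrow> y \<in> Y \<Longrightarrow> (\<And>i. i < n \<Longrightarrow> x i = y i) \<Longrightarrow>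
    \<bar>birkhoff_sum n h x - birkhoff_sum n h y\<bar> \<le> d / 2 * real n + Cv"
    by (rule birkhoff_sum_variation[OF subshift_Y h]) blast
  have lnM: "ln M \<ge> 0" using M1 by simp
  define C' where "C' = real q * ln M + C + real q * \<bar>c - d\<bar>"
  have orbit_G: "ln (G n ((shift_map ^^ i) y)) \<le> real n * (c - d) + C'" if n: "n \<ge> n0 + q + 1" and i: "i < q" for n i
  proof -
    let ?z = "(shift_map ^^ i) y" and ?j = "q - i"
    have z: "?z \<in> Y" by (rule Y_funpow[OF y(1)])
    have return_y: "(shift_map ^^ ?j) ?z = y"
    proof -
      have "(shift_map ^^ ?j) ?z = (shift_map ^^ (?j + i)) y" by (simp only: funpow_add comp_apply)
      then show ?thesis using y(2) i by simp
    qed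
    have nj: "n = ?j + (n - ?j)" "n - ?j \<ge> n0" "n - ?j \<ge> 1" using n i by auto
    have "G n ?z \<le> M ^ ?j * G (n - ?j) y"
      using G_add_const'[OF z, of ?j "n - ?j"] nj(1) return_y by simp
    also have "\<dots> \<le> M ^ q * G (n - ?j) y"
      using M1 G_pos[OF y(1), of "n - ?j"] by (intro mult_right_mono power_increasing) auto
    finally have "ln (G n ?z) \<le> ln (M ^ q * G (n - ?j) y)" using G_pos[OF z, of n] by simp
    also have "\<dots> = real q * ln M + ln (G (n - ?j) y)"
      using M1 G_pos[OF y(1), of "n - ?j"] by (simp add: ln_mult ln_realpow)
    finally have 1: "ln (G n ?z) \<le> real q * ln M + ln (G (n - ?j) y)" .
    have "ln (G (n - ?j) y) - birkhoff_sum (n - ?j) h y < - d * real (n - ?j)"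
      using n0[OF nj(2)] nj(3) by (simp add: pos_divide_less_eq)
    then have 2: "ln (G (n - ?j) y) \<le> real (n - ?j) * (c - d) + C"
      using C[of "n - ?j"] by (simp add: algebra_simps abs_le_iff)
    have "real (n - ?j) = real n - real ?j" using n i by (intro of_nat_diff) auto
    then have "real (n - ?j) * (c - d) = real n * (c - d) - real ?j * (c - d)" by (simp add: algebra_simps)
    also have "- (real ?j * (c - d)) \<le> real ?j * \<bar>c - d\<bar>"
      by (metis abs_ge_minus_self mult_left_mono mult_minus_right of_nat_0_le_iff)
    then have "real n * (c - d) - real ?j * (c - d) \<le> real n * (c - d) + real ?j * \<bar>c - d\<bar>" by simp
    also have "real ?j * \<bar>c - d\<bar> \<le> real q * \<bar>c - d\<bar>" by (intro mult_right_mono) auto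
    finally have 3: "real (n - ?j) * (c - d) \<le> real n * (c - d) + real q * \<bar>c - d\<bar>" by simp
    show ?thesis using 1 2 3 unfolding C'_def by linarith
  qed
  define E where "E = exp (C' + 2 * C + Cv)"
  have contra: "0 \<le> - d / 2 + ln (real q * E + 1) / real n" if n: "n \<ge> n0 + q + 1" for n
  proof -
    have n1: "n \<ge> 1" using n by simp
    (* M^n bounds the sum of all weights and exp (n Bh) the factor from h, so words off the orbit contribute at most exp (- n d / 2). *)
    define t where "t = real n * (ln M + Bh + d / 2)"
    have t0: "t \<ge> 0" using lnM Bh(1) d by (simp add: t_def)
    (* An upper bound for - S_n h plus the penalty, in terms of the word below. *)
    define Hv where "Hv v = (if v \<in> orbit_words q y n then - (real n * c) + 2 * C + d / 2 * real n + Cv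
      else real n * Bh - t)" for v
    let ?s = "\<lambda>u. ln (W u) + Hv (map \<Phi> u)"
    let ?S = "words_of_length X n"
    have fin: "finite ?S" by (rule finite_words_of_length(1)[OF subshift_X])
    have Wpos: "W u > 0" if "u \<in> ?S" for u using that by (intro weight_pos) (simp add: words_of_length_words)
    have hs: "- birkhoff_sum n h z + birkhoff_sum n (penalty q y n t) z \<le> Hv (word_at z 0 n)" if z: "z \<in> Y" for z
    proof (cases "word_at z 0 n \<in> orbit_words q y n")
      case True
      then obtain i where i: "word_at z 0 n = word_at y i n" by (auto simp: orbit_words_def)
      let ?w = "(shift_map ^^ i) y"
      have w: "?w \<in> Y" by (rule Y_funpow[OF y(1)])
      have "\<bar>birkhoff_sum n h z - birkhoff_sum n h ?w\<bar> \<le> d / 2 * real n + Cv"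
        by (rule Cv(2)[OF z w]) (use i in \<open>auto simp: word_at_eq_iff shift_map_funpow add.commute\<close>)
      moreover have "birkhoff_sum n h ?w = birkhoff_sum (i + n) h y - birkhoff_sum i h y"
        by (simp add: birkhoff_sum_add)
      moreover have "real (i + n) * c = real i * c + real n * c" by (simp add: algebra_simps)
      ultimately have "- birkhoff_sum n h z \<le> - (real n * c) + 2 * C + d / 2 * real n + Cv"
        using C[of "i + n"] C[of i] by linarith
      moreover have "birkhoff_sum n (penalty q y n t) z \<le> 0"
        using penalty_sum_le[OF t0 n1, of q y z] True by (simp add: penalty_def)
      ultimately show ?thesis using True by (simp add: Hv_def)
    next
      case False
      then have "birkhoff_sum n (penalty q y n t) z \<le> - t"
        using penalty_sum_le[OF t0 n1, of q y z] by (simp add: penalty_def)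
      then show ?thesis using Bh(2)[OF z, of n] False by (simp add: Hv_def)
    qed
    have sum_le: "(\<Sum>u\<in>?S. exp (?s u)) \<le> exp (- d / 2 * real n) * (real q * E + 1)"
    proof -
      let ?A = "{u \<in> ?S. map \<Phi> u \<in> orbit_words q y n}" and ?B = "{u \<in> ?S. map \<Phi> u \<notin> orbit_words q y n}"
      have "(\<Sum>u\<in>?S. exp (?s u)) = (\<Sum>u\<in>?S. W u * exp (Hv (map \<Phi> u)))"
        using Wpos by (intro sum.cong refl) (simp add: exp_add)
      also have "\<dots> = (\<Sum>u\<in>?A. W u * exp (Hv (map \<Phi> u))) + (\<Sum>u\<in>?B. W u * exp (Hv (map \<Phi> u)))"
        using fin by (subst sum.union_disjoint[symmetric]) (auto intro!: sum.cong)
      also have "(\<Sum>u\<in>?B. W u * exp (Hv (map \<Phi> u))) \<le> exp (- d / 2 * real n)"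
      proof -
        have "(\<Sum>u\<in>?B. W u * exp (Hv (map \<Phi> u))) = (\<Sum>u\<in>?B. W u) * exp (real n * Bh - t)"
          unfolding sum_distrib_right by (intro sum.cong refl) (simp add: Hv_def)
        also have "(\<Sum>u\<in>?B. W u) \<le> (\<Sum>u\<in>?S. W u)"
          using fin Wpos by (intro sum_mono2) (auto intro: less_imp_le)
        also have "\<dots> \<le> M ^ n" by (rule sum_weights_le)
        also have "M ^ n * exp (real n * Bh - t) = exp (- d / 2 * real n)"
        proof -
          have "M ^ n = exp (real n * ln M)" using M1 by (simp add: exp_of_nat_mult)
          then show ?thesis by (simp add: t_def exp_add[symmetric] algebra_simps)
        qed
        finally show ?thesis by (simp add: mult_right_mono)
      qed
      also have "(\<Sum>u\<in>?A. W u * exp (Hv (map \<Phi> u))) \<le> exp (- d / 2 * real n) * (real q * E)"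
      proof -
        let ?x = "- (real n * c) + 2 * C + d / 2 * real n + Cv"
        have "(\<Sum>u\<in>?A. W u * exp (Hv (map \<Phi> u))) = (\<Sum>u\<in>?A. W u) * exp ?x"
          unfolding sum_distrib_right by (intro sum.cong refl) (simp add: Hv_def)
        also have "(\<Sum>u\<in>?A. W u) \<le> (\<Sum>i<q. G n ((shift_map ^^ i) y))"
        proof -
          have sub: "?A \<subseteq> (\<Union>i<q. FW n ((shift_map ^^ i) y))"
            by (auto simp: orbit_words_def fibre_words_def word_at_funpow)
          have "(\<Sum>u\<in>?A. W u) \<le> (\<Sum>u\<in>(\<Union>i<q. FW n ((shift_map ^^ i) y)). W u)"
            by (intro sum_mono2 sub) (auto intro: less_imp_le weight_pos fibre_wordsD)
          also have "\<dots> \<le> (\<Sum>i<q. \<Sum>u\<in>FW n ((shift_map ^^ i) y). W u)"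
            by (rule sum_UN_le) (auto intro: less_imp_le weight_pos fibre_wordsD)
          finally show ?thesis by (simp add: fibre_sum_def)
        qed
        also have "(\<Sum>i<q. G n ((shift_map ^^ i) y)) \<le> (\<Sum>i<q. exp (real n * (c - d) + C'))"
        proof (rule sum_mono)
          fix i assume "i \<in> {..<q}"
          then have "ln (G n ((shift_map ^^ i) y)) \<le> real n * (c - d) + C'" by (intro orbit_G[OF n]) simp
          then show "G n ((shift_map ^^ i) y) \<le> exp (real n * (c - d) + C')"
            using G_pos[OF Y_funpow[OF y(1)], of n i] by (metis exp_le_cancel_iff exp_ln)
        qed
        also have "\<dots> = real q * exp (real n * (c - d) + C')" by simp
        also have "real q * exp (real n * (c - d) + C') * exp ?x = exp (- d / 2 * real n) * (real q * E)"
          by (simp add: E_def exp_add[symmetric] algebra_simps)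
        finally show ?thesis by (simp add: mult_right_mono)
      qed
      finally show ?thesis by (simp add: algebra_simps)
    qed
    have le: "ks_entropy \<mu> shift_map + ereal (\<integral>x. f x - h (\<pi> x) \<partial>\<mu>) + ereal (\<integral>x. penalty q y n t (\<pi> x) \<partial>\<mu>)
      \<le> ereal (- d / 2 + ln (real q * E + 1) / real n)" if \<mu>: "\<mu> \<in> invariant_measures X" for \<mu>
    proof -
      interpret shift_system \<mu> X by (rule shift_systemI[OF \<mu> subshift_X])
      let ?F = "\<lambda>x. (f x - h (\<pi> x)) + penalty q y n t (\<pi> x)"
      have hm: "h \<in> borel_measurable (restrict_space borel Y)" by (rule borel_measurable_continuous_on_restrict[OF h])
      have pm: "penalty q y n t \<in> borel_measurable (restrict_space borel Y)"
        by (rule borel_measurable_continuous_on_restrict[OF penalty_continuous])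
      have m1: "(\<lambda>x. f x - h (\<pi> x)) \<in> borel_measurable (restrict_space borel X)"
        by (intro borel_measurable_diff borel_measurable_continuous_on_restrict[OF cont_f] measurable_compose[OF pi_measurable hm])
      have m2: "(\<lambda>x. penalty q y n t (\<pi> x)) \<in> borel_measurable (restrict_space borel X)"
        by (rule measurable_compose[OF pi_measurable pm])
      have b1: "\<bar>f x - h (\<pi> x)\<bar> \<le> B + Bh'" if "x \<in> X" for x
        using B[OF that] Bh'[OF pi_in[OF that]] by linarith
      have b2: "\<bar>penalty q y n t (\<pi> x)\<bar> \<le> t" for x by (rule penalty_bound[OF t0])
      have "integral\<^sup>L \<mu> ?F = (\<integral>x. f x - h (\<pi> x) \<partial>\<mu>) + (\<integral>x. penalty q y n t (\<pi> x) \<partial>\<mu>)"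
        by (rule Bochner_Integration.integral_add[OF X_integrable[OF \<mu> m1 b1] X_integrable[OF \<mu> m2 b2]])
      then have eq: "ks_entropy \<mu> shift_map + ereal (\<integral>x. f x - h (\<pi> x) \<partial>\<mu>) + ereal (\<integral>x. penalty q y n t (\<pi> x) \<partial>\<mu>)
        = ks_entropy \<mu> shift_map + ereal (integral\<^sup>L \<mu> ?F)" by (simp add: add.assoc)
      have "ks_entropy \<mu> shift_map + ereal (integral\<^sup>L \<mu> ?F) \<le> ereal (ln (\<Sum>u\<in>?S. exp (?s u)) / real n)"
      proof (rule free_energy_le[OF _ _ n1, of _ "B + Bh' + t"])
        show "?F \<in> borel_measurable \<mu>"
          using borel_measurable_add[OF m1 m2] sets_M by (simp cong: measurable_cong_sets)
        show "\<bar>?F x\<bar> \<le> B + Bh' + t" if "x \<in> X" for x using b1[OF that] b2[of x] by linarith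
        fix x assume x: "x \<in> X"
        have "birkhoff_sum n ?F x = birkhoff_sum n f x - birkhoff_sum n h (\<pi> x) + birkhoff_sum n (penalty q y n t) (\<pi> x)"
          by (simp add: birkhoff_sum_def sum.distrib sum_subtractf pi_funpow[OF x])
        moreover have "birkhoff_sum n f x \<le> ln (W (word_at x 0 n))"
        proof -
          have "x \<in> cylinder X (word_at x 0 n)" using x by (simp add: in_cylinder_word_at)
          from weight_ge[OF this] have "exp (birkhoff_sum n f x) \<le> W (word_at x 0 n)" by simp
          then have "ln (exp (birkhoff_sum n f x)) \<le> ln (W (word_at x 0 n))" by (intro ln_mono) auto
          then show ?thesis by simp
        qed
        ultimately show "birkhoff_sum n ?F x \<le> ln (W (word_at x 0 n)) + Hv (map \<Phi> (word_at x 0 n))"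
          using hs[OF pi_in[OF x]] unfolding pi_word_at[OF x] by linarith
      qed
      also have "ln (\<Sum>u\<in>?S. exp (?s u)) / real n \<le> (- d / 2 * real n + ln (real q * E + 1)) / real n"
      proof (rule divide_right_mono)
        have "?S \<noteq> {}" using wd_words[of n] not_empty by auto
        then have pos: "(\<Sum>u\<in>?S. exp (?s u)) > 0" using fin by (intro sum_pos) auto
        have "real q * E + 1 > 0" by (simp add: E_def add_nonneg_pos)
        then have "ln (exp (- d / 2 * real n) * (real q * E + 1)) = - d / 2 * real n + ln (real q * E + 1)"
          by (simp add: ln_mult)
        moreover have "ln (\<Sum>u\<in>?S. exp (?s u)) \<le> ln (exp (- d / 2 * real n) * (real q * E + 1))"
          using pos sum_le by (intro ln_mono) auto
        ultimately show "ln (\<Sum>u\<in>?S. exp (?s u)) \<le> - d / 2 * real n + ln (real q * E + 1)" by linarith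
      qed simp
      also have "(- d / 2 * real n + ln (real q * E + 1)) / real n = - d / 2 + ln (real q * E + 1) / real n"
        using n1 by (simp add: field_simps)
      finally show ?thesis unfolding eq by simp
    qed
    have "0 \<le> free_Y (penalty q y n t)" by (rule free_penalty_nonneg[OF y q t0])
    also have "free_Y (penalty q y n t) = (SUP \<mu> \<in> invariant_measures X. ks_entropy \<mu> shift_map
        + ereal (\<integral>x. f x - h (\<pi> x) \<partial>\<mu>) + ereal (\<integral>x. penalty q y n t (\<pi> x) \<partial>\<mu>))"
      by (rule sym) (use comp penalty_continuous in \<open>unfold compensation_function_def, blast\<close>)
    also have "\<dots> \<le> ereal (- d / 2 + ln (real q * E + 1) / real n)" by (rule SUP_least) (rule le)
    finally show ?thesis by (simp add: zero_ereal_def)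
  qed
  have "(\<lambda>n. - d / 2 + ln (real q * E + 1) / real n) \<longlonglongrightarrow> - d / 2 + 0"
    by (intro tendsto_add tendsto_const lim_const_over_n)
  then have "0 \<le> - d / 2 + 0" by (rule LIMSEQ_le_const) (use contra in blast)
  then show False using d by simp
qed

end

section \<open>The equivalent conditions and their consequences\<close>

lemma factor_system_exists:
  assumes X: "one_step_sft X" "irreducible_shift X" "X \<noteq> {}" and Y: "subshift Y"
    and \<pi>: "factor_map X Y \<pi>" "one_block X \<pi> \<Phi>" and f: "bowen_class X f"
  obtains K B k N where "factor_system X Y \<pi> \<Phi> f K B k N"
proof -
  have sub: "subshift X" by (rule one_step_sft_subshift[OF X(1)])
  have cf: "continuous_on X f" using f by (simp add: bowen_class_def)
  obtain K0 where K0: "\<And>n x y. n \<ge> 1 \<Longrightarrow> x \<in> X \<Longrightarrow> y \<in> X \<Longrightarrow> (\<forall>i<n. x i = y i) \<Longrightarrow>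
      exp (birkhoff_sum n f x) / exp (birkhoff_sum n f y) \<le> K0"
    using f unfolding bowen_class_def by blast
  have K: "exp (birkhoff_sum n f x) \<le> max 1 K0 * exp (birkhoff_sum n f y)"
    if "x \<in> X" "y \<in> X" "\<And>i. i < n \<Longrightarrow> x i = y i" for n x y
  proof (cases "n = 0")
    case False
    then have "exp (birkhoff_sum n f x) / exp (birkhoff_sum n f y) \<le> max 1 K0"
      using K0[of n x y] that by (intro max.coboundedI2) auto
    then show ?thesis by (simp add: pos_divide_le_eq)
  qed simp
  obtain B where B: "B \<ge> 0" "\<And>x. x \<in> X \<Longrightarrow> \<bar>f x\<bar> \<le> B"
    by (rule continuous_on_subshift_bounded[OF sub cf]) blast
  obtain k where k: "k \<ge> 1" "\<And>x i. x \<in> X \<Longrightarrow> x i \<in> {1..k}" by (rule subshift_bound[OF sub]) blast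
  have fin: "finite (symbols X)"
    by (rule finite_subset[of _ "{1..k}"]) (use k(2) in \<open>auto simp: symbols_def\<close>)
  have single: "[a] \<in> words X" if a: "a \<in> symbols X" for a
  proof -
    obtain x where x: "x \<in> X" "a = x 0" using a by (auto simp: symbols_def)
    then have "[a] = word_at x 0 1" by (simp add: word_at_def)
    then have "[a] \<in> words_of_length X 1" unfolding words_of_length_eq[OF sub X(3)] using x(1) by blast
    then show ?thesis by (simp add: words_of_length_words)
  qed
  then have "\<exists>w. [a] @ w @ [b] \<in> words X" if "a \<in> symbols X" "b \<in> symbols X" for a b
    using X(2) that unfolding irreducible_shift_def by blast
  then obtain w where w: "\<And>a b. a \<in> symbols X \<Longrightarrow> b \<in> symbols X \<Longrightarrow> [a] @ w a b @ [b] \<in> words X" by metis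
  define N where "N = Max (insert 0 ((\<lambda>(a, b). length (w a b)) ` (symbols X \<times> symbols X)))"
  have N: "length (w a b) \<le> N" if "a \<in> symbols X" "b \<in> symbols X" for a b
    unfolding N_def by (rule Max_ge) (use that fin in auto)
  have "factor_system X Y \<pi> \<Phi> f (max 1 K0) B k N"
  proof
    show "\<exists>w. length w \<le> N \<and> [a] @ w @ [b] \<in> words X" if "a \<in> symbols X" "b \<in> symbols X" for a b
      using N[OF that] w[OF that] by blast
  qed (use X Y \<pi> cf K B k in auto)
  then show ?thesis by (rule that)
qed

context factor_system
begin

lemma Y_nonempty: "Y \<noteq> {}" using nonempty by (simp add: Y_eq)

lemma uniformly_close_if_periodic:
  assumes h: "continuous_on Y h"
    and L: "\<And>y q. y \<in> Y \<Longrightarrow> q \<ge> 1 \<Longrightarrow> (shift_map ^^ q) y = y \<Longrightarrow> birkhoff_sum q h y \<le> ln (G q y)"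
    and U: "\<And>y q a. y \<in> Y \<Longrightarrow> q \<ge> 1 \<Longrightarrow> (shift_map ^^ q) y = y \<Longrightarrow> loops X \<Phi> q y a \<noteq> {} \<Longrightarrow>
      ln (Z q y a) \<le> birkhoff_sum q h y + 2 * ln K"
  shows "\<exists>D. uniformly_close Y (gfun X \<Phi> f) h D"
proof -
  have "\<exists>C. \<forall>n\<ge>1. \<forall>y\<in>Y. \<bar>ln (gfun X \<Phi> f n y) - birkhoff_sum n h y\<bar> \<le> e * real n + C" if e: "e > 0" for e
  proof -
    obtain C where "\<And>n y. n \<ge> 1 \<Longrightarrow> y \<in> Y \<Longrightarrow> \<bar>ln (gfun X \<Phi> f n y) - birkhoff_sum n h y\<bar> \<le> e * real n + C"
      by (rule uniform_estimate_if_periodic_estimates[OF h e L U]) blast+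
    then show ?thesis by blast
  qed
  then show ?thesis by (rule uniformly_closeI[OF Y_nonempty, of "gfun X \<Phi> f" h]) blast+
qed

text \<open>Excess zero at a periodic point provides both the lower bound for one period and the upper bound for the loops.\<close>

lemma uniformly_close_if_excess_zero:
  assumes h: "continuous_on Y h"
    and ex: "\<And>y. y \<in> Y \<Longrightarrow> periodic_point y \<Longrightarrow> excess h y = 0"
  shows "\<exists>D. uniformly_close Y (gfun X \<Phi> f) h D"
proof (rule uniformly_close_if_periodic[OF h])
  fix y q assume y: "y \<in> Y" "q \<ge> 1" "(shift_map ^^ q) y = y"
  then have e: "excess h y = 0" by (intro ex) (auto simp: periodic_point_def)
  show "birkhoff_sum q h y \<le> ln (G q y)"
    by (rule fibre_sum_lower_if_excess_nonneg[OF y(1,3,2) h]) (simp add: e)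
  show "ln (Z q y a) \<le> birkhoff_sum q h y + 2 * ln K" if "loops X \<Phi> q y a \<noteq> {}" for a
    by (rule loop_sum_upper_if_excess_nonpos[OF y(1,3,2) _ that]) (simp add: e)
qed

lemma excess_zero_if_limit:
  assumes "y \<in> Y" "(\<lambda>n. ln (gfun X \<Phi> f n y / exp (birkhoff_sum n h y)) / real n) \<longlonglongrightarrow> 0"
  shows "excess h y = 0"
  unfolding gfun_limsup[OF assms(1), symmetric]
  using assms(2) by (intro lim_imp_Limsup) (auto simp: zero_ereal_def)

lemma uniformly_close_if_compensation:
  assumes h: "continuous_on Y h" and comp: "compensation_function X Y \<pi> (\<lambda>x. f x - h (\<pi> x))"
  shows "\<exists>D. uniformly_close Y (gfun X \<Phi> f) h D"
proof (rule uniformly_close_if_periodic[OF h])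
  fix y q assume y: "y \<in> Y" "q \<ge> 1" "(shift_map ^^ q) y = y"
  show "birkhoff_sum q h y \<le> ln (G q y)"
    by (rule fibre_sum_lower_if_excess_nonneg[OF y(1,3,2) h excess_nonneg_if_compensation[OF y(1,3,2) h comp]])
  show "ln (Z q y a) \<le> birkhoff_sum q h y + 2 * ln K" if "loops X \<Phi> q y a \<noteq> {}" for a
    by (rule loop_sum_upper_if_compensation[OF y(1,3,2) h comp that])
qed

lemma uniformly_close_if_integrals:
  assumes h: "continuous_on Y h"
    and int: "\<forall>\<mu>\<in>invariant_measures Y. (\<integral>y. real_of_ereal (rel_pressure X \<pi> f y) \<partial>\<mu>) = (\<integral>y. h y \<partial>\<mu>)"
  shows "\<exists>D. uniformly_close Y (gfun X \<Phi> f) h D"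
proof (rule uniformly_close_if_excess_zero[OF h])
  fix y assume y: "y \<in> Y" "periodic_point y"
  then obtain q where q: "q \<ge> 1" "(shift_map ^^ q) y = y" by (auto simp: periodic_point_def)
  show "excess h y = 0"
    by (rule excess_zero_if_integrals_agree[OF y(1) q(2,1) h]) (use int in blast)
qed

lemma uniformly_close_if_sup_norm:
  assumes h: "continuous_on Y h"
    and lim: "(\<lambda>n. sup_norm_on Y (\<lambda>y. ln (gfun X \<Phi> f n y / exp (birkhoff_sum n h y))) / real n) \<longlonglongrightarrow> 0"
  shows "uniformly_close Y (gfun X \<Phi> f) h (\<lambda>n. sup_norm_on Y (\<lambda>y. ln (gfun X \<Phi> f n y / exp (birkhoff_sum n h y))))"
  unfolding uniformly_close_def
proof (intro conjI lim allI impI ballI)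
  fix n :: nat and y assume y: "y \<in> Y"
  obtain Bh where Bh: "Bh \<ge> 0" "\<And>y n. y \<in> Y \<Longrightarrow> \<bar>birkhoff_sum n h y\<bar> \<le> real n * Bh"
    by (rule h_bound[OF h]) blast
  have eq: "ln (gfun X \<Phi> f n z / exp (birkhoff_sum n h z)) = ln (gfun X \<Phi> f n z) - birkhoff_sum n h z" if "z \<in> Y" for z
    using gfun_pos[OF that, of n] by (simp add: ln_div)
  have "\<bar>ln (gfun X \<Phi> f n z / exp (birkhoff_sum n h z))\<bar> \<le> ln K + real n * ln M + real n * Bh" if "z \<in> Y" for z
    using ln_gfun[OF that, of n] ln_G_bounds[OF that, of n] Bh(2)[OF that, of n] unfolding eq[OF that] by linarith
  then have "bdd_above ((\<lambda>z. \<bar>ln (gfun X \<Phi> f n z / exp (birkhoff_sum n h z))\<bar>) ` Y)"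
    by (rule bdd_aboveI2)
  then have "\<bar>ln (gfun X \<Phi> f n y / exp (birkhoff_sum n h y))\<bar>
    \<le> sup_norm_on Y (\<lambda>y. ln (gfun X \<Phi> f n y / exp (birkhoff_sum n h y)))"
    unfolding sup_norm_on_def by (rule cSUP_upper[OF y])
  then show "\<bar>ln (gfun X \<Phi> f n y) - birkhoff_sum n h y\<bar>
    \<le> sup_norm_on Y (\<lambda>y. ln (gfun X \<Phi> f n y / exp (birkhoff_sum n h y)))" unfolding eq[OF y] .
qed

end

theorem corollary6p1:
  fixes X Y :: "seq set" and \<pi> :: "seq \<Rightarrow> seq" and \<Phi> :: "nat \<Rightarrow> nat" and f :: "seq \<Rightarrow> real"
  defines "g \<equiv> gfun X \<Phi> f"
  assumes "one_step_sft X" and "irreducible_shift X" and "subshift Y"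
    and "factor_map X Y \<pi>" and "one_block X \<pi> \<Phi>"
    and "bowen_class X f"
  shows
    "(\<forall>m h. gibbs Y g m \<longrightarrow> equilibrium_state Y g m \<longrightarrow> continuous_on Y h \<longrightarrow>
        ((\<forall>y\<in>Y. periodic_point y \<longrightarrow> rel_pressure X \<pi> (\<lambda>x. f x - h (\<pi> x)) y = 0) \<or>
         (\<forall>y\<in>Y. periodic_point y \<longrightarrow>
            (\<lambda>n. ln (g n y / exp (birkhoff_sum n h y)) / real n) \<longlonglongrightarrow> 0) \<or>
         compensation_function X Y \<pi> (\<lambda>x. f x - h (\<pi> x)) \<or>
         (\<forall>y\<in>Y. (\<lambda>n. ln (g n y / exp (birkhoff_sum n h y)) / real n) \<longlonglongrightarrow> 0) \<or>
         (asymptotically_additive Y g \<and>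
            (\<lambda>n. sup_norm_on Y (\<lambda>y. ln (g n y / exp (birkhoff_sum n h y))) / real n) \<longlonglongrightarrow> 0) \<or>
         (\<forall>\<mu>\<in>invariant_measures Y.
            (\<integral>y. real_of_ereal (rel_pressure X \<pi> f y) \<partial>\<mu>) = (\<integral>y. h y \<partial>\<mu>)))
        \<longrightarrow>
        weak_gibbs Y (additive_seq h) m \<and>
        (\<exists>C. subexp_almost_additive_bounds Y g C) \<and>
        ((\<exists>\<psi>. continuous_on Y \<psi> \<and> gibbs Y (additive_seq \<psi>) m) \<longrightarrow> almost_additive Y g))
     \<and>
     ((\<nexists>C. subexp_almost_additive_bounds Y g C) \<longrightarrow>
        (\<nexists>h. continuous_on Y h \<and>
           (\<forall>\<mu>\<in>invariant_measures Y.
              (\<integral>y. real_of_ereal (rel_pressure X \<pi> f y) \<partial>\<mu>) = (\<integral>y. h y \<partial>\<mu>))))"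
proof (cases "X = {}")
  case True
  then have Y: "Y = {}" using \<open>factor_map X Y \<pi>\<close> by (simp add: factor_map_def)
  have "\<not> gibbs Y g m" for m
  proof
    assume "gibbs Y g m"
    then have m: "prob_space m" "sets m = sets (restrict_space borel Y)"
      by (auto simp: gibbs_def invariant_measures_def)
    have "space m = {}" using sets_eq_imp_space_eq[OF m(2)] Y by (simp add: space_restrict_space)
    then show False using prob_space.not_empty[OF m(1)] by simp
  qed
  moreover have "subexp_almost_additive_bounds Y g (\<lambda>_ _. 1)"
    by (simp add: subexp_almost_additive_bounds_def Y)
  ultimately show ?thesis by blast
next
  case False
  obtain K B k N where "factor_system X Y \<pi> \<Phi> f K B k N"
    by (rule factor_system_exists[OF assms(2,3) False assms(4-7)])
  then interpret factor_system X Y \<pi> \<Phi> f K B k N .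
  have pos: "\<And>n y. y \<in> Y \<Longrightarrow> g n y > 0" unfolding g_def by (rule gfun_pos)
  have bounds: "\<exists>C. subexp_almost_additive_bounds Y g C" if "uniformly_close Y g h D" for h D
    using uniformly_close_subexp_bounds[OF that subshift_Y pos] by blast
  (* Convergence at all points includes convergence at the periodic ones, so five of the six alternatives remain. *)
  have close: "\<exists>D. uniformly_close Y g h D"
    if h: "continuous_on Y h" and
      "(\<forall>y\<in>Y. periodic_point y \<longrightarrow> rel_pressure X \<pi> (\<lambda>x. f x - h (\<pi> x)) y = 0) \<or>
       (\<forall>y\<in>Y. periodic_point y \<longrightarrow>
          (\<lambda>n. ln (g n y / exp (birkhoff_sum n h y)) / real n) \<longlonglongrightarrow> 0) \<or>
       compensation_function X Y \<pi> (\<lambda>x. f x - h (\<pi> x)) \<or>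
       (\<forall>y\<in>Y. (\<lambda>n. ln (g n y / exp (birkhoff_sum n h y)) / real n) \<longlonglongrightarrow> 0) \<or>
       (asymptotically_additive Y g \<and>
          (\<lambda>n. sup_norm_on Y (\<lambda>y. ln (g n y / exp (birkhoff_sum n h y))) / real n) \<longlonglongrightarrow> 0) \<or>
       (\<forall>\<mu>\<in>invariant_measures Y.
          (\<integral>y. real_of_ereal (rel_pressure X \<pi> f y) \<partial>\<mu>) = (\<integral>y. h y \<partial>\<mu>))"
      (is "?a \<or> ?a' \<or> ?b \<or> ?c \<or> ?d \<or> ?e") for h
  proof -
    from that(2) consider ?a | ?a' | ?b | ?d | ?e by blast
    then show ?thesis
    proof cases
      case 1
      have "excess h y = 0" if y: "y \<in> Y" "periodic_point y" for y
      proof -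
        obtain q where "q \<ge> 1" "(shift_map ^^ q) y = y" using y(2) by (auto simp: periodic_point_def)
        then show ?thesis using rel_pressure_periodic[OF y(1) _ _ h] 1 y by simp
      qed
      then show ?thesis unfolding g_def by (intro uniformly_close_if_excess_zero[OF h])
    next
      case 2
      then show ?thesis unfolding g_def
        by (intro uniformly_close_if_excess_zero[OF h] excess_zero_if_limit) auto
    next
      case 3
      then show ?thesis unfolding g_def by (rule uniformly_close_if_compensation[OF h])
    next
      case 4
      then show ?thesis unfolding g_def using uniformly_close_if_sup_norm[OF h] by blast
    next
      case 5
      then show ?thesis unfolding g_def by (rule uniformly_close_if_integrals[OF h])
    qed
  qed
  show ?thesis
  proof (rule conjI, (intro allI impI), goal_cases)
    case (1 m h)
    obtain D where D: "uniformly_close Y g h D" using close[OF 1(3,4)] by blast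
    show ?case
      using weak_gibbs_if_close[OF D subshift_Y Y_nonempty 1(3) pos 1(1)] bounds[OF D]
        almost_additive_if_gibbs[OF subshift_Y pos 1(1)] by blast
  next
    case 2
    show ?case
    proof (intro impI notI, elim exE conjE)
      fix h assume no: "\<nexists>C. subexp_almost_additive_bounds Y g C" and h: "continuous_on Y h"
        "\<forall>\<mu>\<in>invariant_measures Y. (\<integral>y. real_of_ereal (rel_pressure X \<pi> f y) \<partial>\<mu>) = (\<integral>y. h y \<partial>\<mu>)"
      obtain D where "uniformly_close Y g h D"
        using uniformly_close_if_integrals[OF h] unfolding g_def by blast
      then show False using bounds no by blast
    qed
  qed
qed

end
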